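(* Consider the pathwise robust Duncan–Mortensen–Zakai (DMZ) equation on $\Omega\times[0,T]$, with solution $u$, and let $\widehat{u}(\cdot,t_{N_t})=\mathcal{I}\widehat{U}_{\cdot,N_t}^{\Delta T/\tau}$ be the function recovered from the QTT (quantized tensor train) solution at the final time $t_{N_t}=T$, all as defined in the context. Assume [Asm.1]–[Asm.4], the regularity conditions (R) on $\mathbf{F}$ and $J$, and the stability condition $h<\frac{1}{C_f}$, $\tau<\big(\frac{d}{h^2}+dL_f+\frac d2C_h^2\big)^{-1}$. Then the QTT solution converges to the solution of the pathwise robust DMZ equation on the bounded domain $\Omega$ in the sense of the $L^1$ norm; specifically, there is a (generic) constant $C>0$, possibly depending on $\Omega$ but not depending on $\tau,h,\epsilon_1,\epsilon_2$, such that $$ \begin{aligned} &\big\|u(\mathbf{x},T)-\exp(-\mathbf{h}(\mathbf{x})^T\mathbf{y}_{t_{N_t-1}})\,\widehat{u}(\mathbf{x},t_{N_t})\big\|_{L^1(\Omega)}\le \frac{2c_5}{\alpha+1}\frac{T^{\alpha+1}e^{c_3T}}{N_t^{\alpha}}\\ &\quad+Ce^{c_2}\Big(\frac{Ce^{c_2N_t+TdL_f}}{dL_f\,(e^{c_2+\Delta T dL_f}-1)}(\tau+h^2)+h^2\|\Delta\widetilde{u}_{N_t}(\mathbf{x},T)\|_{L^2(\Omega)}\Big)\\ &\quad+Ce^{c_2}c_7^{N_t}\,\epsilon_1\big\|U_{\cdot,0}^{\Delta T/\tau}\big\|_2+Ce^{c_2}\sum_{j=1}^{N_t}c_7^{N_t-j}\Big((1+\epsilon_2)\epsilon_1c_6e^{c_2}\big\|U_{\cdot,j-1}^{\Delta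 T/\tau}\big\|_2+\epsilon_2c_6\big\|U_{\cdot,j}^{0}\big\|_2\Big), \end{aligned} $$ where $$c_5=c_4e^{c_3T}+c_4\sqrt{\mathrm{Vol}(\Omega)}\,e^{c_3^2T}\sqrt{2c_3^2T\int_\Omega u^2(\mathbf{x},0)\,d\mathbf{x}+\int_\Omega|\nabla u(\mathbf{x},0)|^2\,d\mathbf{x}},$$ $c_6=\|(\tau\mathbf{A}+\mathbf{I})^{\Delta T/\tau}\|_2$ and $c_7=(1+\epsilon_2)(1+\epsilon_1)c_6e^{c_2}$.
   Context: Setting. $\Omega=[-a,a]^d$ with $a>0$. The functions $\mathbf{f}=(f_1,\dots,f_d)$ (drift) and $\mathbf{h}=(h_1,\dots,h_m)$ (observation function; $m=d$, all noise covariances and the diffusion matrix are identities) are time-independent. $\mathbf{y}_t$, $t\in[0,T]$, is a given observation path in $\mathbb{R}^m$ with $\mathbf{y}_0=0$, $K(\mathbf{x},t)=\mathbf{h}(\mathbf{x})^T\mathbf{y}_t$, and $\sigma_0$ is the initial density. The partition is $t_j=j\Delta T$, $j=0,\dots,N_t$, $\Delta T=T/N_t$. The scalar $h$ denotes the mesh size and bold $\mathbf{h}$ the observation function. Pathwise robust DMZ equation on $\Omega$. $u$ solves $$\partial_tu=\tfrac12\Delta u+\mathbf{F}(\mathbf{x},t)\cdot\nabla u+J(\mathbf{x},t)u,\quad u(\mathbf{x},0)=\sigma_0(\mathbf{x}),\quad u|_{\partial\Omega}=0,$$ with $\mathbf{F}=-\mathbf{f}+\nabla K$ and $J=-\mathrm{div}\,\mathbf{f}-\frac12\mathbf{h}^T\mathbf{h}+\frac12\Delta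 K-\mathbf{f}\cdot\nabla K+\frac12|\nabla K|^2$. Frozen equations. For $j=1,\dots,N_t$, $u_j$ solves on $\Omega\times[t_{j-1},t_j]$ the same equation with $\mathbf{F},J$ frozen at time $t_{j-1}$, $u_j|_{\partial\Omega}=0$, $u_j(\cdot,t_{j-1})=u_{j-1}(\cdot,t_{j-1})$, where $u_0=\sigma_0$. Put $\widetilde{u}_j(\mathbf{x},t)=\exp(\mathbf{h}(\mathbf{x})^T\mathbf{y}_{t_{j-1}})u_j(\mathbf{x},t)$; it satisfies the forward Kolmogorov equation (FKE) $$\partial_t\widetilde{u}_j=\tfrac12\Delta\widetilde{u}_j-\mathbf{f}\cdot\nabla\widetilde{u}_j-\big(\mathrm{div}\,\mathbf{f}+\tfrac12\mathbf{h}^T\mathbf{h}\big)\widetilde{u}_j .$$ The functions $\widetilde{u}_j$ are smooth on $\Omega\times[t_{j-1},t_j]$. Assumptions. [Asm.1] $-\frac12\mathbf{h}^T\mathbf{h}-\frac12\Delta K-\mathbf{f}\cdot\nabla K+\frac12|\nabla K|^2+|\mathbf{f}-\nabla K|\le c_1$ on $\mathbb{R}^d\times[0,T]$, with a constant $c_1$ possibly depending on $T$. [Asm.2] $\sup_\Omega|f_i|\le C_f<\infty$ and $|f_i(\mathbf{x}_1)-f_i(\mathbf{x}_2)|\le L_f|\mathbf{x}_1-\mathbf{x}_2|$ for $\mathbf{x}_1,\mathbf{x}_2\in\Omega$, $i=1,\dots,d$ ($C_f,L_f>0$). [Asm.3] $\sup_\Omega|h_i|\le C_h<\infty$, $i=1,\dots,m$.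 [Asm.4] $|2K|\le c_2$ on $\Omega\times\{t_0,\dots,t_{N_t}\}$. (R) $\mathbf{F}$ and $J$ are $C^\infty$ in $\mathbf{x}$ and Hölder continuous in $t$ with exponent $\alpha$ on $\Omega\times[0,T]$, and $|\mathrm{div}\,\mathbf{F}|+2|J|+|\mathbf{F}|\le c_3$ on $\Omega\times[0,T]$, $|\mathbf{F}(\mathbf{x},t)-\mathbf{F}(\mathbf{x},\bar t)|+|\mathrm{div}\,\mathbf{F}(\mathbf{x},t)-\mathrm{div}\,\mathbf{F}(\mathbf{x},\bar t)|+|J(\mathbf{x},t)-J(\mathbf{x},\bar t)|\le c_4|t-\bar t|^\alpha$ for $(\mathbf{x},t),(\mathbf{x},\bar t)\in\Omega\times[0,T]$. Finite difference (FD) solution. The uniform grid has $N$ points per direction, mesh size $h=2a/(N-1)$, grid points $\mathbf{x}_{\mathbf{l}}$, $\mathbf{l}=(l_1,\dots,l_d)$, $1\le l_i\le N$; $\mathbf{e}_i$ is the $i$th unit vector; $\tau>0$ is the time step with $\Delta T/\tau\in\mathbb{N}$. On $[t_{j-1},t_j]$, $U^n_{\mathbf{l},j}$ approximates $\widetilde{u}_j(\mathbf{x}_{\mathbf{l}},t_{j-1}+n\tau)$, vanishes at boundary grid points, and satisfies at interior grid points $$\frac{U^{n+1}_{\mathbf{l},j}-U^n_{\mathbf{l},j}}{\tau}=\frac{\sum_{i=1}^d(U^n_{\mathbf{l}+\mathbf{e}_i,j}+U^n_{\mathbf{l}-\mathbf{e}_i,j})-2dU^n_{\mathbf{l},j}}{2h^2}-\frac{\sum_{i=1}^d(f_i)_{\mathbf{l}}(U^n_{\mathbf{l}+\mathbf{e}_i,j}-U^n_{\mathbf{l}-\mathbf{e}_i,j})}{2h}-\frac{\sum_{i=1}^d((f_i)_{\mathbf{l}+\mathbf{e}_i}-(f_i)_{\mathbf{l}-\mathbf{e}_i})U^n_{\mathbf{l},j}}{2h}-\frac12(\mathbf{h}^T\mathbf{h})_{\mathbf{l}}U^n_{\mathbf{l},j}.$$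 $\mathbf{A}$ denotes the matrix of the right-hand side, so $U^{\Delta T/\tau}_{\cdot,j}=(\tau\mathbf{A}+\mathbf{I})^{\Delta T/\tau}U^0_{\cdot,j}$. Initialization: $U^{\Delta T/\tau}_{\mathbf{l},0}=\sigma_0(\mathbf{x}_{\mathbf{l}})$, $U^0_{\cdot,1}=U^{\Delta T/\tau}_{\cdot,0}$, and for $j\ge1$, $U^0_{\mathbf{l},j+1}=E_j(\mathbf{x}_{\mathbf{l}})\,U^{\Delta T/\tau}_{\mathbf{l},j}$ with $E_j(\mathbf{x})=\exp[\mathbf{h}(\mathbf{x})^T(\mathbf{y}_{t_j}-\mathbf{y}_{t_{j-1}})]$. QTT solution. Let $\widehat{E}_j$ and $\widehat{M}$ be the QTT-format (i.e. low-rank) approximations of the grid function $E_j$ and of $M=(\tau\mathbf{A}+\mathbf{I})^{\Delta T/\tau}$. The QTT solution is given by $\widehat{U}^{0}_{\cdot,1}=\widehat{U}^{\Delta T/\tau}_{\cdot,0}$, the QTT-format approximation of $U^{\Delta T/\tau}_{\cdot,0}$, and $\widehat{U}^{\Delta T/\tau}_{\cdot,j}=\widehat{M}\,\widehat{U}^0_{\cdot,j}$, $\widehat{U}^0_{\cdot,j+1}=\widehat{E}_j\circ\widehat{U}^{\Delta T/\tau}_{\cdot,j}$ (Hadamard product). The precisions $\epsilon_1,\epsilon_2\ge0$ are relative: $\|\widehat{U}^{\Delta T/\tau}_{\cdot,0}-U^{\Delta T/\tau}_{\cdot,0}\|_2\le\epsilon_1\|U^{\Delta T/\tau}_{\cdot,0}\|_2$;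 $\|\mathrm{diag}(\widehat{E}_j)-\mathrm{diag}(E_j)\|_2\le\epsilon_1\|\mathrm{diag}(E_j)\|_2$; $\|\widehat{M}-M\|_F\le\epsilon_2\|M\|_2$. Here $\|\cdot\|_2$ is the Euclidean norm of grid vectors or the spectral norm of matrices, and $\|\cdot\|_F$ is the Frobenius norm. Interpolation. $\mathcal{I}$ is a linear interpolation operator (e.g. polynomial or spline) from grid functions to functions on $\Omega$ which is bounded, $\|\mathcal{I}V\|_{L^1(\Omega)}\le C\|V\|_\infty$, and second-order accurate, $\|\mathcal{I}v-v\|_{L^1(\Omega)}\le Ch^2\|\Delta v\|_{L^2(\Omega)}$ for the smooth functions $v=\widetilde{u}_j(\cdot,t_j)$, where $\mathcal{I}v$ means $\mathcal{I}$ applied to the grid values of $v$. *)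

theory Defs
  imports "HOL-Analysis.Analysis"
begin

text \<open>
  All derivatives are taken within a set \<open>S\<close>: \<open>S = UNIV\<close> for the data \<open>f\<close>, \<open>h\<close>, which live on the
  whole space, and \<open>S = cube a\<close> for functions which are only meaningful on the closed cube. Within
  the cube the derivative is unique also at boundary points, since \<open>a > 0\<close>.
\<close>

definition cube :: "real \<Rightarrow> (real^'d) set" where
  "cube a = cbox (\<chi> i. - a) (\<chi> i. a)"

definition pderiv_within :: "(real^'d) set \<Rightarrow> 'd \<Rightarrow> (real^'d \<Rightarrow> real) \<Rightarrow> real^'d \<Rightarrow> real" where
  "pderiv_within S i g x = frechet_derivative g (at x within S) (axis i 1)"

definition grad :: "(real^'d) set \<Rightarrow> (real^'d \<Rightarrow> real) \<Rightarrow> real^'d \<Rightarrow> real^'d" where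
  "grad S g x = (\<chi> i. pderiv_within S i g x)"

definition divergence :: "(real^'d) set \<Rightarrow> (real^'d \<Rightarrow> real^'d) \<Rightarrow> real^'d \<Rightarrow> real" where
  "divergence S G x = (\<Sum>i\<in>UNIV. pderiv_within S i (\<lambda>z. G z $ i) x)"

definition laplacian :: "(real^'d) set \<Rightarrow> (real^'d \<Rightarrow> real) \<Rightarrow> real^'d \<Rightarrow> real" where
  "laplacian S g x = (\<Sum>i\<in>UNIV. pderiv_within S i (pderiv_within S i g) x)"

definition time_deriv :: "real set \<Rightarrow> (real \<Rightarrow> real) \<Rightarrow> real \<Rightarrow> real" where
  "time_deriv R g t = vector_derivative g (at t within R)"

text \<open>
  \<open>C\<^sup>\<infinity>\<close> on a set \<open>S\<close> (up to the boundary, for a closed box): \<open>D bs\<close> is the iterated partial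
  derivative in the directions \<open>bs\<close>. Continuity of all of them follows from differentiability.
\<close>

definition smooth_on :: "'a::euclidean_space set \<Rightarrow> ('a \<Rightarrow> real) \<Rightarrow> bool" where
  "smooth_on S g \<longleftrightarrow> (\<exists>D. (\<forall>x\<in>S. D [] x = g x) \<and>
     (\<forall>bs\<in>lists Basis. \<forall>x\<in>S.
        (D bs has_derivative (\<lambda>v. \<Sum>b\<in>Basis. (v \<bullet> b) * D (b # bs) x)) (at x within S)))"

definition C21_on :: "(real^'d) set \<Rightarrow> real set \<Rightarrow> (real^'d \<Rightarrow> real \<Rightarrow> real) \<Rightarrow> bool" where
  "C21_on S R u \<longleftrightarrow>
     (\<forall>x\<in>S. \<forall>t\<in>R.
        (\<lambda>z. u z t) differentiable (at x within S) \<and>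
        (\<forall>i. pderiv_within S i (\<lambda>z. u z t) differentiable (at x within S)) \<and>
        u x differentiable (at t within R)) \<and>
     continuous_on (S \<times> R) (\<lambda>(x, t). u x t) \<and>
     continuous_on (S \<times> R) (\<lambda>(x, t). time_deriv R (u x) t) \<and>
     (\<forall>i. continuous_on (S \<times> R) (\<lambda>(x, t). pderiv_within S i (\<lambda>z. u z t) x)) \<and>
     (\<forall>i k. continuous_on (S \<times> R)
        (\<lambda>(x, t). pderiv_within S k (pderiv_within S i (\<lambda>z. u z t)) x))"

definition L1_norm :: "(real^'d) set \<Rightarrow> (real^'d \<Rightarrow> real) \<Rightarrow> real" where
  "L1_norm S g = (LINT x:S|lebesgue. \<bar>g x\<bar>)"

definition L2_norm :: "(real^'d) set \<Rightarrow> (real^'d \<Rightarrow> real) \<Rightarrow> real" where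
  "L2_norm S g = sqrt (LINT x:S|lebesgue. (g x)\<^sup>2)"

definition obsK :: "(real^'d \<Rightarrow> real^'d) \<Rightarrow> (real \<Rightarrow> real^'d) \<Rightarrow> real^'d \<Rightarrow> real \<Rightarrow> real" where
  "obsK h y x t = h x \<bullet> y t"

definition dmzF ::
  "(real^'d \<Rightarrow> real^'d) \<Rightarrow> (real^'d \<Rightarrow> real^'d) \<Rightarrow> (real \<Rightarrow> real^'d) \<Rightarrow> real^'d \<Rightarrow> real \<Rightarrow> real^'d" where
  "dmzF f h y x t = - f x + grad UNIV (\<lambda>z. obsK h y z t) x"

definition dmzJ ::
  "(real^'d \<Rightarrow> real^'d) \<Rightarrow> (real^'d \<Rightarrow> real^'d) \<Rightarrow> (real \<Rightarrow> real^'d) \<Rightarrow> real^'d \<Rightarrow> real \<Rightarrow> real" where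
  "dmzJ f h y x t =
     - divergence UNIV f x - 1/2 * (h x \<bullet> h x) + 1/2 * laplacian UNIV (\<lambda>z. obsK h y z t) x
     - f x \<bullet> grad UNIV (\<lambda>z. obsK h y z t) x
     + 1/2 * (norm (grad UNIV (\<lambda>z. obsK h y z t) x))\<^sup>2"

text \<open>
  Classical solution, \<open>C\<^sup>2\<close> in space and \<open>C\<^sup>1\<close> in time up to the parabolic boundary, of
  \<open>\<partial>\<^sub>t u = \<Delta>u / 2 + F \<cdot> \<nabla>u + J u\<close> on \<open>S \<times> [t0, t1]\<close> with zero Dirichlet data and initial value \<open>g\<close>.
\<close>

definition solves_dirichlet ::
  "(real^'d) set \<Rightarrow> real \<Rightarrow> real \<Rightarrow> (real^'d \<Rightarrow> real \<Rightarrow> real^'d) \<Rightarrow> (real^'d \<Rightarrow> real \<Rightarrow> real)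
     \<Rightarrow> (real^'d \<Rightarrow> real) \<Rightarrow> (real^'d \<Rightarrow> real \<Rightarrow> real) \<Rightarrow> bool" where
  "solves_dirichlet S t0 t1 F J g u \<longleftrightarrow>
     C21_on S {t0..t1} u \<and>
     (\<forall>x\<in>interior S. \<forall>t\<in>{t0<..t1}.
        time_deriv {t0..t1} (u x) t =
          1/2 * laplacian S (\<lambda>z. u z t) x + F x t \<bullet> grad S (\<lambda>z. u z t) x + J x t * u x t) \<and>
     (\<forall>x\<in>S. u x t0 = g x) \<and>
     (\<forall>x\<in>frontier S. \<forall>t\<in>{t0..t1}. u x t = 0)"

definition tnode :: "real \<Rightarrow> nat \<Rightarrow> nat \<Rightarrow> real" where
  "tnode T Nt j = real j * (T / real Nt)"

definition utilde ::
  "(real^'d \<Rightarrow> real^'d) \<Rightarrow> (real \<Rightarrow> real^'d) \<Rightarrow> real \<Rightarrow> nat \<Rightarrow> (nat \<Rightarrow> real^'d \<Rightarrow> real \<Rightarrow> real)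
     \<Rightarrow> nat \<Rightarrow> real^'d \<Rightarrow> real \<Rightarrow> real" where
  "utilde h y T Nt uj j x t = exp (h x \<bullet> y (tnode T Nt (j - 1))) * uj j x t"

text \<open>
  A grid function is a function of the multi-index \<open>l\<close>, of which only the values on the finite set
  \<open>grid N\<close> matter; a matrix is a function of two multi-indices (row, column).
\<close>

definition grid :: "nat \<Rightarrow> ('d \<Rightarrow> nat) set" where
  "grid N = {l. \<forall>i. 1 \<le> l i \<and> l i \<le> N}"

definition grid_interior :: "nat \<Rightarrow> ('d \<Rightarrow> nat) set" where
  "grid_interior N = {l. \<forall>i. 1 < l i \<and> l i < N}"

definition grid_boundary :: "nat \<Rightarrow> ('d \<Rightarrow> nat) set" where
  "grid_boundary N = grid N - grid_interior N"

definition mesh :: "real \<Rightarrow> nat \<Rightarrow> real" where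
  "mesh a N = 2 * a / (real N - 1)"

definition gpt :: "real \<Rightarrow> nat \<Rightarrow> ('d \<Rightarrow> nat) \<Rightarrow> real^'d" where
  "gpt a N l = (\<chi> i. - a + (real (l i) - 1) * mesh a N)"

definition up :: "'d \<Rightarrow> ('d \<Rightarrow> nat) \<Rightarrow> 'd \<Rightarrow> nat" where
  "up i l = l(i := l i + 1)"

definition dn :: "'d \<Rightarrow> ('d \<Rightarrow> nat) \<Rightarrow> 'd \<Rightarrow> nat" where
  "dn i l = l(i := l i - 1)"

definition mat_vec :: "'i set \<Rightarrow> ('i \<Rightarrow> 'i \<Rightarrow> real) \<Rightarrow> ('i \<Rightarrow> real) \<Rightarrow> 'i \<Rightarrow> real" where
  "mat_vec G M V = (\<lambda>k. \<Sum>l\<in>G. M k l * V l)"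

definition diag_mat :: "('i \<Rightarrow> real) \<Rightarrow> 'i \<Rightarrow> 'i \<Rightarrow> real" where
  "diag_mat V = (\<lambda>k l. if k = l then V k else 0)"

primrec mat_power :: "'i set \<Rightarrow> ('i \<Rightarrow> 'i \<Rightarrow> real) \<Rightarrow> nat \<Rightarrow> 'i \<Rightarrow> 'i \<Rightarrow> real" where
  "mat_power G M 0 = diag_mat (\<lambda>_. 1)"
| "mat_power G M (Suc n) = (\<lambda>k l. \<Sum>p\<in>G. M k p * mat_power G M n p l)"

text \<open>
  The Euclidean norm of a grid vector is the library's \<open>L2_set V G\<close>. The spectral norm is the
  operator norm it induces.
\<close>

definition spectral_norm :: "'i set \<Rightarrow> ('i \<Rightarrow> 'i \<Rightarrow> real) \<Rightarrow> real" where
  "spectral_norm G M = Sup {L2_set (mat_vec G M V) G | V. L2_set V G \<le> 1}"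

definition frobenius_norm :: "'i set \<Rightarrow> ('i \<Rightarrow> 'i \<Rightarrow> real) \<Rightarrow> real" where
  "frobenius_norm G M = L2_set (\<lambda>(k, l). M k l) (G \<times> G)"

definition fd_rhs ::
  "real \<Rightarrow> nat \<Rightarrow> (real^'d \<Rightarrow> real^'d) \<Rightarrow> (real^'d \<Rightarrow> real^'d) \<Rightarrow> (('d \<Rightarrow> nat) \<Rightarrow> real) \<Rightarrow> ('d \<Rightarrow> nat) \<Rightarrow> real"
  where
  "fd_rhs a N f h V l =
     ((\<Sum>i\<in>UNIV. V (up i l) + V (dn i l)) - 2 * real CARD('d) * V l) / (2 * (mesh a N)\<^sup>2)
     - (\<Sum>i\<in>UNIV. f (gpt a N l) $ i * (V (up i l) - V (dn i l))) / (2 * mesh a N)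
     - (\<Sum>i\<in>UNIV. (f (gpt a N (up i l)) $ i - f (gpt a N (dn i l)) $ i) * V l) / (2 * mesh a N)
     - 1/2 * (h (gpt a N l) \<bullet> h (gpt a N l)) * V l"

text \<open>
  \<open>A\<close> represents the right-hand side of the scheme on the grid functions with zero boundary values.
  Its boundary columns only ever multiply zeros, so they are left arbitrary. This covers every
  convention for them, including a matrix that acts on the interior unknowns only.
\<close>

definition fd_matrix ::
  "real \<Rightarrow> nat \<Rightarrow> (real^'d \<Rightarrow> real^'d) \<Rightarrow> (real^'d \<Rightarrow> real^'d)
     \<Rightarrow> (('d \<Rightarrow> nat) \<Rightarrow> ('d \<Rightarrow> nat) \<Rightarrow> real) \<Rightarrow> bool" where
  "fd_matrix a N f h A \<longleftrightarrow>
     (\<forall>V. (\<forall>l\<in>grid_boundary N. V l = 0) \<longrightarrow>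
        (\<forall>l\<in>grid_interior N. mat_vec (grid N) A V l = fd_rhs a N f h V l) \<and>
        (\<forall>l\<in>grid_boundary N. mat_vec (grid N) A V l = 0))"

definition fd_propagator ::
  "nat \<Rightarrow> nat \<Rightarrow> real \<Rightarrow> (('d \<Rightarrow> nat) \<Rightarrow> ('d \<Rightarrow> nat) \<Rightarrow> real) \<Rightarrow> ('d \<Rightarrow> nat) \<Rightarrow> ('d \<Rightarrow> nat) \<Rightarrow> real" where
  "fd_propagator N n \<tau> A = mat_power (grid N) (\<lambda>k l. \<tau> * A k l + diag_mat (\<lambda>_. 1) k l) n"

definition Efun ::
  "real \<Rightarrow> nat \<Rightarrow> (real^'d \<Rightarrow> real^'d) \<Rightarrow> (real \<Rightarrow> real^'d) \<Rightarrow> real \<Rightarrow> nat \<Rightarrow> nat \<Rightarrow> ('d \<Rightarrow> nat) \<Rightarrow> real" where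
  "Efun a N h y T Nt j l = exp (h (gpt a N l) \<bullet> (y (tnode T Nt j) - y (tnode T Nt (j - 1))))"

text \<open>\<open>U j k l\<close> is the value at the multi-index \<open>l\<close> after \<open>k\<close> of the \<open>n\<close> steps on the \<open>j\<close>-th interval.\<close>

definition fd_solution ::
  "real \<Rightarrow> nat \<Rightarrow> (real^'d \<Rightarrow> real^'d) \<Rightarrow> (real^'d \<Rightarrow> real^'d) \<Rightarrow> (real \<Rightarrow> real^'d) \<Rightarrow> (real^'d \<Rightarrow> real)
     \<Rightarrow> real \<Rightarrow> nat \<Rightarrow> nat \<Rightarrow> real \<Rightarrow> (nat \<Rightarrow> nat \<Rightarrow> ('d \<Rightarrow> nat) \<Rightarrow> real) \<Rightarrow> bool" where
  "fd_solution a N f h y \<sigma>0 T Nt n \<tau> U \<longleftrightarrow>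
     (\<forall>l\<in>grid N. U 0 n l = \<sigma>0 (gpt a N l)) \<and>
     (\<forall>l\<in>grid N. U 1 0 l = U 0 n l) \<and>
     (\<forall>j\<in>{1..<Nt}. \<forall>l\<in>grid N. U (j + 1) 0 l = Efun a N h y T Nt j l * U j n l) \<and>
     (\<forall>j\<in>{1..Nt}. \<forall>k\<le>n. \<forall>l\<in>grid_boundary N. U j k l = 0) \<and>
     (\<forall>j\<in>{1..Nt}. \<forall>k<n. \<forall>l\<in>grid_interior N.
        (U j (k + 1) l - U j k l) / \<tau> = fd_rhs a N f h (U j k) l)"

text \<open>
  The QTT approximations enter through their relative precisions only: every grid function and every
  matrix has a QTT representation of sufficiently high rank, and no rank is prescribed. So \<open>Eh\<close>, \<open>Mh\<close>
  and \<open>UhT 0\<close> are arbitrary subject to the precisions. \<open>Uh0 j\<close> and \<open>UhT j\<close> are the approximations at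
  the beginning and at the end of the \<open>j\<close>-th interval.
\<close>

definition qtt_solution ::
  "real \<Rightarrow> nat \<Rightarrow> (real^'d \<Rightarrow> real^'d) \<Rightarrow> (real \<Rightarrow> real^'d) \<Rightarrow> real \<Rightarrow> nat
     \<Rightarrow> (('d \<Rightarrow> nat) \<Rightarrow> ('d \<Rightarrow> nat) \<Rightarrow> real) \<Rightarrow> (('d \<Rightarrow> nat) \<Rightarrow> real) \<Rightarrow> real \<Rightarrow> real
     \<Rightarrow> (nat \<Rightarrow> ('d \<Rightarrow> nat) \<Rightarrow> real) \<Rightarrow> (('d \<Rightarrow> nat) \<Rightarrow> ('d \<Rightarrow> nat) \<Rightarrow> real)
     \<Rightarrow> (nat \<Rightarrow> ('d \<Rightarrow> nat) \<Rightarrow> real) \<Rightarrow> (nat \<Rightarrow> ('d \<Rightarrow> nat) \<Rightarrow> real) \<Rightarrow> bool" where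
  "qtt_solution a N h y T Nt M V0 \<epsilon>1 \<epsilon>2 Eh Mh Uh0 UhT \<longleftrightarrow>
     L2_set (\<lambda>l. UhT 0 l - V0 l) (grid N) \<le> \<epsilon>1 * L2_set V0 (grid N) \<and>
     (\<forall>j\<in>{1..<Nt}.
        spectral_norm (grid N) (\<lambda>k l. diag_mat (Eh j) k l - diag_mat (Efun a N h y T Nt j) k l)
          \<le> \<epsilon>1 * spectral_norm (grid N) (diag_mat (Efun a N h y T Nt j))) \<and>
     frobenius_norm (grid N) (\<lambda>k l. Mh k l - M k l) \<le> \<epsilon>2 * spectral_norm (grid N) M \<and>
     (\<forall>l\<in>grid N. Uh0 1 l = UhT 0 l) \<and>
     (\<forall>j\<in>{1..Nt}. \<forall>l\<in>grid N. UhT j l = mat_vec (grid N) Mh (Uh0 j) l) \<and>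
     (\<forall>j\<in>{1..<Nt}. \<forall>l\<in>grid N. Uh0 (j + 1) l = Eh j l * UhT j l)"

text \<open>
  The accuracy estimate is required for the functions in \<open>\<V>\<close> only; \<open>P\<close> need not reproduce the grid
  values. The integrability clause is part of boundedness into \<open>L\<^sup>1\<close>.
\<close>

definition interp_operator ::
  "real \<Rightarrow> nat \<Rightarrow> real \<Rightarrow> (real^'d \<Rightarrow> real) set
     \<Rightarrow> ((('d \<Rightarrow> nat) \<Rightarrow> real) \<Rightarrow> real^'d \<Rightarrow> real) \<Rightarrow> bool" where
  "interp_operator a N CI \<V> P \<longleftrightarrow>
     (\<forall>V W. \<forall>x\<in>cube a. P (\<lambda>l. V l + W l) x = P V x + P W x) \<and>
     (\<forall>c V. \<forall>x\<in>cube a. P (\<lambda>l. c * V l) x = c * P V x) \<and>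
     (\<forall>V. P V absolutely_integrable_on cube a \<and>
        L1_norm (cube a) (P V) \<le> CI * Max ((\<lambda>l. \<bar>V l\<bar>) ` grid N)) \<and>
     (\<forall>v\<in>\<V>. L1_norm (cube a) (\<lambda>x. P (\<lambda>l. v (gpt a N l)) x - v x)
        \<le> CI * (mesh a N)\<^sup>2 * L2_norm (cube a) (laplacian (cube a) v))"

end

theory Submission
  imports Defs
begin

text \<open>
  The error splits into three parts, and each of them is controlled by a stability estimate in the
  norm that suits it. With \<open>v\<close> the solution of the last frozen equation, \<open>w = exp(h\<cdot>y) v\<close> its transform,
  \<open>V\<close> the final low-rank grid vector and \<open>P\<close> the interpolation,
  \<open>u(T) - exp(-h\<cdot>y) P V = (u(T) - v(T)) + exp(-h\<cdot>y) (w(T) - P w(T)) + exp(-h\<cdot>y) P (w(T) - V)\<close>,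
  where \<open>|h\<cdot>y| \<le> c\<^sub>2/2\<close> at the nodes.

  \<^bold>\<open>Freezing the coefficients.\<close> On the \<open>j\<close>-th interval the difference \<open>u - u\<^sub>j\<close> solves the equation
  frozen at its left end \<open>s\<close>, with the source \<open>(F(t) - F(s))\<cdot>\<nabla>u + (J(t) - J(s)) u\<close>. Tested with \<open>\<phi>'(u - u\<^sub>j)\<close>
  for a convex \<open>\<phi>\<close> close to the absolute value, the Laplacian contributes a nonpositive term; therefore
  \<open>exp(- c\<^sub>3 t) \<parallel>u - u\<^sub>j\<parallel>\<^sub>1\<close> grows at most by the correspondingly weighted \<open>L\<^sup>1\<close> norm of the source. The
  source is at most \<open>c\<^sub>4 (t - s)\<^sup>\<alpha> (|\<nabla>u| + |u|)\<close>. Its norm is bounded by the \<open>L\<^sup>1\<close> estimate for \<open>u\<close> itself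
  and by an \<open>H\<^sup>1\<close> energy estimate, and integrating \<open>(t - s)\<^sup>\<alpha>\<close> over the \<open>N\<^sub>t\<close> intervals gives the first
  term of the bound. The weight \<open>exp(- c\<^sub>3 t)\<close> has to be kept to the end: it makes room for the factor
  \<open>exp(c\<^sub>3 t)\<close> by which \<open>\<nabla>u(t)\<close> grows. These steps are \<open>entropy_inequality\<close>, \<open>L1_growth\<close>,
  \<open>gradient_growth\<close> and \<open>freezing_error\<close>.

  \<^bold>\<open>Finite differences.\<close> Multiplication by \<open>exp(h\<cdot>y)\<close> turns the frozen equation into the Kolmogorov
  equation (\<open>kolmogorov_equation\<close>), whose drift and solutions are smooth up to the boundary, so
  that Taylor expansion gives a truncation error \<open>O(\<tau> + h\<^sup>2)\<close> (\<open>fd_consistency\<close>). Under the step size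
  conditions one step of the scheme has nonnegative weights, hence amplifies the maximum norm at most
  by \<open>1 + \<tau> d L\<^sub>f\<close> (\<open>fd_step_stable\<close>), and each restart costs a factor \<open>exp c\<^sub>2\<close>
  (\<open>fd_error_at_nodes\<close>).

  \<^bold>\<open>Low-rank approximation.\<close> Both the propagator and the Hadamard factor are linear maps known up to a
  relative operator error, so the Euclidean error satisfies a linear recursion with factor \<open>c\<^sub>7\<close>
  (\<open>perturbed_operator_error\<close>, \<open>qtt_error\<close>).

  The interpolation operator carries the last two errors, both of them bounded in the maximum norm on
  the grid, over to \<open>L\<^sup>1\<close>.
\<close>

section \<open>Integration by parts on the cube\<close>

lemma lipschitz_along_direction:
  fixes g :: "'a::euclidean_space \<Rightarrow> real"
  assumes deriv: "\<And>x. x \<in> cbox p q \<Longrightarrow> (g has_derivative g' x) (at x within cbox p q)"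
    and bound: "\<And>x. x \<in> cbox p q \<Longrightarrow> \<bar>g' x b\<bar> \<le> B"
    and x: "x \<in> cbox p q" and y: "x + s *\<^sub>R b \<in> cbox p q"
  shows "\<bar>g (x + s *\<^sub>R b) - g x\<bar> \<le> B * \<bar>s\<bar>"
proof -
  define k where "k r = g (x + (r * s) *\<^sub>R b)" for r
  have inS: "x + (r * s) *\<^sub>R b \<in> cbox p q" if "r \<in> {0..1}" for r
  proof -
    have "(1 - r) *\<^sub>R x + r *\<^sub>R (x + s *\<^sub>R b) \<in> cbox p q"
      using that convexD[OF convex_box(1) x y, of "1 - r" r] by auto
    then show ?thesis by (simp add: algebra_simps)
  qed
  have D: "(k has_derivative (\<lambda>v. g' (x + (r * s) *\<^sub>R b) ((v * s) *\<^sub>R b))) (at r within {0..1})"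
    if "r \<in> {0..1}" for r
    unfolding k_def
    by (rule has_derivative_in_compose2[where g=g and t="cbox p q" and g'=g'])
       (use inS that in \<open>auto intro!: derivative_eq_intros deriv\<close>)
  have lin: "g' (x + (r * s) *\<^sub>R b) ((v * s) *\<^sub>R b) = v * (s * g' (x + (r * s) *\<^sub>R b) b)"
    if "r \<in> {0..1}" for r v
    using linear_scale[OF has_derivative_linear[OF deriv[OF inS[OF that]]], of "v * s" b] by simp
  have "norm (k 1 - k 0) \<le> (B * \<bar>s\<bar>) * norm (1 - 0 :: real)"
  proof (rule differentiable_bound[where S="{0..1}", OF _ D])
    fix r :: real assume r: "r \<in> {0..1}"
    have "norm (v * (s * g' (x + (r * s) *\<^sub>R b) b)) \<le> (B * \<bar>s\<bar>) * norm v" for v :: real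
      using bound[OF inS[OF r]]
        mult_left_mono[of "\<bar>g' (x + (r * s) *\<^sub>R b) b\<bar>" B "\<bar>v\<bar> * \<bar>s\<bar>"]
      by (simp add: abs_mult mult_ac)
    then show "onorm (\<lambda>v. g' (x + (r * s) *\<^sub>R b) ((v * s) *\<^sub>R b)) \<le> B * \<bar>s\<bar>"
      unfolding lin[OF r] by (intro onorm_le)
  qed auto
  then show ?thesis by (simp add: k_def)
qed

text \<open>
  Extended by zero, \<open>g\<close> is Lipschitz along \<open>b\<close>, because a segment which leaves the box crosses its
  frontier, where \<open>g\<close> vanishes. The difference quotients along \<open>b\<close> have integral zero by translation
  invariance; they are bounded, live on a bounded set and converge to the derivative off the frontier.
  Dominated convergence replaces the usual argument by iterated integrals.
\<close>

lemma integral_directional_derivative_eq_0: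
  fixes g :: "'a::euclidean_space \<Rightarrow> real"
  assumes deriv: "\<And>x. x \<in> cbox p q \<Longrightarrow> (g has_derivative g' x) (at x within cbox p q)"
    and cont: "continuous_on (cbox p q) (\<lambda>x. g' x b)"
    and zero: "\<And>x. x \<in> frontier (cbox p q) \<Longrightarrow> g x = 0"
    and b: "norm b = 1"
  shows "integral (cbox p q) (\<lambda>x. g' x b) = 0"
proof -
  let ?S = "cbox p q"
  have "compact ((\<lambda>x. g' x b) ` ?S)"
    using cont compact_cbox compact_continuous_image by blast
  then obtain B where "B > 0" "\<forall>z\<in>(\<lambda>x. g' x b) ` ?S. norm z \<le> B"
    using compact_imp_bounded bounded_pos by metis
  then have B: "\<And>x. x \<in> ?S \<Longrightarrow> \<bar>g' x b\<bar> \<le> B" "B > 0"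
    by auto
  have contg: "continuous_on ?S g"
    using deriv has_derivative_continuous_on by blast
  define G where "G x = indicator ?S x *\<^sub>R g x" for x
  have Gout: "G x = 0" if "x \<notin> ?S" for x using that by (simp add: G_def)
  have Gin: "G x = g x" if "x \<in> ?S" for x using that by (simp add: G_def)
  have intG: "integrable lborel G"
    unfolding G_def by (rule borel_integrable_compact[OF compact_cbox contg])
  have crossing: "\<bar>g x\<bar> \<le> B * \<bar>s\<bar>" if x: "x \<in> ?S" and y: "x + s *\<^sub>R b \<notin> ?S" for x s
  proof -
    have "closed_segment x (x + s *\<^sub>R b) \<inter> frontier ?S \<noteq> {}"
      by (rule connected_Int_frontier) (use x y in auto)
    then obtain z where z: "z \<in> closed_segment x (x + s *\<^sub>R b)" "z \<in> frontier ?S" by blast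
    then obtain r where r: "0 \<le> r" "r \<le> 1" "z = x + (r * s) *\<^sub>R b"
      by (auto simp: in_segment algebra_simps)
    have zS: "z \<in> ?S" using z(2) frontier_subset_closed[OF closed_cbox] by blast
    have "\<bar>g z - g x\<bar> \<le> B * \<bar>r * s\<bar>"
      unfolding r(3)
      by (rule lipschitz_along_direction[OF deriv B(1) x]) (use zS r in auto)
    also have "\<dots> \<le> B * \<bar>s\<bar>"
      using r B(2) mult_right_mono[of r 1 "\<bar>s\<bar>"] by (auto simp: abs_mult)
    finally show ?thesis using zero[OF z(2)] by simp
  qed
  have lip: "\<bar>G (x + s *\<^sub>R b) - G x\<bar> \<le> B * \<bar>s\<bar>" for x s
  proof (cases "x \<in> ?S"; cases "x + s *\<^sub>R b \<in> ?S")
    assume "x \<in> ?S" "x + s *\<^sub>R b \<in> ?S"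
    then show ?thesis
      using lipschitz_along_direction[OF deriv B(1)] by (simp add: Gin)
  next
    assume "x \<in> ?S" "x + s *\<^sub>R b \<notin> ?S"
    then show ?thesis using crossing by (simp add: Gin Gout)
  next
    assume "x \<notin> ?S" "x + s *\<^sub>R b \<in> ?S"
    then show ?thesis using crossing[of "x + s *\<^sub>R b" "- s"] by (simp add: Gin Gout)
  next
    assume "x \<notin> ?S" "x + s *\<^sub>R b \<notin> ?S"
    then show ?thesis using B(2) by (simp add: Gout)
  qed
  \<comment> \<open>The quotients are taken along the null sequence \<open>1/(n+1) \<le> 1\<close>; so they vanish outside a unit neighbourhood of the box.\<close>
  define e :: "nat \<Rightarrow> real" where "e n = inverse (real (Suc n))" for n
  have e: "e n > 0" "e n \<le> 1" for n by (auto simp: e_def field_simps)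
  have e0: "e \<longlonglongrightarrow> 0" unfolding e_def by (rule LIMSEQ_inverse_real_of_nat)
  define Q where "Q n x = (G (x + e n *\<^sub>R b) - G x) / e n" for n x
  define Q' where "Q' x = indicator (box p q) x *\<^sub>R g' x b" for x
  have mG: "G \<in> borel_measurable borel" using intG by auto
  have shift: "integrable lborel (\<lambda>x. G (x + c))" "integral\<^sup>L lborel (\<lambda>x. G (x + c)) = integral\<^sup>L lborel G" for c
  proof -
    have "integrable (distr lborel borel ((+) c)) G" using intG by (simp add: lborel_distr_plus)
    then show "integrable lborel (\<lambda>x. G (x + c))"
      by (subst (asm) integrable_distr_eq) (auto simp: mG add.commute)
    have "integral\<^sup>L (distr lborel borel ((+) c)) G = integral\<^sup>L lborel (\<lambda>x. G (c + x))"
      by (rule integral_distr) (auto simp: mG)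
    then show "integral\<^sup>L lborel (\<lambda>x. G (x + c)) = integral\<^sup>L lborel G"
      by (simp add: lborel_distr_plus add.commute)
  qed
  have Q_int: "integral\<^sup>L lborel (Q n) = 0" for n
    unfolding Q_def using shift[of "e n *\<^sub>R b"] intG by simp
  define W where "W x = indicator (cbox (p - One) (q + One)) x *\<^sub>R B" for x :: 'a
  have intW: "integrable lborel W"
    unfolding W_def by (rule borel_integrable_compact) auto
  have ae: "AE x in lborel. x \<notin> frontier ?S"
  proof -
    have "negligible (frontier ?S)" by (simp add: frontier_cbox negligible_frontier_interval)
    then have "AE x in lebesgue. x \<notin> frontier ?S"
      by (intro AE_not_in) (simp add: negligible_iff_null_sets)
    then show ?thesis by (simp add: AE_completion_iff)
  qed
  have measQ': "Q' \<in> borel_measurable lborel"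
  proof -
    have "continuous_on (box p q) (\<lambda>x. g' x b)"
      using cont box_subset_cbox continuous_on_subset by blast
    then have "(\<lambda>x. indicator (box p q) x *\<^sub>R g' x b) \<in> borel_measurable borel"
      by (rule borel_measurable_continuous_on_indicator[rotated]) simp
    then show ?thesis by (simp add: Q'_def[abs_def])
  qed
  have "(\<lambda>n. integral\<^sup>L lborel (Q n)) \<longlonglongrightarrow> integral\<^sup>L lborel Q'"
  proof (rule integral_dominated_convergence[where w=W])
    show "Q' \<in> borel_measurable lborel" by (rule measQ')
    show "Q n \<in> borel_measurable lborel" for n
      unfolding Q_def using mG by (auto intro!: borel_measurable_divide borel_measurable_diff
         measurable_compose[where g=G])
    show "integrable lborel W" by (rule intW)
    show "AE x in lborel. norm (Q n x) \<le> W x" for n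
    proof (rule AE_I2)
      fix x
      show "norm (Q n x) \<le> W x"
      proof (cases "x \<in> cbox (p - One) (q + One)")
        case True
        have "\<bar>G (x + e n *\<^sub>R b) - G x\<bar> \<le> B * e n" using lip[of x "e n"] e[of n] by simp
        then show ?thesis using True e[of n] by (simp add: Q_def W_def field_simps)
      next
        case False
        have bd: "\<bar>e n * (b \<bullet> i)\<bar> \<le> 1" if "i \<in> Basis" for i
        proof -
          have "\<bar>b \<bullet> i\<bar> \<le> 1" using Basis_le_norm[OF that, of b] b by simp
          then have "e n * \<bar>b \<bullet> i\<bar> \<le> 1 * 1" by (intro mult_mono) (use e[of n] in auto)
          then show ?thesis using e[of n] by (simp add: abs_mult)
        qed
        from False obtain i where i: "i \<in> Basis" "x \<bullet> i < p \<bullet> i - 1 \<or> x \<bullet> i > q \<bullet> i + 1"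
          by (auto simp: mem_box inner_simps not_le)
        have "x \<notin> ?S" using i by (force simp: mem_box)
        moreover have "x + e n *\<^sub>R b \<notin> ?S"
        proof
          assume "x + e n *\<^sub>R b \<in> ?S"
          then have "p \<bullet> i \<le> x \<bullet> i + e n * (b \<bullet> i)" "x \<bullet> i + e n * (b \<bullet> i) \<le> q \<bullet> i"
            using i(1) by (auto simp: mem_box inner_simps)
          then show False using bd[OF i(1)] i(2) by linarith
        qed
        ultimately show ?thesis using False by (simp add: Q_def W_def Gout)
      qed
    qed
    show "AE x in lborel. (\<lambda>n. Q n x) \<longlonglongrightarrow> Q' x"
      using ae
    proof eventually_elim
      fix x assume x: "x \<notin> frontier ?S"
      show "(\<lambda>n. Q n x) \<longlonglongrightarrow> Q' x"
      proof (cases "x \<in> ?S")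
        case True
        then have xb: "x \<in> box p q" using x by (auto simp: frontier_cbox)
        have "(g has_derivative g' x) (at x)"
          using deriv[OF True] xb True at_within_interior[of x ?S] by (simp add: interior_cbox)
        then have "(G has_derivative g' x) (at x)"
          by (rule has_derivative_transform_within_open[OF _ open_box xb])
             (simp add: Gin subsetD[OF box_subset_cbox])
        then have "((\<lambda>s. G (x + s *\<^sub>R b)) has_derivative (\<lambda>s. g' x (s *\<^sub>R b))) (at 0)"
          by (intro has_derivative_compose[where f="\<lambda>s. x + s *\<^sub>R b" and g=G])
             (auto intro!: derivative_eq_intros)
        then have "((\<lambda>s. G (x + s *\<^sub>R b)) has_real_derivative g' x b) (at 0)"
          using linear_scale[OF has_derivative_linear[OF deriv[OF True]]]
          by (simp add: has_field_derivative_def mult_commute_abs)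
        then have "((\<lambda>s. (G (x + s *\<^sub>R b) - G x) / s) \<longlongrightarrow> g' x b) (at 0)"
          by (simp add: has_field_derivative_iff)
        then have "(\<lambda>n. (G (x + e n *\<^sub>R b) - G x) / e n) \<longlonglongrightarrow> g' x b"
          by (rule filterlim_compose)
             (use e e0 in \<open>auto simp: filterlim_at intro!: always_eventually less_imp_neq[symmetric]\<close>)
        then show ?thesis using xb by (simp add: Q_def Q'_def)
      next
        case False
        then have "open (- ?S)" "x \<in> - ?S" by auto
        moreover have "(\<lambda>n. x + e n *\<^sub>R b) \<longlonglongrightarrow> x + 0 *\<^sub>R b"
          by (intro tendsto_intros e0)
        ultimately have "\<forall>\<^sub>F n in sequentially. x + e n *\<^sub>R b \<in> - ?S"
          by (auto simp: tendsto_def)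
        then have "\<forall>\<^sub>F n in sequentially. Q n x = Q' x"
          by eventually_elim (use False box_subset_cbox[of p q] in \<open>auto simp: Q_def Gout Q'_def indicator_def\<close>)
        then show ?thesis by (rule tendsto_eventually)
      qed
    qed
  qed
  then have "integral\<^sup>L lborel Q' = 0"
    by (simp add: Q_int LIMSEQ_const_iff)
  moreover have "integral\<^sup>L lborel Q' = integral\<^sup>L lborel (\<lambda>x. indicator ?S x *\<^sub>R g' x b)"
  proof (rule integral_cong_AE)
    show "(\<lambda>x. indicator ?S x *\<^sub>R g' x b) \<in> borel_measurable lborel"
      using borel_measurable_continuous_on_indicator[OF _ cont] by simp
    show "AE x in lborel. Q' x = indicator ?S x *\<^sub>R g' x b"
      using ae by eventually_elim (use box_subset_cbox[of p q] in \<open>auto simp: Q'_def frontier_cbox indicator_def\<close>)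
    show "Q' \<in> borel_measurable lborel"
      by (rule measQ')
  qed
  moreover have "set_integrable lborel ?S (\<lambda>x. g' x b)"
    unfolding set_integrable_def by (rule borel_integrable_compact[OF compact_cbox cont])
  then have "integral ?S (\<lambda>x. g' x b) = integral\<^sup>L lborel (\<lambda>x. indicator ?S x *\<^sub>R g' x b)"
    by (simp add: set_borel_integral_eq_integral(2)[symmetric] set_lebesgue_integral_def)
  ultimately show ?thesis by simp
qed

lemma compact_cube [simp]: "compact (cube a)"
  by (simp add: cube_def)

text \<open>
  A \<open>C\<^sup>1\<close> function on \<open>S\<close> together with its gradient. The gradient is an argument, so that the rules of
  calculus below do not depend on the uniqueness of derivatives within \<open>S\<close>.
\<close>

definition has_gradient_on :: "(real^'d) set \<Rightarrow> (real^'d \<Rightarrow> real) \<Rightarrow> (real^'d \<Rightarrow> real^'d) \<Rightarrow> bool" where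
  "has_gradient_on S g G \<longleftrightarrow>
     (\<forall>x\<in>S. (g has_derivative (\<lambda>v. v \<bullet> G x)) (at x within S)) \<and> continuous_on S G"

lemma has_gradient_on_imp_continuous_on: "has_gradient_on S g G \<Longrightarrow> continuous_on S g"
  unfolding has_gradient_on_def
  by (rule has_derivative_continuous_on[where f'="\<lambda>x v. v \<bullet> G x"]) auto

lemma has_gradient_on_add:
  "has_gradient_on S g G \<Longrightarrow> has_gradient_on S k K \<Longrightarrow> has_gradient_on S (\<lambda>x. g x + k x) (\<lambda>x. G x + K x)"
  unfolding has_gradient_on_def
  by (auto intro!: continuous_intros derivative_eq_intros simp: inner_add_right)

lemma has_gradient_on_diff:
  "has_gradient_on S g G \<Longrightarrow> has_gradient_on S k K \<Longrightarrow> has_gradient_on S (\<lambda>x. g x - k x) (\<lambda>x. G x - K x)"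
  unfolding has_gradient_on_def
  by (auto intro!: continuous_intros derivative_eq_intros simp: inner_diff_right)

lemma has_gradient_on_mult:
  assumes "has_gradient_on S g G" "has_gradient_on S k K"
  shows "has_gradient_on S (\<lambda>x. g x * k x) (\<lambda>x. k x *\<^sub>R G x + g x *\<^sub>R K x)"
  using assms has_gradient_on_imp_continuous_on[OF assms(1)] has_gradient_on_imp_continuous_on[OF assms(2)]
  unfolding has_gradient_on_def
  by (auto intro!: continuous_intros derivative_eq_intros simp: inner_add_right algebra_simps)

lemma has_gradient_on_compose:
  assumes g: "has_gradient_on S g G" and phi: "\<And>r. (\<phi> has_real_derivative \<phi>' r) (at r)"
    and cont: "continuous_on UNIV \<phi>'"
  shows "has_gradient_on S (\<lambda>x. \<phi> (g x)) (\<lambda>x. \<phi>' (g x) *\<^sub>R G x)"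
proof -
  have "continuous_on S (\<lambda>x. \<phi>' (g x))"
    using continuous_on_compose2[OF cont has_gradient_on_imp_continuous_on[OF g]] by simp
  moreover have "((\<lambda>x. \<phi> (g x)) has_derivative (\<lambda>v. v \<bullet> (\<phi>' (g x) *\<^sub>R G x))) (at x within S)"
    if "x \<in> S" for x
  proof -
    have "((\<lambda>x. \<phi> (g x)) has_derivative (\<lambda>v. \<phi>' (g x) * (v \<bullet> G x))) (at x within S)"
      using has_derivative_compose[of g "\<lambda>v. v \<bullet> G x" x S \<phi> "(*) (\<phi>' (g x))"] g that phi
      by (simp add: has_gradient_on_def has_field_derivative_def)
    then show ?thesis by simp
  qed
  ultimately show ?thesis
    using g unfolding has_gradient_on_def by (auto intro!: continuous_intros)
qed

text \<open>
  With \<open>G\<close> a gradient this is Green's identity; with \<open>G\<close> a drift it moves the derivative of the transport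
  term onto the drift. Both uses need only one of the two factors to vanish on the boundary.
\<close>

lemma integration_by_parts_cube:
  fixes v :: "real^'d \<Rightarrow> real"
  assumes v: "has_gradient_on (cube a) v V"
    and G: "\<And>i. has_gradient_on (cube a) (\<lambda>x. G x $ i) (H i)"
    and zero: "\<And>x. x \<in> frontier (cube a) \<Longrightarrow> v x = 0"
  shows "integral (cube a) (\<lambda>x. v x * (\<Sum>i\<in>UNIV. H i x $ i)) = - integral (cube a) (\<lambda>x. V x \<bullet> G x)"
proof -
  have contv: "continuous_on (cube a) v" and contV: "continuous_on (cube a) V"
    and contG: "\<And>i. continuous_on (cube a) (\<lambda>x. G x $ i)" and contH: "\<And>i. continuous_on (cube a) (H i)"
    using has_gradient_on_imp_continuous_on[OF v] has_gradient_on_imp_continuous_on[OF G] v G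
    by (simp_all add: has_gradient_on_def)
  note ci = continuous_intros contv contV contG contH
  define D where "D i x = G x $ i * (V x $ i) + v x * (H i x $ i)" for i x
  have contD: "continuous_on (cube a) (D i)" for i
    unfolding D_def[abs_def] by (intro ci)
  have "integral (cube a) (D i) = 0" for i
  proof -
    let ?D = "\<lambda>x w. w \<bullet> (G x $ i *\<^sub>R V x + v x *\<^sub>R H i x)"
    have "has_gradient_on (cube a) (\<lambda>x. v x * G x $ i) (\<lambda>x. G x $ i *\<^sub>R V x + v x *\<^sub>R H i x)"
      by (rule has_gradient_on_mult[OF v G])
    then have "integral (cbox (\<chi> i. - a) (\<chi> i. a)) (\<lambda>x. ?D x (axis i 1)) = 0"
      by (intro integral_directional_derivative_eq_0[where g="\<lambda>x. v x * G x $ i"])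
         (auto simp: has_gradient_on_def cube_def[symmetric] zero intro!: ci)
    then show ?thesis
      by (simp add: D_def[abs_def] cube_def inner_axis')
  qed
  then have "integral (cube a) (\<lambda>x. \<Sum>i\<in>UNIV. D i x) = 0"
    using contD by (subst integral_sum) (auto simp: cube_def intro!: integrable_continuous)
  moreover have "(\<Sum>i\<in>UNIV. D i x) = V x \<bullet> G x + v x * (\<Sum>i\<in>UNIV. H i x $ i)" for x
    by (simp add: D_def sum.distrib sum_distrib_left inner_vec_def mult.commute)
  moreover have "integral (cube a) (\<lambda>x. V x \<bullet> G x + v x * (\<Sum>i\<in>UNIV. H i x $ i))
     = integral (cube a) (\<lambda>x. V x \<bullet> G x) + integral (cube a) (\<lambda>x. v x * (\<Sum>i\<in>UNIV. H i x $ i))"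
  proof (rule integral_add)
    show "(\<lambda>x. V x \<bullet> G x) integrable_on cube a"
      unfolding inner_vec_def cube_def inner_real_def
      by (intro integrable_continuous ci[unfolded cube_def])
    show "(\<lambda>x. v x * (\<Sum>i\<in>UNIV. H i x $ i)) integrable_on cube a"
      unfolding cube_def by (intro integrable_continuous ci[unfolded cube_def])
  qed
  ultimately show ?thesis by simp
qed

lemma continuous_on_fix_snd:
  assumes "continuous_on (A \<times> B) (\<lambda>(x, t). f x t)" "t \<in> B"
  shows "continuous_on A (\<lambda>x. f x t)"
proof -
  have "continuous_on A (\<lambda>x. case (x, t) of (x, t) \<Rightarrow> f x t)"
    by (rule continuous_on_compose2[OF assms(1)]) (use assms(2) in \<open>auto intro!: continuous_intros\<close>)
  then show ?thesis by simp
qed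

lemma integrable_on_cube: "continuous_on (cube a) f \<Longrightarrow> f integrable_on cube a"
  for f :: "real^'d \<Rightarrow> real"
  unfolding cube_def by (rule integrable_continuous)

text \<open>
  The factor \<open>exp (c t)\<close> next to \<open>\<beta>'\<close> says that the source may grow at the same rate as the quantity
  itself. In this form the bounds over consecutive intervals telescope.
\<close>

lemma gronwall_decreasing:
  fixes y :: "real \<Rightarrow> real"
  assumes le: "t0 \<le> t1" and cont: "continuous_on {t0..t1} y" "continuous_on {t0..t1} \<beta>"
    and y: "\<And>t. t \<in> {t0<..<t1} \<Longrightarrow> (y has_real_derivative y' t) (at t)"
    and \<beta>: "\<And>t. t \<in> {t0<..<t1} \<Longrightarrow> (\<beta> has_real_derivative \<beta>' t) (at t)"
    and ineq: "\<And>t. t \<in> {t0<..<t1} \<Longrightarrow> y' t \<le> c * y t + \<beta>' t * exp (c * t)"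
  shows "exp (- (c * t1)) * y t1 - \<beta> t1 \<le> exp (- (c * t0)) * y t0 - \<beta> t0"
proof (rule DERIV_nonpos_imp_decreasing_open[OF le])
  fix t assume t: "t0 < t" "t < t1"
  have "((\<lambda>t. exp (- (c * t)) * y t - \<beta> t) has_real_derivative
          (exp (- (c * t)) * (- c)) * y t + y' t * exp (- (c * t)) - \<beta>' t) (at t)"
    using t by (auto intro!: derivative_eq_intros y \<beta>)
  moreover have "exp (- (c * t)) * y' t \<le> exp (- (c * t)) * c * y t + \<beta>' t"
  proof -
    have "exp (- (c * t)) * y' t \<le> exp (- (c * t)) * (c * y t + \<beta>' t * exp (c * t))"
      using ineq[of t] t by (intro mult_left_mono) auto
    also have "\<dots> = exp (- (c * t)) * c * y t + \<beta>' t * (exp (- (c * t)) * exp (c * t))"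
      by (simp add: algebra_simps)
    also have "exp (- (c * t)) * exp (c * t) = 1"
      by (simp add: exp_minus)
    finally show ?thesis by simp
  qed
  ultimately show "\<exists>z. ((\<lambda>t. exp (- (c * t)) * y t - \<beta> t) has_real_derivative z) (at t) \<and> z \<le> 0"
    by (intro exI conjI) (assumption, simp add: algebra_simps)
qed (intro continuous_intros cont)

section \<open>Energy inequalities for functions vanishing on the boundary\<close>

text \<open>
  A function of class \<open>C\<^sup>2\<close> in space and \<open>C\<^sup>1\<close> in time which vanishes on the boundary, with time
  derivative \<open>wt\<close>, gradient \<open>G\<close> and \<open>H i\<close> the gradient of the \<open>i\<close>-th partial derivative. The derivatives
  are parameters: thereby restrictions to shorter time intervals and differences of two such functions
  are instances again, although a derivative within an interval depends on the interval. Of the second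
  derivatives only the Laplacian is required to be jointly continuous in space and time.
\<close>

locale dirichlet_function =
  fixes a t0 t1 :: real
    and w wt :: "real^'d \<Rightarrow> real \<Rightarrow> real"
    and G :: "real^'d \<Rightarrow> real \<Rightarrow> real^'d"
    and H :: "'d \<Rightarrow> real^'d \<Rightarrow> real \<Rightarrow> real^'d"
  assumes t0_less_t1: "t0 < t1"
    and time: "\<And>x t. x \<in> cube a \<Longrightarrow> t \<in> {t0..t1} \<Longrightarrow> (w x has_real_derivative wt x t) (at t within {t0..t1})"
    and cont_w: "continuous_on (cube a \<times> {t0..t1}) (\<lambda>(x, t). w x t)"
    and cont_wt: "continuous_on (cube a \<times> {t0..t1}) (\<lambda>(x, t). wt x t)"
    and cont_G: "continuous_on (cube a \<times> {t0..t1}) (\<lambda>(x, t). G x t)"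
    and cont_lap: "continuous_on (cube a \<times> {t0..t1}) (\<lambda>(x, t). \<Sum>i\<in>UNIV. H i x t $ i)"
    and gradient: "\<And>t. t \<in> {t0..t1} \<Longrightarrow> has_gradient_on (cube a) (\<lambda>x. w x t) (\<lambda>x. G x t)"
    and hessian: "\<And>i t. t \<in> {t0..t1} \<Longrightarrow> has_gradient_on (cube a) (\<lambda>x. G x t $ i) (\<lambda>x. H i x t)"
    and boundary: "\<And>x t. x \<in> frontier (cube a) \<Longrightarrow> t \<in> {t0..t1} \<Longrightarrow> w x t = 0"
begin

definition lap :: "real^'d \<Rightarrow> real \<Rightarrow> real" where
  "lap x t = (\<Sum>i\<in>UNIV. H i x t $ i)"

lemma continuous_lap: "continuous_on (cube a \<times> {t0..t1}) (\<lambda>(x, t). lap x t)"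
  using cont_lap by (simp add: lap_def)

lemma cont_slice:
  assumes "t \<in> {t0..t1}"
  shows "continuous_on (cube a) (\<lambda>x. w x t)" "continuous_on (cube a) (\<lambda>x. wt x t)"
    "continuous_on (cube a) (\<lambda>x. G x t)" "continuous_on (cube a) (\<lambda>x. lap x t)"
  using continuous_on_fix_snd[OF cont_w assms] continuous_on_fix_snd[OF cont_wt assms]
    continuous_on_fix_snd[OF cont_G assms] continuous_on_fix_snd[OF continuous_lap assms] by auto

lemma integral_compose_has_derivative:
  assumes phi: "\<And>r. (\<phi> has_real_derivative \<phi>' r) (at r)" and cont: "continuous_on UNIV \<phi>'"
    and t: "t \<in> {t0..t1}"
  shows "((\<lambda>t. integral (cube a) (\<lambda>x. \<phi> (w x t))) has_real_derivative
           integral (cube a) (\<lambda>x. \<phi>' (w x t) * wt x t)) (at t within {t0..t1})"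
  unfolding cube_def
proof (rule leibniz_rule_field_derivative[where U="{t0..t1}" and f="\<lambda>t x. \<phi> (w x t)"
    and fx="\<lambda>t x. \<phi>' (w x t) * wt x t"])
  fix s :: real and x :: "real^'d" assume s: "s \<in> {t0..t1}" and x: "x \<in> cbox (\<chi> i. - a) (\<chi> i. a)"
  show "((\<lambda>s. \<phi> (w x s)) has_real_derivative \<phi>' (w x s) * wt x s) (at s within {t0..t1})"
    by (rule DERIV_chain2[OF phi time]) (use s x in \<open>auto simp: cube_def\<close>)
next
  fix s assume s: "s \<in> {t0..t1}"
  have "continuous_on UNIV \<phi>" by (auto intro!: continuous_at_imp_continuous_on DERIV_isCont phi)
  then have "continuous_on (cube a) (\<lambda>x. \<phi> (w x s))"
    using continuous_on_compose2[OF _ cont_slice(1)[OF s]] by blast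
  then show "(\<lambda>x. \<phi> (w x s)) integrable_on cbox (\<chi> i. - a) (\<chi> i. a)"
    using integrable_on_cube by (simp add: cube_def)
next
  have w: "continuous_on ({t0..t1} \<times> cube a) (\<lambda>p. w (snd p) (fst p))"
    using continuous_on_swap_args[OF cont_w] by (simp add: case_prod_beta)
  have "continuous_on ({t0..t1} \<times> cube a) (\<lambda>p. \<phi>' (w (snd p) (fst p)))"
    by (rule continuous_on_compose2[OF cont w]) simp
  moreover have "continuous_on ({t0..t1} \<times> cube a) (\<lambda>p. wt (snd p) (fst p))"
    using continuous_on_swap_args[OF cont_wt] by (simp add: case_prod_beta)
  ultimately show "continuous_on ({t0..t1} \<times> cbox (\<chi> i. - a) (\<chi> i. a)) (\<lambda>(s, x). \<phi>' (w x s) * wt x s)"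
    unfolding case_prod_beta cube_def by (intro continuous_intros)
qed (use t in auto)

text \<open>
  Testing the equation with \<open>\<phi>'(w)\<close>. Since \<open>\<phi>'(0) = 0\<close>, integration by parts turns the Laplacian into
  \<open>- \<phi>''(w) |\<nabla>w|\<^sup>2 \<le> 0\<close>; since \<open>\<phi>(0) = 0\<close>, the transport term becomes \<open>- div F \<phi>(w)\<close>; and the doubling
  condition bounds \<open>w \<phi>'(w)\<close> by \<open>2 \<phi>(w)\<close>, which is why \<open>J\<close> enters the rate twice. The slack \<open>e\<close> admits
  regularisations of the absolute value; \<open>e = 0\<close> suffices for the square.
\<close>

lemma entropy_inequality:
  assumes t: "t \<in> {t0..t1}"
    and phi: "\<And>r. (\<phi> has_real_derivative \<phi>' r) (at r)" "\<And>r. (\<phi>' has_real_derivative \<phi>'' r) (at r)"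
      "continuous_on UNIV \<phi>''" "\<phi> 0 = 0" "\<phi>' 0 = 0"
    and convex: "\<And>r. \<phi>'' r \<ge> 0" "\<And>r. \<phi> r \<ge> 0"
    and doubling: "\<And>r. 0 \<le> r * \<phi>' r" "\<And>r. r * \<phi>' r \<le> 2 * \<phi> r + e" and e: "e \<ge> 0"
    and F: "\<And>i. has_gradient_on (cube a) (\<lambda>x. F x $ i) (DF i)" and J: "continuous_on (cube a) J"
    and bound: "\<And>x. x \<in> cube a \<Longrightarrow> \<bar>\<Sum>i\<in>UNIV. DF i x $ i\<bar> + 2 * \<bar>J x\<bar> \<le> c"
    and eq: "\<And>x. x \<in> cube a \<Longrightarrow> wt x t = 1/2 * lap x t + F x \<bullet> G x t + J x * w x t + g x"
  shows "integral (cube a) (\<lambda>x. \<phi>' (w x t) * wt x t)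
     \<le> c * integral (cube a) (\<lambda>x. \<phi> (w x t)) + c * e * measure lborel (cube a :: (real^'d) set)
        + integral (cube a) (\<lambda>x. \<phi>' (w x t) * g x)"
proof -
  let ?S = "cube a :: (real^'d) set"
  let ?I = "integral ?S"
  define divF where "divF x = (\<Sum>i\<in>UNIV. DF i x $ i)" for x
  have c_phi: "continuous_on UNIV \<phi>" "continuous_on UNIV \<phi>'"
    by (auto intro!: continuous_at_imp_continuous_on DERIV_isCont phi(1,2))
  note sl = cont_slice[OF t]
  have cs: "continuous_on ?S (\<lambda>x. \<phi> (w x t))" "continuous_on ?S (\<lambda>x. \<phi>' (w x t))"
     "continuous_on ?S (\<lambda>x. \<phi>'' (w x t))"
    using continuous_on_compose2[OF c_phi(1) sl(1)] continuous_on_compose2[OF c_phi(2) sl(1)]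
      continuous_on_compose2[OF phi(3) sl(1)] by auto
  have cF: "continuous_on ?S (\<lambda>x. F x)"
  proof -
    have "continuous_on ?S (\<lambda>x. \<chi> i. F x $ i)"
      by (intro continuous_on_vec_lambda has_gradient_on_imp_continuous_on[OF F])
    then show ?thesis by simp
  qed
  have cdF: "continuous_on ?S divF"
    unfolding divF_def[abs_def] using F by (auto simp: has_gradient_on_def intro!: continuous_intros)
  have cg: "continuous_on ?S g"
  proof -
    have "continuous_on ?S (\<lambda>x. wt x t - 1/2 * lap x t - F x \<bullet> G x t - J x * w x t)"
      by (intro continuous_intros sl cF J)
    then show ?thesis by (rule continuous_on_eq) (use eq in auto)
  qed
  note ints = integrable_on_cube[OF continuous_on_mult] integrable_on_cube
  note ci = continuous_intros sl cs cF cdF cg J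
  have grad_phi: "has_gradient_on ?S (\<lambda>x. \<phi> (w x t)) (\<lambda>x. \<phi>' (w x t) *\<^sub>R G x t)"
    by (rule has_gradient_on_compose[OF gradient[OF t] phi(1) c_phi(2)])
  have grad_phi': "has_gradient_on ?S (\<lambda>x. \<phi>' (w x t)) (\<lambda>x. \<phi>'' (w x t) *\<^sub>R G x t)"
    by (rule has_gradient_on_compose[OF gradient[OF t] phi(2,3)])
  have A: "?I (\<lambda>x. \<phi>' (w x t) * lap x t) \<le> 0"
  proof -
    have "?I (\<lambda>x. \<phi>' (w x t) * lap x t) = - ?I (\<lambda>x. (\<phi>'' (w x t) *\<^sub>R G x t) \<bullet> G x t)"
      unfolding lap_def
      by (rule integration_by_parts_cube[OF grad_phi' hessian[OF t]]) (simp add: boundary[OF _ t] phi)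
    moreover have "?I (\<lambda>x. (\<phi>'' (w x t) *\<^sub>R G x t) \<bullet> G x t) \<ge> 0"
      by (rule integral_nonneg) (auto intro!: integrable_on_cube ci simp: convex)
    ultimately show ?thesis by simp
  qed
  have B: "?I (\<lambda>x. \<phi>' (w x t) * (F x \<bullet> G x t)) = - ?I (\<lambda>x. divF x * \<phi> (w x t))"
  proof -
    have "?I (\<lambda>x. \<phi> (w x t) * divF x) = - ?I (\<lambda>x. (\<phi>' (w x t) *\<^sub>R G x t) \<bullet> F x)"
      unfolding divF_def
      by (rule integration_by_parts_cube[OF grad_phi F]) (simp add: boundary[OF _ t] phi)
    then show ?thesis by (simp add: mult.commute inner_commute)
  qed
  have "?I (\<lambda>x. \<phi>' (w x t) * wt x t) =
     ?I (\<lambda>x. 1/2 * (\<phi>' (w x t) * lap x t) + \<phi>' (w x t) * (F x \<bullet> G x t)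
        + J x * (w x t * \<phi>' (w x t)) + \<phi>' (w x t) * g x)"
    by (rule integral_cong) (simp add: eq algebra_simps)
  also have "\<dots> = 1/2 * ?I (\<lambda>x. \<phi>' (w x t) * lap x t) + ?I (\<lambda>x. \<phi>' (w x t) * (F x \<bullet> G x t))
        + ?I (\<lambda>x. J x * (w x t * \<phi>' (w x t))) + ?I (\<lambda>x. \<phi>' (w x t) * g x)"
    by (subst integral_add, (intro integrable_on_cube ci)+)+ simp
  also have "\<dots> \<le> - ?I (\<lambda>x. divF x * \<phi> (w x t))
        + ?I (\<lambda>x. J x * (w x t * \<phi>' (w x t))) + ?I (\<lambda>x. \<phi>' (w x t) * g x)"
    using A B by simp
  also have "- ?I (\<lambda>x. divF x * \<phi> (w x t)) + ?I (\<lambda>x. J x * (w x t * \<phi>' (w x t)))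
       = ?I (\<lambda>x. J x * (w x t * \<phi>' (w x t)) - divF x * \<phi> (w x t))"
    by (subst integral_diff, (intro integrable_on_cube ci)+) simp
  also have "\<dots> \<le> ?I (\<lambda>x. c * \<phi> (w x t) + c * e)"
  proof (rule integral_le)
    fix x assume x: "x \<in> ?S"
    let ?r = "w x t"
    have "J x * (?r * \<phi>' ?r) \<le> \<bar>J x\<bar> * (2 * \<phi> ?r + e)"
    proof -
      have "J x * (?r * \<phi>' ?r) \<le> \<bar>J x\<bar> * (?r * \<phi>' ?r)"
        using doubling(1) by (intro mult_right_mono) auto
      also have "\<dots> \<le> \<bar>J x\<bar> * (2 * \<phi> ?r + e)"
        using doubling(2) by (intro mult_left_mono) auto
      finally show ?thesis .
    qed
    moreover have "- (divF x * \<phi> ?r) \<le> \<bar>divF x\<bar> * \<phi> ?r"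
      using convex(2)[of ?r] mult_right_mono[of "- divF x" "\<bar>divF x\<bar>" "\<phi> ?r"] by simp
    moreover have "(\<bar>divF x\<bar> + 2 * \<bar>J x\<bar>) * \<phi> ?r \<le> c * \<phi> ?r"
      using bound[OF x] convex(2) unfolding divF_def by (intro mult_right_mono) auto
    moreover have "\<bar>J x\<bar> * e \<le> c * e"
      using bound[OF x] e by (intro mult_right_mono) auto
    ultimately show "J x * (?r * \<phi>' ?r) - divF x * \<phi> ?r \<le> c * \<phi> ?r + c * e"
      by (simp add: algebra_simps)
  qed (intro integrable_on_cube ci)+
  also have "\<dots> = c * ?I (\<lambda>x. \<phi> (w x t)) + c * e * measure lborel ?S"
    by (subst integral_add, (intro integrable_on_cube ci)+) (simp add: cube_def)
  finally show ?thesis by simp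
qed

lemma time_increment_bound:
  obtains B where "B \<ge> 0"
    "\<And>x s t. x \<in> cube a \<Longrightarrow> s \<in> {t0..t1} \<Longrightarrow> t \<in> {t0..t1} \<Longrightarrow> \<bar>w x s - w x t\<bar> \<le> B * \<bar>s - t\<bar>"
proof -
  have "compact ((\<lambda>(x, t). wt x t) ` (cube a \<times> {t0..t1}))"
    by (intro compact_continuous_image cont_wt compact_Times) auto
  then obtain B where B: "B > 0" "\<forall>z\<in>(\<lambda>(x, t). wt x t) ` (cube a \<times> {t0..t1}). norm z \<le> B"
    using compact_imp_bounded[THEN bounded_pos[THEN iffD1]] by blast
  have "\<bar>w x s - w x t\<bar> \<le> B * \<bar>s - t\<bar>" if x: "x \<in> cube a" "s \<in> {t0..t1}" "t \<in> {t0..t1}" for x s t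
  proof -
    have "norm (w x s - w x t) \<le> B * norm (s - t)"
      by (rule field_differentiable_bound[OF _ time[OF x(1)] _ x(2,3)]) (use B(2) x(1) in auto)
    then show ?thesis by simp
  qed
  then show thesis using that[of B] B(1) by auto
qed

text \<open>
  The mixed derivative \<open>\<partial>\<^sub>t\<nabla>w\<close> need not exist. Instead, integration by parts applied to the increment
  \<open>\<integral>(\<nabla>w\<^sub>s - \<nabla>w\<^sub>t)\<cdot>(\<nabla>w\<^sub>s + \<nabla>w\<^sub>t)\<close> leaves only the increment of \<open>w\<close>, which is differentiable in time.
\<close>

lemma gradient_energy_has_derivative:
  assumes t: "t \<in> {t0..t1}"
  shows "((\<lambda>t. integral (cube a) (\<lambda>x. G x t \<bullet> G x t)) has_real_derivative
           - 2 * integral (cube a) (\<lambda>x. wt x t * lap x t)) (at t within {t0..t1})"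
proof -
  let ?I = "integral (cube a :: (real^'d) set)" and ?T = "{t0..t1}"
  \<comment> \<open>The increment of the energy is the differentiable part \<open>- 2 (P s - P t)\<close> plus a remainder \<open>R\<close> of smaller order.\<close>
  define P where "P s = ?I (\<lambda>x. w x s * lap x t)" for s
  define R where "R s = ?I (\<lambda>x. (w x s - w x t) * (lap x s - lap x t))" for s
  define m where "m s = ?I (\<lambda>x. \<bar>lap x s - lap x t\<bar>)" for s
  note slt = cont_slice[OF t]
  have b_eq: "?I (\<lambda>x. G x s \<bullet> G x s) = ?I (\<lambda>x. G x t \<bullet> G x t) - 2 * (P s - P t) - R s" if s: "s \<in> ?T" for s
  proof -
    note sls = cont_slice[OF s]
    note ci = continuous_intros slt sls
    have "?I (\<lambda>x. (w x s - w x t) * (\<Sum>i\<in>UNIV. (H i x s + H i x t) $ i))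
        = - ?I (\<lambda>x. (G x s - G x t) \<bullet> (G x s + G x t))"
      by (rule integration_by_parts_cube)
         (auto intro!: has_gradient_on_diff has_gradient_on_add gradient hessian s t simp: boundary[OF _ s] boundary[OF _ t])
    also have "(\<lambda>x. (G x s - G x t) \<bullet> (G x s + G x t)) = (\<lambda>x. G x s \<bullet> G x s - G x t \<bullet> G x t)"
      by (auto simp: algebra_simps inner_commute)
    also have "?I \<dots> = ?I (\<lambda>x. G x s \<bullet> G x s) - ?I (\<lambda>x. G x t \<bullet> G x t)"
      by (intro integral_diff integrable_on_cube ci)
    also have "(\<lambda>x. (w x s - w x t) * (\<Sum>i\<in>UNIV. (H i x s + H i x t) $ i))
       = (\<lambda>x. 2 * (w x s * lap x t - w x t * lap x t) + (w x s - w x t) * (lap x s - lap x t))"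
      by (auto simp: lap_def sum.distrib algebra_simps)
    also have "?I \<dots> = 2 * (P s - P t) + R s"
      unfolding P_def R_def
      by (subst integral_add, (intro integrable_on_cube ci)+, subst integral_mult_right,
          subst integral_diff, (intro integrable_on_cube ci)+) simp
    finally show ?thesis by simp
  qed
  have P: "(P has_real_derivative ?I (\<lambda>x. wt x t * lap x t)) (at t within ?T)"
    unfolding P_def cube_def
  proof (rule leibniz_rule_field_derivative[where U="?T" and f="\<lambda>s x. w x s * lap x t" and fx="\<lambda>s x. wt x s * lap x t"])
    show "((\<lambda>s. w x s * lap x t) has_real_derivative wt x s * lap x t) (at s within ?T)"
      if "s \<in> ?T" "x \<in> cbox (\<chi> i. - a) (\<chi> i. a)" for s x
      using time[of x s] that by (auto simp: cube_def intro!: derivative_eq_intros)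
    show "(\<lambda>x. w x s * lap x t) integrable_on cbox (\<chi> i. - a) (\<chi> i. a)" if "s \<in> ?T" for s
      using integrable_on_cube[OF continuous_on_mult[OF cont_slice(1)[OF that] slt(4)]] by (simp add: cube_def)
    have "continuous_on (?T \<times> cube a) (\<lambda>(s, x). wt x s)"
      by (rule continuous_on_swap_args[OF cont_wt])
    moreover have "continuous_on (?T \<times> cube a) (\<lambda>p. lap (snd p) t)"
      by (rule continuous_on_compose2[OF slt(4)]) (auto intro!: continuous_intros)
    ultimately show "continuous_on (?T \<times> cbox (\<chi> i. - a) (\<chi> i. a)) (\<lambda>(s, x). wt x s * lap x t)"
      unfolding cube_def case_prod_beta by (intro continuous_intros)
  qed (use t in auto)
  obtain B where B: "B \<ge> 0"
    "\<And>x s t. x \<in> cube a \<Longrightarrow> s \<in> ?T \<Longrightarrow> t \<in> ?T \<Longrightarrow> \<bar>w x s - w x t\<bar> \<le> B * \<bar>s - t\<bar>"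
    using time_increment_bound by blast
  have m0: "(m \<longlongrightarrow> 0) (at t within ?T)"
  proof -
    have "continuous_on (?T \<times> cube a) (\<lambda>(s, x). lap x s)"
      by (rule continuous_on_swap_args[OF continuous_lap])
    moreover have "continuous_on (?T \<times> cube a) (\<lambda>p. lap (snd p) t)"
      by (rule continuous_on_compose2[OF slt(4)]) (auto intro!: continuous_intros)
    ultimately have "continuous_on (?T \<times> cube a) (\<lambda>(s, x). \<bar>lap x s - lap x t\<bar>)"
      unfolding case_prod_beta by (intro continuous_intros)
    then have "continuous_on ?T m"
      unfolding m_def[abs_def] cube_def by (rule integral_continuous_on_param)
    then have "(m \<longlongrightarrow> m t) (at t within ?T)" using t by (simp add: continuous_on_def)
    then show ?thesis by (simp add: m_def)
  qed
  have R_bound: "\<bar>R s\<bar> \<le> B * \<bar>s - t\<bar> * m s" if s: "s \<in> ?T" for s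
  proof -
    note ci = continuous_intros slt cont_slice[OF s]
    have "norm (R s) \<le> ?I (\<lambda>x. (B * \<bar>s - t\<bar>) * \<bar>lap x s - lap x t\<bar>)"
      unfolding R_def
    proof (rule integral_norm_bound_integral)
      fix x :: "real^'d" assume "x \<in> cube a"
      then show "norm ((w x s - w x t) * (lap x s - lap x t)) \<le> (B * \<bar>s - t\<bar>) * \<bar>lap x s - lap x t\<bar>"
        using B(2)[OF _ s t] by (auto simp: abs_mult intro!: mult_right_mono)
    qed (intro integrable_on_cube ci)+
    then show ?thesis by (simp add: m_def)
  qed
  have R: "(R has_real_derivative 0) (at t within ?T)"
    unfolding has_field_derivative_iff
  proof (rule Lim_null_comparison[where g="\<lambda>s. B * m s"])
    show "\<forall>\<^sub>F s in at t within ?T. norm ((R s - R t) / (s - t)) \<le> B * m s"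
      unfolding eventually_at_filter
    proof (intro always_eventually allI impI)
      fix s assume "s \<noteq> t" "s \<in> ?T"
      moreover have "R t = 0" by (simp add: R_def)
      ultimately show "norm ((R s - R t) / (s - t)) \<le> B * m s"
        using R_bound[of s] by (simp add: field_simps)
    qed
    show "((\<lambda>s. B * m s) \<longlongrightarrow> 0) (at t within ?T)"
      using tendsto_mult_right_zero[OF m0] by simp
  qed
  have "((\<lambda>s. ?I (\<lambda>x. G x t \<bullet> G x t) - 2 * (P s - P t) - R s) has_real_derivative
      0 - 2 * (?I (\<lambda>x. wt x t * lap x t) - 0) - 0) (at t within ?T)"
    by (intro DERIV_diff DERIV_cmult DERIV_const P R)
  then have "((\<lambda>s. ?I (\<lambda>x. G x s \<bullet> G x s)) has_real_derivative
      0 - 2 * (?I (\<lambda>x. wt x t * lap x t) - 0) - 0) (at t within ?T)"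
    by (rule has_field_derivative_transform_within[OF _ zero_less_one t]) (rule b_eq[symmetric])
  then show ?thesis by simp
qed

end

lemma dirichlet_function_subinterval:
  assumes "dirichlet_function a t0 t1 w wt G H" and sub: "t0 \<le> s0" "s0 < s1" "s1 \<le> t1"
  shows "dirichlet_function a s0 s1 w wt G H"
proof -
  interpret dirichlet_function a t0 t1 w wt G H by fact
  have "{s0..s1} \<subseteq> {t0..t1}" using sub by auto
  then have T: "cube a \<times> {s0..s1} \<subseteq> cube a \<times> {t0..t1}" for a :: real by auto
  show ?thesis
  proof
    show "(w x has_real_derivative wt x t) (at t within {s0..s1})"
      if "x \<in> cube a" "t \<in> {s0..s1}" for x t
      by (rule DERIV_subset[OF time]) (use that sub in auto)
  qed (use sub in \<open>auto intro: gradient hessian boundary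
         continuous_on_subset[OF cont_w T] continuous_on_subset[OF cont_wt T]
         continuous_on_subset[OF cont_G T] continuous_on_subset[OF cont_lap T]\<close>)
qed

lemma dirichlet_function_diff:
  assumes "dirichlet_function a t0 t1 w wt G H" "dirichlet_function a t0 t1 w' wt' G' H'"
  shows "dirichlet_function a t0 t1 (\<lambda>x t. w x t - w' x t) (\<lambda>x t. wt x t - wt' x t)
           (\<lambda>x t. G x t - G' x t) (\<lambda>i x t. H i x t - H' i x t)"
proof -
  interpret A: dirichlet_function a t0 t1 w wt G H by fact
  interpret B: dirichlet_function a t0 t1 w' wt' G' H' by fact
  show ?thesis
  proof
    show "continuous_on (cube a \<times> {t0..t1}) (\<lambda>(x, t). w x t - w' x t)"
      using continuous_on_diff[OF A.cont_w B.cont_w] by (simp add: case_prod_beta)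
    show "continuous_on (cube a \<times> {t0..t1}) (\<lambda>(x, t). wt x t - wt' x t)"
      using continuous_on_diff[OF A.cont_wt B.cont_wt] by (simp add: case_prod_beta)
    show "continuous_on (cube a \<times> {t0..t1}) (\<lambda>(x, t). G x t - G' x t)"
      using continuous_on_diff[OF A.cont_G B.cont_G] by (simp add: case_prod_beta)
    show "continuous_on (cube a \<times> {t0..t1}) (\<lambda>(x, t). \<Sum>i\<in>UNIV. (H i x t - H' i x t) $ i)"
      using continuous_on_diff[OF A.cont_lap B.cont_lap] by (simp add: case_prod_beta sum_subtractf)
  qed (auto intro!: A.t0_less_t1 derivative_intros A.time B.time has_gradient_on_diff A.gradient B.gradient
         A.hessian B.hessian simp: A.boundary B.boundary)
qed

text \<open>
  The convex functions \<open>\<surd>(r\<^sup>2 + e\<^sup>2) - e\<close> approximate the absolute value up to \<open>e\<close> and satisfy the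
  conditions on an entropy.
\<close>

lemma regularised_abs:
  fixes e :: real
  assumes e: "e > 0"
  defines "\<phi> \<equiv> \<lambda>r. sqrt (r\<^sup>2 + e\<^sup>2) - e" and "\<phi>' \<equiv> \<lambda>r. r / sqrt (r\<^sup>2 + e\<^sup>2)"
    and "\<phi>'' \<equiv> \<lambda>r. e\<^sup>2 / (sqrt (r\<^sup>2 + e\<^sup>2)) ^ 3"
  shows "(\<phi> has_real_derivative \<phi>' r) (at r)" "(\<phi>' has_real_derivative \<phi>'' r) (at r)"
    "continuous_on UNIV \<phi>''" "\<phi>'' r \<ge> 0" "\<phi> r \<ge> 0" "0 \<le> r * \<phi>' r" "r * \<phi>' r \<le> 2 * \<phi> r + e"
    "\<bar>\<phi>' r\<bar> \<le> 1" "\<phi> r \<le> \<bar>r\<bar>" "\<bar>r\<bar> - e \<le> \<phi> r"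
proof -
  define s where "s r = sqrt (r\<^sup>2 + e\<^sup>2)" for r
  have pos: "r\<^sup>2 + e\<^sup>2 > 0" for r using e by (simp add: add_nonneg_pos)
  have s: "s r > 0" "s r * s r = r * r + e * e" "s r \<ge> e" "s r \<ge> \<bar>r\<bar>" for r
    using pos[of r] e real_le_rsqrt[of e "r\<^sup>2 + e\<^sup>2"] real_le_rsqrt[of "\<bar>r\<bar>" "r\<^sup>2 + e\<^sup>2"]
    by (auto simp: s_def power2_eq_square)
  have ds: "(s has_real_derivative r / s r) (at r)" for r
    unfolding s_def[abs_def] using pos[of r]
    by (auto intro!: derivative_eq_intros simp: field_simps)
  show "(\<phi> has_real_derivative \<phi>' r) (at r)"
    using DERIV_diff[OF ds[of r] DERIV_const[of e]] by (simp add: \<phi>_def \<phi>'_def s_def[abs_def])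
  have "((\<lambda>r. r / s r) has_real_derivative (1 * s r - r * (r / s r)) / (s r * s r)) (at r)"
    using s(1)[of r] by (intro DERIV_divide ds DERIV_ident) auto
  also have "(1 * s r - r * (r / s r)) / (s r * s r) = e\<^sup>2 / (s r) ^ 3"
    using s(1,2)[of r] by (simp add: field_simps power2_eq_square power3_eq_cube)
  finally show "(\<phi>' has_real_derivative \<phi>'' r) (at r)"
    by (simp add: \<phi>'_def \<phi>''_def s_def[abs_def])
  show "continuous_on UNIV \<phi>''"
    unfolding \<phi>''_def by (intro continuous_intros) (use e in auto)
  show "\<phi>'' r \<ge> 0" using s(1)[of r] by (simp add: \<phi>''_def s_def)
  show "\<phi> r \<ge> 0" using s(3)[of r] by (simp add: \<phi>_def s_def)
  show "0 \<le> r * \<phi>' r" using s(1)[of r] by (simp add: \<phi>'_def s_def)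
  show "\<bar>\<phi>' r\<bar> \<le> 1" using s(1,4)[of r] by (simp add: \<phi>'_def s_def)
  show "\<bar>r\<bar> - e \<le> \<phi> r" using s(4)[of r] by (simp add: \<phi>_def s_def)
  show "\<phi> r \<le> \<bar>r\<bar>"
    using e sqrt_sum_squares_le_sum_abs[of r e] by (simp add: \<phi>_def)
  have "r * r \<le> (2 * s r - e) * s r"
  proof -
    have "e * s r \<le> s r * s r" using s(1,3)[of r] by (intro mult_right_mono) auto
    moreover have "(2 * s r - e) * s r = 2 * (s r * s r) - e * s r" by (simp add: algebra_simps)
    moreover have "0 \<le> e * e" by simp
    ultimately show ?thesis using s(2)[of r] by linarith
  qed
  then have "r * r / s r \<le> 2 * s r - e"
    using s(1)[of r] by (simp add: pos_divide_le_eq)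
  then show "r * \<phi>' r \<le> 2 * \<phi> r + e"
    by (simp add: \<phi>'_def \<phi>_def s_def)
qed

context dirichlet_function
begin

lemma continuous_on_integral_compose:
  assumes phi: "\<And>r. (\<phi> has_real_derivative \<phi>' r) (at r)" and cont: "continuous_on UNIV \<phi>'"
  shows "continuous_on {t0..t1} (\<lambda>t. integral (cube a) (\<lambda>x. \<phi> (w x t)))"
  by (rule DERIV_continuous_on[OF integral_compose_has_derivative[OF phi cont]])

lemma interior_time:
  assumes "(f has_real_derivative D) (at t within {t0..t1})" "t \<in> {t0<..<t1}"
  shows "(f has_real_derivative D) (at t)"
proof -
  have "at t within {t0..t1} = at t" using assms(2) by (intro at_within_interior) auto
  then show ?thesis using assms(1) by simp
qed

text \<open>
  The entropy inequality for the regularised absolute value, in the limit \<open>e \<longlongrightarrow> 0\<close>: with derivative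
  bounded by one, the entropy picks up no more than the \<open>L\<^sup>1\<close> norm of the source \<open>g\<close>.
\<close>

lemma L1_growth:
  assumes t0: "0 \<le> t0" and c: "0 \<le> c"
    and F: "\<And>i t. t \<in> {t0<..<t1} \<Longrightarrow> has_gradient_on (cube a) (\<lambda>x. F x t $ i) (\<lambda>x. DF i x t)"
    and J: "\<And>t. t \<in> {t0<..<t1} \<Longrightarrow> continuous_on (cube a) (\<lambda>x. J x t)"
    and bound: "\<And>x t. x \<in> cube a \<Longrightarrow> t \<in> {t0<..<t1} \<Longrightarrow> \<bar>\<Sum>i\<in>UNIV. DF i x t $ i\<bar> + 2 * \<bar>J x t\<bar> \<le> c"
    and eq: "\<And>x t. x \<in> cube a \<Longrightarrow> t \<in> {t0<..<t1} \<Longrightarrow>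
       wt x t = 1/2 * lap x t + F x t \<bullet> G x t + J x t * w x t + g x t"
    and g: "\<And>t. t \<in> {t0<..<t1} \<Longrightarrow> continuous_on (cube a) (\<lambda>x. g x t)"
       "\<And>t. t \<in> {t0<..<t1} \<Longrightarrow> integral (cube a) (\<lambda>x. \<bar>g x t\<bar>) \<le> \<beta>' t * exp (c * t)"
    and \<beta>: "continuous_on {t0..t1} \<beta>" "\<And>t. t \<in> {t0<..<t1} \<Longrightarrow> (\<beta> has_real_derivative \<beta>' t) (at t)"
  shows "exp (- (c * t1)) * integral (cube a) (\<lambda>x. \<bar>w x t1\<bar>)
     \<le> exp (- (c * t0)) * integral (cube a) (\<lambda>x. \<bar>w x t0\<bar>) + (\<beta> t1 - \<beta> t0)"
proof -
  let ?I = "integral (cube a :: (real^'d) set)"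
  let ?vol = "measure lborel (cube a :: (real^'d) set)"
  \<comment> \<open>Per unit of \<open>e\<close>, the regularisation costs the volume at the final time and the slack of the entropy inequality over the interval.\<close>
  define K where "K = ?vol + c * ?vol * (t1 - t0)"
  have vol: "?vol \<ge> 0" by simp
  have approx: "exp (- (c * t1)) * ?I (\<lambda>x. \<bar>w x t1\<bar>)
      \<le> exp (- (c * t0)) * ?I (\<lambda>x. \<bar>w x t0\<bar>) + (\<beta> t1 - \<beta> t0) + K * e" if e: "e > 0" for e
  proof -
    define \<phi> where "\<phi> r = sqrt (r\<^sup>2 + e\<^sup>2) - e" for r
    define \<phi>' where "\<phi>' r = r / sqrt (r\<^sup>2 + e\<^sup>2)" for r
    define \<phi>'' where "\<phi>'' r = e\<^sup>2 / (sqrt (r\<^sup>2 + e\<^sup>2)) ^ 3" for r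
    note reg = regularised_abs[OF e, folded \<phi>_def[abs_def] \<phi>'_def[abs_def] \<phi>''_def[abs_def],
        folded \<phi>_def \<phi>'_def \<phi>''_def]
    have c\<phi>': "continuous_on UNIV \<phi>'"
      by (auto intro!: continuous_at_imp_continuous_on DERIV_isCont reg(2))
    have c\<phi>: "continuous_on UNIV \<phi>"
      by (auto intro!: continuous_at_imp_continuous_on DERIV_isCont reg(1))
    have int\<phi>: "(\<lambda>x. \<phi> (w x t)) integrable_on cube a" if "t \<in> {t0..t1}" for t
      by (rule integrable_on_cube, rule continuous_on_compose2[OF c\<phi> cont_slice(1)[OF that]]) simp
    have intw: "(\<lambda>x. \<bar>w x t\<bar>) integrable_on cube a" if "t \<in> {t0..t1}" for t
      by (intro integrable_on_cube continuous_intros cont_slice(1)[OF that])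
    define y where "y t = ?I (\<lambda>x. \<phi> (w x t))" for t
    define y' where "y' t = ?I (\<lambda>x. \<phi>' (w x t) * wt x t)" for t
    have ineq: "y' t \<le> c * y t + (\<beta>' t + c * e * ?vol) * exp (c * t)" if t: "t \<in> {t0<..<t1}" for t
    proof -
      have tt: "t \<in> {t0..t1}" using t by auto
      have "y' t \<le> c * y t + c * e * ?vol + ?I (\<lambda>x. \<phi>' (w x t) * g x t)"
        unfolding y_def y'_def
        by (rule entropy_inequality[OF tt reg(1,2,3) _ _ reg(4,5,6,7) _ F[OF t] J[OF t] bound[OF _ t] eq[OF _ t]])
           (use e in \<open>auto simp: \<phi>_def \<phi>'_def\<close>)
      also have "?I (\<lambda>x. \<phi>' (w x t) * g x t) \<le> ?I (\<lambda>x. \<bar>g x t\<bar>)"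
      proof (rule integral_le)
        show "(\<lambda>x. \<phi>' (w x t) * g x t) integrable_on cube a"
          by (intro integrable_on_cube continuous_intros g(1)[OF t]
               continuous_on_compose2[OF c\<phi>' cont_slice(1)[OF tt]]) simp
        show "(\<lambda>x. \<bar>g x t\<bar>) integrable_on cube a"
          by (intro integrable_on_cube continuous_intros g(1)[OF t])
        fix x
        have "\<bar>\<phi>' (w x t) * g x t\<bar> \<le> 1 * \<bar>g x t\<bar>"
          unfolding abs_mult using reg(8) by (intro mult_right_mono) auto
        then show "\<phi>' (w x t) * g x t \<le> \<bar>g x t\<bar>" by linarith
      qed
      also have "\<dots> \<le> \<beta>' t * exp (c * t)" by (rule g(2)[OF t])
      also have "c * e * ?vol \<le> c * e * ?vol * exp (c * t)"
        using mult_left_mono[of 1 "exp (c * t)" "c * e * ?vol"] c e vol t t0 by simp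
      finally show ?thesis by (simp add: algebra_simps)
    qed
    have "exp (- (c * t1)) * y t1 - (\<beta> t1 + c * e * ?vol * t1)
       \<le> exp (- (c * t0)) * y t0 - (\<beta> t0 + c * e * ?vol * t0)"
    proof (rule gronwall_decreasing[where y'=y' and \<beta>'="\<lambda>t. \<beta>' t + c * e * ?vol"])
      show "continuous_on {t0..t1} y"
        unfolding y_def[abs_def] by (rule continuous_on_integral_compose[OF reg(1) c\<phi>'])
      show "(y has_real_derivative y' t) (at t)" if "t \<in> {t0<..<t1}" for t
        using interior_time[OF integral_compose_has_derivative[OF reg(1) c\<phi>'] that] that
        by (simp add: y_def[abs_def] y'_def)
      show "continuous_on {t0..t1} (\<lambda>t. \<beta> t + c * e * ?vol * t)"
        by (intro continuous_intros \<beta>)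
      show "((\<lambda>t. \<beta> t + c * e * ?vol * t) has_real_derivative \<beta>' t + c * e * ?vol) (at t)"
        if "t \<in> {t0<..<t1}" for t
        using \<beta>(2)[OF that] by (auto intro!: derivative_eq_intros)
    qed (use t0_less_t1 ineq in auto)
    moreover have "?I (\<lambda>x. \<bar>w x t1\<bar>) - e * ?vol \<le> y t1"
    proof -
      have "?I (\<lambda>x. \<bar>w x t1\<bar> - e) \<le> y t1"
        unfolding y_def using t0_less_t1
        by (intro integral_le int\<phi> integrable_diff intw reg(10)) (auto intro!: integrable_on_cube)
      moreover have "?I (\<lambda>x. \<bar>w x t1\<bar> - e) = ?I (\<lambda>x. \<bar>w x t1\<bar>) - e * ?vol"
      proof -
        have "?I (\<lambda>x. e) = e * ?vol" by (simp add: cube_def)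
        then show ?thesis
          by (subst integral_diff) (use intw[of t1] t0_less_t1 in \<open>simp_all add: integrable_on_cube\<close>)
      qed
      ultimately show ?thesis by simp
    qed
    then have "exp (- (c * t1)) * (?I (\<lambda>x. \<bar>w x t1\<bar>) - e * ?vol) \<le> exp (- (c * t1)) * y t1"
      by (intro mult_left_mono) auto
    moreover have "exp (- (c * t0)) * y t0 \<le> exp (- (c * t0)) * ?I (\<lambda>x. \<bar>w x t0\<bar>)"
      unfolding y_def using t0_less_t1
      by (intro mult_left_mono integral_le int\<phi> intw reg(9)) auto
    moreover have "exp (- (c * t1)) * (e * ?vol) \<le> 1 * (e * ?vol)"
      using c t0 t0_less_t1 e vol by (intro mult_right_mono) auto
    moreover have "K * e = e * ?vol + (c * e * ?vol * t1 - c * e * ?vol * t0)"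
      by (simp add: K_def algebra_simps)
    moreover have "exp (- (c * t1)) * (?I (\<lambda>x. \<bar>w x t1\<bar>) - e * ?vol)
       = exp (- (c * t1)) * ?I (\<lambda>x. \<bar>w x t1\<bar>) - exp (- (c * t1)) * (e * ?vol)"
      by (rule right_diff_distrib)
    ultimately show ?thesis by linarith
  qed
  have K: "K \<ge> 0" using c vol t0_less_t1 by (simp add: K_def)
  show ?thesis
  proof (rule field_le_epsilon)
    fix d :: real assume d: "d > 0"
    have "K * (d / (K + 1)) \<le> d" using K d by (simp add: field_simps)
    then show "exp (- (c * t1)) * ?I (\<lambda>x. \<bar>w x t1\<bar>)
      \<le> exp (- (c * t0)) * ?I (\<lambda>x. \<bar>w x t0\<bar>) + (\<beta> t1 - \<beta> t0) + d"
      using approx[of "d / (K + 1)"] d K by (simp add: add_nonneg_pos)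
  qed
qed

lemma L2_growth:
  assumes F: "\<And>i t. t \<in> {t0<..<t1} \<Longrightarrow> has_gradient_on (cube a) (\<lambda>x. F x t $ i) (\<lambda>x. DF i x t)"
    and J: "\<And>t. t \<in> {t0<..<t1} \<Longrightarrow> continuous_on (cube a) (\<lambda>x. J x t)"
    and bound: "\<And>x t. x \<in> cube a \<Longrightarrow> t \<in> {t0<..<t1} \<Longrightarrow> \<bar>\<Sum>i\<in>UNIV. DF i x t $ i\<bar> + 2 * \<bar>J x t\<bar> \<le> c"
    and eq: "\<And>x t. x \<in> cube a \<Longrightarrow> t \<in> {t0<..<t1} \<Longrightarrow>
       wt x t = 1/2 * lap x t + F x t \<bullet> G x t + J x t * w x t"
    and t: "t \<in> {t0..t1}"
  shows "integral (cube a) (\<lambda>x. (w x t)\<^sup>2) \<le> exp (c * (t - t0)) * integral (cube a) (\<lambda>x. (w x t0)\<^sup>2)"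
proof -
  let ?I = "integral (cube a :: (real^'d) set)"
  define y where "y t = ?I (\<lambda>x. (w x t)\<^sup>2)" for t
  define y' where "y' t = ?I (\<lambda>x. 2 * w x t * wt x t)" for t
  have sq: "((\<lambda>r. r\<^sup>2) has_real_derivative 2 * r) (at r)" for r :: real
    by (auto intro!: derivative_eq_intros)
  have sq': "((\<lambda>r. 2 * r) has_real_derivative 2) (at r)" for r :: real
    by (auto intro!: derivative_eq_intros)
  have csq: "continuous_on UNIV (\<lambda>r::real. 2 * r)" by (intro continuous_intros)
  have "exp (- (c * t)) * y t - 0 \<le> exp (- (c * t0)) * y t0 - 0"
  proof (rule gronwall_decreasing[where y'=y' and \<beta>'="\<lambda>t. 0"])
    show "continuous_on {t0..t} y"
      using continuous_on_subset[OF continuous_on_integral_compose[OF sq csq]] t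
      by (auto simp: y_def[abs_def])
    fix s assume s: "s \<in> {t0<..<t}"
    then have s': "s \<in> {t0<..<t1}" "s \<in> {t0..t1}" using t by auto
    show "(y has_real_derivative y' s) (at s)"
      using interior_time[OF integral_compose_has_derivative[OF sq csq s'(2)] s'(1)]
      by (simp add: y_def[abs_def] y'_def)
    have "y' s \<le> c * y s + c * 0 * measure lborel (cube a :: (real^'d) set) + ?I (\<lambda>x. 2 * w x s * 0)"
      unfolding y_def y'_def
      by (rule entropy_inequality[OF s'(2) sq sq' _ _ _ _ _ _ _ _ F[OF s'(1)] J[OF s'(1)] bound[OF _ s'(1)]])
         (use eq[OF _ s'(1)] in \<open>auto simp: power2_eq_square\<close>)
    then show "y' s \<le> c * y s + 0 * exp (c * s)" by simp
  qed (use t in auto)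
  then have "exp (c * t) * (exp (- (c * t)) * y t) \<le> exp (c * t) * (exp (- (c * t0)) * y t0)"
    by (intro mult_left_mono) auto
  then show ?thesis
    by (simp add: y_def exp_minus exp_diff right_diff_distrib field_simps)
qed

end

context dirichlet_function
begin

text \<open>
  Inserting the equation into the energy identity and completing the square in the Laplacian leaves
  \<open>\<integral>(F\<cdot>\<nabla>w + J w)\<^sup>2\<close>, hence at most \<open>c\<^sup>2 \<parallel>\<nabla>w\<parallel>\<^sup>2 + (c\<^sup>2/4) \<parallel>w\<parallel>\<^sup>2\<close>. The growth of the last term is known from
  the entropy inequality for the square.
\<close>

lemma gradient_growth:
  assumes c: "0 \<le> c" and t0: "t0 = 0"
    and F: "\<And>i t. t \<in> {t0<..<t1} \<Longrightarrow> has_gradient_on (cube a) (\<lambda>x. F x t $ i) (\<lambda>x. DF i x t)"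
    and J: "\<And>t. t \<in> {t0<..<t1} \<Longrightarrow> continuous_on (cube a) (\<lambda>x. J x t)"
    and bound: "\<And>x t. x \<in> cube a \<Longrightarrow> t \<in> {t0<..<t1} \<Longrightarrow>
       \<bar>\<Sum>i\<in>UNIV. DF i x t $ i\<bar> + 2 * \<bar>J x t\<bar> + norm (F x t) \<le> c"
    and eq: "\<And>x t. x \<in> cube a \<Longrightarrow> t \<in> {t0<..<t1} \<Longrightarrow>
       wt x t = 1/2 * lap x t + F x t \<bullet> G x t + J x t * w x t"
  shows "integral (cube a) (\<lambda>x. G x t1 \<bullet> G x t1)
    \<le> exp (c\<^sup>2 * t1) * (integral (cube a) (\<lambda>x. G x 0 \<bullet> G x 0)
         + c\<^sup>2 * t1 * exp (c * t1) * integral (cube a) (\<lambda>x. (w x 0)\<^sup>2))"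
proof -
  let ?I = "integral (cube a :: (real^'d) set)"
  define y where "y t = ?I (\<lambda>x. G x t \<bullet> G x t)" for t
  define a0 where "a0 = ?I (\<lambda>x. (w x 0)\<^sup>2)"
  \<comment> \<open>The derivative of \<open>\<beta>\<close> dominates the contribution \<open>(c\<^sup>2/4) exp (c t) a0\<close> of the \<open>L\<^sup>2\<close> norm.\<close>
  define \<beta> where "\<beta> t = c\<^sup>2 * t * exp (c * t) * a0" for t
  define \<beta>' where "\<beta>' t = c\<^sup>2 * exp (c * t) * a0 + c\<^sup>2 * t * (c * exp (c * t)) * a0" for t
  have a0: "a0 \<ge> 0"
    using cont_slice(1)[of t0] t0_less_t1 t0 unfolding a0_def
    by (intro integral_nonneg) (auto intro!: integrable_on_cube continuous_intros)
  have "exp (- (c\<^sup>2 * t1)) * y t1 - \<beta> t1 \<le> exp (- (c\<^sup>2 * t0)) * y t0 - \<beta> t0"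
  proof (rule gronwall_decreasing[where y'="\<lambda>t. - 2 * ?I (\<lambda>x. wt x t * lap x t)" and \<beta>'=\<beta>'])
    show "continuous_on {t0..t1} y"
      unfolding y_def[abs_def] by (rule DERIV_continuous_on[OF gradient_energy_has_derivative])
    show "continuous_on {t0..t1} \<beta>"
      unfolding \<beta>_def[abs_def] by (intro continuous_intros)
    fix t assume t: "t \<in> {t0<..<t1}"
    then have tt: "t \<in> {t0..t1}" "t > 0" using t0 by auto
    show "(y has_real_derivative - 2 * ?I (\<lambda>x. wt x t * lap x t)) (at t)"
      unfolding y_def[abs_def] by (rule interior_time[OF gradient_energy_has_derivative[OF tt(1)] t])
    show "(\<beta> has_real_derivative \<beta>' t) (at t)"
      unfolding \<beta>_def[abs_def] \<beta>'_def by (auto intro!: derivative_eq_intros simp: algebra_simps)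
    note sl = cont_slice[OF tt(1)]
    have "- 2 * ?I (\<lambda>x. wt x t * lap x t) = ?I (\<lambda>x. - 2 * (wt x t * lap x t))"
      by (simp only: integral_mult_right)
    also have "\<dots> \<le> ?I (\<lambda>x. c\<^sup>2 * (G x t \<bullet> G x t) + c\<^sup>2 / 4 * (w x t)\<^sup>2)"
    proof (rule integral_le)
      fix x :: "real^'d" assume x: "x \<in> cube a"
      define q where "q = F x t \<bullet> G x t + J x t * w x t"
      define A B where "A = norm (F x t)" and "B = 2 * \<bar>J x t\<bar>"
      define X Y where "X = norm (G x t)" and "Y = \<bar>w x t\<bar> / 2"
      have nn: "A \<ge> 0" "B \<ge> 0" "X \<ge> 0" "Y \<ge> 0" by (auto simp: A_def B_def X_def Y_def)
      have "\<bar>q\<bar> \<le> A * X + B * Y"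
        unfolding q_def A_def B_def X_def Y_def
        using Cauchy_Schwarz_ineq2[of "F x t" "G x t"] abs_triangle_ineq[of "F x t \<bullet> G x t" "J x t * w x t"]
        by (simp add: abs_mult)
      then have "q\<^sup>2 \<le> (A * X + B * Y)\<^sup>2"
        by (metis abs_ge_zero power2_abs power_mono)
      also have "\<dots> \<le> (A + B)\<^sup>2 * (X\<^sup>2 + Y\<^sup>2)"
      proof -
        have "0 \<le> (A * Y - B * X)\<^sup>2 + 2 * (A * B) * (X\<^sup>2 + Y\<^sup>2)"
          using nn by (intro add_nonneg_nonneg mult_nonneg_nonneg) auto
        then show ?thesis by (simp add: power2_eq_square algebra_simps)
      qed
      also have "\<dots> \<le> c\<^sup>2 * (X\<^sup>2 + Y\<^sup>2)"
        using bound[OF x t] nn by (intro mult_right_mono power_mono) (auto simp: A_def B_def)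
      also have "\<dots> = c\<^sup>2 * (G x t \<bullet> G x t) + c\<^sup>2 / 4 * (w x t)\<^sup>2"
        by (simp add: X_def Y_def power2_norm_eq_inner power_divide algebra_simps)
      finally have "q\<^sup>2 \<le> c\<^sup>2 * (G x t \<bullet> G x t) + c\<^sup>2 / 4 * (w x t)\<^sup>2" .
      moreover have "- 2 * (wt x t * lap x t) = q\<^sup>2 - (lap x t + q)\<^sup>2"
        unfolding eq[OF x t] q_def by (simp add: power2_eq_square algebra_simps)
      moreover have "(lap x t + q)\<^sup>2 \<ge> 0" by simp
      ultimately show "- 2 * (wt x t * lap x t) \<le> c\<^sup>2 * (G x t \<bullet> G x t) + c\<^sup>2 / 4 * (w x t)\<^sup>2"
        by linarith
    qed (intro integrable_on_cube continuous_intros sl)+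
    also have "\<dots> = c\<^sup>2 * y t + c\<^sup>2 / 4 * ?I (\<lambda>x. (w x t)\<^sup>2)"
      unfolding y_def by (subst integral_add, (intro integrable_on_cube continuous_intros sl)+) simp
    also have "?I (\<lambda>x. (w x t)\<^sup>2) \<le> exp (c * t) * a0"
    proof -
      have "?I (\<lambda>x. (w x t)\<^sup>2) \<le> exp (c * (t - t0)) * ?I (\<lambda>x. (w x t0)\<^sup>2)"
      proof (rule L2_growth[OF F J _ eq tt(1)])
        fix x :: "real^'d" and s :: real assume "x \<in> cube a" "s \<in> {t0<..<t1}"
        from bound[OF this] show "\<bar>\<Sum>i\<in>UNIV. DF i x s $ i\<bar> + 2 * \<bar>J x s\<bar> \<le> c"
          using norm_ge_zero[of "F x s"] by linarith
      qed
      then show ?thesis using t0 by (simp add: a0_def)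
    qed
    also have "c\<^sup>2 / 4 * (exp (c * t) * a0) \<le> \<beta>' t * exp (c\<^sup>2 * t)"
    proof -
      have "c\<^sup>2 / 4 * (exp (c * t) * a0) \<le> c\<^sup>2 * exp (c * t) * a0"
        using a0 by (simp add: mult_left_mono divide_right_mono)
      also have "\<dots> \<le> \<beta>' t" using c tt a0 by (simp add: \<beta>'_def)
      also have "\<dots> \<le> \<beta>' t * exp (c\<^sup>2 * t)"
      proof -
        have "0 \<le> \<beta>' t" using c tt a0 by (simp add: \<beta>'_def)
        moreover have "1 \<le> exp (c\<^sup>2 * t)" using tt by simp
        ultimately show ?thesis using mult_left_mono[of 1 "exp (c\<^sup>2 * t)" "\<beta>' t"] by simp
      qed
      finally show ?thesis .
    qed
    finally show "- 2 * ?I (\<lambda>x. wt x t * lap x t) \<le> c\<^sup>2 * y t + \<beta>' t * exp (c\<^sup>2 * t)"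
      by (simp add: mult_left_mono)
  qed (use t0_less_t1 in auto)
  then have "exp (- (c\<^sup>2 * t1)) * y t1 \<le> y 0 + \<beta> t1"
    using t0 by (simp add: \<beta>_def)
  moreover have "y t1 = exp (c\<^sup>2 * t1) * (exp (- (c\<^sup>2 * t1)) * y t1)"
    by (simp add: exp_minus)
  ultimately have "y t1 \<le> exp (c\<^sup>2 * t1) * (y 0 + \<beta> t1)"
    by (metis exp_ge_zero mult_left_mono)
  then show ?thesis
    by (simp only: y_def \<beta>_def a0_def)
qed

end

section \<open>The error of freezing the coefficients\<close>

text \<open>
  The variance of \<open>f\<close> with respect to the uniform distribution on the cube is nonnegative.
\<close>

lemma L1_le_L2:
  fixes f :: "real^'d \<Rightarrow> real"
  assumes a: "a > 0" and f: "continuous_on (cube a) f"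
  shows "integral (cube a) f \<le> sqrt (measure lborel (cube a :: (real^'d) set)) * sqrt (integral (cube a) (\<lambda>x. (f x)\<^sup>2))"
proof -
  let ?I = "integral (cube a :: (real^'d) set)" and ?V = "measure lborel (cube a :: (real^'d) set)"
  have V: "?V > 0"
    using a by (simp add: cube_def content_pos_lt_eq Basis_vec_def inner_axis)
  define m where "m = ?I f / ?V"
  note ci = continuous_intros f
  have "0 \<le> ?I (\<lambda>x. (f x - m)\<^sup>2)"
    by (intro integral_nonneg integrable_on_cube ci) auto
  also have "(\<lambda>x. (f x - m)\<^sup>2) = (\<lambda>x. (f x)\<^sup>2 - 2 * m * f x + m\<^sup>2)"
    by (auto simp: power2_eq_square algebra_simps)
  also have "?I \<dots> = ?I (\<lambda>x. (f x)\<^sup>2) - 2 * m * ?I f + m\<^sup>2 * ?V"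
    by (subst integral_add, (intro integrable_on_cube ci)+, subst integral_diff, (intro integrable_on_cube ci)+)
       (simp add: cube_def)
  also have "\<dots> = ?I (\<lambda>x. (f x)\<^sup>2) - (?I f)\<^sup>2 / ?V"
    using V by (simp add: m_def power2_eq_square field_simps)
  finally have "(?I f)\<^sup>2 \<le> ?V * ?I (\<lambda>x. (f x)\<^sup>2)"
    using V by (simp add: field_simps)
  then have "\<bar>?I f\<bar> \<le> sqrt (?V * ?I (\<lambda>x. (f x)\<^sup>2))"
    by (metis real_sqrt_abs real_sqrt_le_mono)
  then show ?thesis by (simp add: real_sqrt_mult)
qed

lemma has_derivative_grad:
  fixes g :: "real^'d \<Rightarrow> real"
  assumes "g differentiable (at x within S)"
  shows "(g has_derivative (\<lambda>v. v \<bullet> grad S g x)) (at x within S)"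
proof -
  let ?D = "frechet_derivative g (at x within S)"
  have D: "(g has_derivative ?D) (at x within S)"
    using assms frechet_derivative_works by blast
  then have lin: "linear ?D" by (rule has_derivative_linear)
  have "?D v = v \<bullet> grad S g x" for v
  proof -
    have "?D v = ?D (\<Sum>i\<in>UNIV. (v $ i) *\<^sub>R axis i 1)"
      using basis_expansion[of v] by (simp add: scalar_mult_eq_scaleR)
    also have "\<dots> = (\<Sum>i\<in>UNIV. v $ i * ?D (axis i 1))"
      by (simp add: linear_sum[OF lin] linear_scale[OF lin])
    finally show ?thesis by (simp add: grad_def pderiv_within_def inner_vec_def)
  qed
  then have "?D = (\<lambda>v. v \<bullet> grad S g x)" by blast
  with D show ?thesis by simp
qed

lemma cube_has_derivative_unique:
  fixes f :: "real^'d \<Rightarrow> real"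
  assumes "a > 0" "x \<in> cube a" "(f has_derivative f') (at x within cube a)" "(f has_derivative f'') (at x within cube a)"
  shows "f' = f''"
  using assms(2-4) unfolding cube_def
  by (rule frechet_derivative_unique_within_closed_interval[rotated])
     (use assms(1) in \<open>auto simp: Basis_vec_def inner_axis\<close>)

lemma closure_interior_cube: "a > 0 \<Longrightarrow> closure (interior (cube a :: (real^'d) set)) = cube a"
proof -
  assume "a > 0"
  then have "box (\<chi> i. - a) (\<chi> i. a) \<noteq> ({} :: (real^'d) set)"
    by (auto simp: box_ne_empty Basis_vec_def inner_axis)
  then show ?thesis unfolding cube_def interior_cbox by (rule closure_box)
qed

lemma solves_dirichlet_imp_dirichlet_function:
  assumes "t0 < t1" "solves_dirichlet (cube a) t0 t1 F J g u"
  shows "dirichlet_function a t0 t1 u (\<lambda>x t. time_deriv {t0..t1} (u x) t)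
     (\<lambda>x t. grad (cube a) (\<lambda>z. u z t) x) (\<lambda>i x t. grad (cube a) (pderiv_within (cube a) i (\<lambda>z. u z t)) x)"
proof -
  let ?S = "cube a :: (real^'d) set" and ?T = "{t0..t1}"
  have C: "C21_on ?S ?T u" and b: "\<forall>x\<in>frontier ?S. \<forall>t\<in>?T. u x t = 0"
    using assms(2) by (auto simp: solves_dirichlet_def)
  have d1: "(\<lambda>z. u z t) differentiable (at x within ?S)"
    and d2: "pderiv_within ?S i (\<lambda>z. u z t) differentiable (at x within ?S)"
    and dt: "u x differentiable (at t within ?T)" if "x \<in> ?S" "t \<in> ?T" for x t i
    using C that unfolding C21_on_def by auto
  have cu: "continuous_on (?S \<times> ?T) (\<lambda>(x, t). u x t)"
    and ct: "continuous_on (?S \<times> ?T) (\<lambda>(x, t). time_deriv ?T (u x) t)"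
    and c1: "continuous_on (?S \<times> ?T) (\<lambda>(x, t). pderiv_within ?S i (\<lambda>z. u z t) x)"
    and c2: "continuous_on (?S \<times> ?T) (\<lambda>(x, t). pderiv_within ?S k (pderiv_within ?S i (\<lambda>z. u z t)) x)" for i k
    using C unfolding C21_on_def by auto
  have cg: "continuous_on (?S \<times> ?T) (\<lambda>(x, t). grad ?S (\<lambda>z. u z t) x)"
    unfolding grad_def case_prod_beta using c1 by (intro continuous_on_vec_lambda) (simp add: case_prod_beta)
  have cgg: "continuous_on (?S \<times> ?T) (\<lambda>(x, t). grad ?S (pderiv_within ?S i (\<lambda>z. u z t)) x)" for i
    unfolding grad_def case_prod_beta using c2 by (intro continuous_on_vec_lambda) (simp add: case_prod_beta)
  show ?thesis
  proof
    show "(u x has_real_derivative time_deriv ?T (u x) t) (at t within ?T)" if "x \<in> ?S" "t \<in> ?T" for x t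
      using dt[OF that] by (simp add: time_deriv_def vector_derivative_works has_real_derivative_iff_has_vector_derivative)
    show "has_gradient_on ?S (\<lambda>x. u x t) (\<lambda>x. grad ?S (\<lambda>z. u z t) x)" if "t \<in> ?T" for t
      using d1 that continuous_on_fix_snd[OF cg that]
      by (auto simp: has_gradient_on_def intro!: has_derivative_grad)
    show "has_gradient_on ?S (\<lambda>x. grad ?S (\<lambda>z. u z t) x $ i) (\<lambda>x. grad ?S (pderiv_within ?S i (\<lambda>z. u z t)) x)"
      if "t \<in> ?T" for t i
    proof -
      have "(\<lambda>x. grad ?S (\<lambda>z. u z t) x $ i) = pderiv_within ?S i (\<lambda>z. u z t)"
        by (auto simp: grad_def)
      then show ?thesis
        using d2 that continuous_on_fix_snd[OF cgg that]
        by (auto simp: has_gradient_on_def intro!: has_derivative_grad)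
    qed
    show "continuous_on (?S \<times> ?T) (\<lambda>(x, t). \<Sum>i\<in>UNIV. grad ?S (pderiv_within ?S i (\<lambda>z. u z t)) x $ i)"
      using c2 by (simp add: case_prod_beta grad_def continuous_on_sum)
  qed (use assms(1) cu ct cg b in auto)
qed

text \<open>
  An equation between continuous functions on the open cube extends to its closure. Integrals over the
  cube may then use the equation pointwise, without an exceptional null set.
\<close>

lemma solves_dirichlet_closed:
  fixes F :: "real^'d \<Rightarrow> real \<Rightarrow> real^'d"
  assumes a: "a > 0" and T: "t0 < t1" and sol: "solves_dirichlet (cube a) t0 t1 F J g u"
    and F: "continuous_on (cube a) (\<lambda>x. F x t)" and J: "continuous_on (cube a) (\<lambda>x. J x t)"
    and x: "x \<in> cube a" and t: "t \<in> {t0<..t1}"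
  shows "time_deriv {t0..t1} (u x) t = 1/2 * laplacian (cube a) (\<lambda>z. u z t) x
       + F x t \<bullet> grad (cube a) (\<lambda>z. u z t) x + J x t * u x t"
proof -
  interpret dirichlet_function a t0 t1 u "\<lambda>x t. time_deriv {t0..t1} (u x) t"
     "\<lambda>x t. grad (cube a) (\<lambda>z. u z t) x" "\<lambda>i x t. grad (cube a) (pderiv_within (cube a) i (\<lambda>z. u z t)) x"
    by (rule solves_dirichlet_imp_dirichlet_function[OF T sol])
  have lap_eq: "lap x t = laplacian (cube a) (\<lambda>z. u z t) x" for x
    unfolding lap_def laplacian_def by (simp add: grad_def)
  have tt: "t \<in> {t0..t1}" using t by auto
  define r where "r x = time_deriv {t0..t1} (u x) t
     - (1/2 * lap x t + F x t \<bullet> grad (cube a) (\<lambda>z. u z t) x + J x t * u x t)" for x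
  have "r x = 0"
  proof (rule continuous_constant_on_closure[where S="interior (cube a)" and f=r])
    show "continuous_on (closure (interior (cube a))) r"
      unfolding closure_interior_cube[OF a] r_def[abs_def]
      by (intro continuous_intros cont_slice[OF tt] F J)
    show "r z = 0" if "z \<in> interior (cube a)" for z
      using sol that t unfolding solves_dirichlet_def r_def by (auto simp: lap_eq)
  qed (simp add: closure_interior_cube[OF a] x)
  then show ?thesis by (simp add: r_def lap_eq)
qed

lemma has_gradient_on_components_continuous:
  fixes F :: "real^'d \<Rightarrow> real^'d"
  assumes "\<And>i. has_gradient_on S (\<lambda>x. F x $ i) (DF i)"
  shows "continuous_on S F"
proof -
  have "continuous_on S (\<lambda>x. \<chi> i. F x $ i)"
    by (intro continuous_on_vec_lambda has_gradient_on_imp_continuous_on[OF assms])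
  then show ?thesis by simp
qed

text \<open>
  Both bounds carry the factor \<open>exp (c3 t)\<close> with the current time \<open>t\<close>, as the weighted accumulation of
  the freezing errors demands. For the gradient, \<open>c3\<^sup>2 t exp (c3 t)\<close> from the energy estimate is
  absorbed by \<open>(exp (c3 t))\<^sup>2\<close>; the bound \<open>exp (c3 t) \<le> exp (2 c3\<^sup>2 T)\<close> would fail for small \<open>c3\<close>.
\<close>

lemma solution_L1_gradient_bounds:
  fixes u :: "real^'d \<Rightarrow> real \<Rightarrow> real"
  assumes a: "a > 0" and T: "T > 0" and c3: "c3 \<ge> 0"
    and dmz: "solves_dirichlet (cube a) 0 T F J g u"
    and F: "\<And>i t. t \<in> {0..T} \<Longrightarrow> has_gradient_on (cube a) (\<lambda>x. F x t $ i) (\<lambda>x. DF i x t)"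
    and J: "\<And>t. t \<in> {0..T} \<Longrightarrow> continuous_on (cube a) (\<lambda>x. J x t)"
    and bound: "\<And>x t. x \<in> cube a \<Longrightarrow> t \<in> {0..T} \<Longrightarrow>
       \<bar>\<Sum>i\<in>UNIV. DF i x t $ i\<bar> + 2 * \<bar>J x t\<bar> + norm (F x t) \<le> c3"
    and t: "t \<in> {0<..T}"
  shows "integral (cube a) (\<lambda>x. \<bar>u x t\<bar>) \<le> exp (c3 * t) * integral (cube a) (\<lambda>x. \<bar>u x 0\<bar>)"
    and "integral (cube a) (\<lambda>x. norm (grad (cube a) (\<lambda>z. u z t) x))
       \<le> exp (c3 * t) * (sqrt (measure lborel (cube a :: (real^'d) set)) * exp (c3\<^sup>2 * T)
           * sqrt (2 * c3\<^sup>2 * T * integral (cube a) (\<lambda>x. (u x 0)\<^sup>2)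
                  + integral (cube a) (\<lambda>x. (norm (grad (cube a) (\<lambda>z. u z 0) x))\<^sup>2)))"
proof -
  let ?S = "cube a :: (real^'d) set"
  let ?I = "integral ?S"
  define ut where "ut x t = time_deriv {0..T} (u x) t" for x t
  define G where "G x t = grad ?S (\<lambda>z. u z t) x" for x t
  define H where "H i x t = grad ?S (pderiv_within ?S i (\<lambda>z. u z t)) x" for i x t
  have "dirichlet_function a 0 T u ut G H"
    unfolding ut_def G_def H_def by (rule solves_dirichlet_imp_dirichlet_function[OF T dmz])
  then have "dirichlet_function a 0 t u ut G H"
    by (rule dirichlet_function_subinterval) (use t in auto)
  then interpret dirichlet_function a 0 t u ut G H .
  have eq: "ut x s = 1/2 * lap x s + F x s \<bullet> G x s + J x s * u x s" if "x \<in> ?S" "s \<in> {0<..<t}" for x s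
  proof -
    have s: "s \<in> {0<..T}" "s \<in> {0..T}" using that t by auto
    have "lap x s = laplacian ?S (\<lambda>z. u z s) x"
      unfolding lap_def H_def laplacian_def by (simp add: grad_def)
    then show ?thesis
      using solves_dirichlet_closed[OF a T dmz has_gradient_on_components_continuous[OF F[OF s(2)]] J[OF s(2)] that(1) s(1)]
      by (simp add: ut_def G_def)
  qed
  have sub: "s \<in> {0..T}" if "s \<in> {0<..<t}" for s using that t by auto
  have bound': "\<bar>\<Sum>i\<in>UNIV. DF i x s $ i\<bar> + 2 * \<bar>J x s\<bar> \<le> c3" if "x \<in> ?S" "s \<in> {0<..<t}" for x s
    using bound[OF that(1) sub[OF that(2)]] norm_ge_zero[of "F x s"] by linarith
  have "exp (- (c3 * t)) * ?I (\<lambda>x. \<bar>u x t\<bar>) \<le> exp (- (c3 * 0)) * ?I (\<lambda>x. \<bar>u x 0\<bar>) + (0 - 0)"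
    by (rule L1_growth[where g="\<lambda>x t. 0" and \<beta>="\<lambda>t. 0" and \<beta>'="\<lambda>t. 0", OF _ c3 F[OF sub] J[OF sub] bound'])
       (use eq in auto)
  then have "exp (c3 * t) * (exp (- (c3 * t)) * ?I (\<lambda>x. \<bar>u x t\<bar>)) \<le> exp (c3 * t) * ?I (\<lambda>x. \<bar>u x 0\<bar>)"
    by (intro mult_left_mono) auto
  moreover have "exp (c3 * t) * (exp (- (c3 * t)) * ?I (\<lambda>x. \<bar>u x t\<bar>)) = ?I (\<lambda>x. \<bar>u x t\<bar>)"
    by (simp add: exp_minus)
  ultimately show "?I (\<lambda>x. \<bar>u x t\<bar>) \<le> exp (c3 * t) * ?I (\<lambda>x. \<bar>u x 0\<bar>)" by linarith

  define a0 where "a0 = ?I (\<lambda>x. (u x 0)\<^sup>2)"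
  define b0 where "b0 = ?I (\<lambda>x. G x 0 \<bullet> G x 0)"
  have T0: "0 \<in> {0..t}" "t \<in> {0..t}" using t by auto
  have nn: "a0 \<ge> 0" "b0 \<ge> 0"
    unfolding a0_def b0_def
    by (intro integral_nonneg integrable_on_cube continuous_intros cont_slice[OF T0(1)]; simp)+
  have "?I (\<lambda>x. G x t \<bullet> G x t) \<le> exp (c3\<^sup>2 * t) * (b0 + c3\<^sup>2 * t * exp (c3 * t) * a0)"
    unfolding a0_def b0_def
    by (rule gradient_growth[OF c3 refl F[OF sub] J[OF sub] bound[OF _ sub] eq])
  also have "\<dots> \<le> (exp (c3\<^sup>2 * T))\<^sup>2 * ((exp (c3 * t))\<^sup>2 * (2 * c3\<^sup>2 * T * a0 + b0))"
  proof (intro mult_mono)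
    have "exp (c3\<^sup>2 * t) \<le> exp (c3\<^sup>2 * T)" using t by (simp add: mult_left_mono)
    also have "\<dots> \<le> (exp (c3\<^sup>2 * T))\<^sup>2"
      using T by (simp add: power2_eq_square)
    finally show "exp (c3\<^sup>2 * t) \<le> (exp (c3\<^sup>2 * T))\<^sup>2" .
    have e: "1 \<le> exp (c3 * t)" using c3 t by simp
    then have e2: "exp (c3 * t) \<le> (exp (c3 * t))\<^sup>2" "1 \<le> (exp (c3 * t))\<^sup>2"
      using mult_left_mono[OF e, of "exp (c3 * t)"] one_le_power[OF e, of 2]
      by (simp_all add: power2_eq_square)
    have "c3\<^sup>2 * t * exp (c3 * t) * a0 \<le> 2 * c3\<^sup>2 * T * (exp (c3 * t))\<^sup>2 * a0"
      using t e2 nn by (intro mult_mono) auto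
    moreover have "1 * b0 \<le> (exp (c3 * t))\<^sup>2 * b0"
      using e2 nn by (intro mult_right_mono) auto
    ultimately show "b0 + c3\<^sup>2 * t * exp (c3 * t) * a0 \<le> (exp (c3 * t))\<^sup>2 * (2 * c3\<^sup>2 * T * a0 + b0)"
      by (simp add: algebra_simps)
  qed (use nn t in auto)
  also have "\<dots> = (exp (c3 * t) * exp (c3\<^sup>2 * T))\<^sup>2 * (2 * c3\<^sup>2 * T * a0 + b0)"
    by (simp add: power_mult_distrib)
  finally have "sqrt (?I (\<lambda>x. G x t \<bullet> G x t)) \<le> sqrt ((exp (c3 * t) * exp (c3\<^sup>2 * T))\<^sup>2 * (2 * c3\<^sup>2 * T * a0 + b0))"
    by (rule real_sqrt_le_mono)
  also have "\<dots> = exp (c3 * t) * exp (c3\<^sup>2 * T) * sqrt (2 * c3\<^sup>2 * T * a0 + b0)"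
    by (simp add: real_sqrt_mult)
  finally have *: "sqrt (?I (\<lambda>x. G x t \<bullet> G x t)) \<le> exp (c3 * t) * exp (c3\<^sup>2 * T) * sqrt (2 * c3\<^sup>2 * T * a0 + b0)" .
  have "?I (\<lambda>x. norm (G x t)) \<le> sqrt (measure lborel ?S) * sqrt (?I (\<lambda>x. (norm (G x t))\<^sup>2))"
    by (rule L1_le_L2[OF a]) (intro continuous_intros cont_slice[OF T0(2)])
  also have "\<dots> \<le> sqrt (measure lborel ?S) * (exp (c3 * t) * exp (c3\<^sup>2 * T) * sqrt (2 * c3\<^sup>2 * T * a0 + b0))"
    using * by (intro mult_left_mono) (auto simp: power2_norm_eq_inner)
  finally show "?I (\<lambda>x. norm (grad ?S (\<lambda>z. u z t) x))
       \<le> exp (c3 * t) * (sqrt (measure lborel ?S) * exp (c3\<^sup>2 * T)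
           * sqrt (2 * c3\<^sup>2 * T * ?I (\<lambda>x. (u x 0)\<^sup>2) + ?I (\<lambda>x. (norm (grad ?S (\<lambda>z. u z 0) x))\<^sup>2)))"
    by (simp add: a0_def b0_def G_def power2_norm_eq_inner mult_ac)
qed

lemma tnode_simps [simp]: "tnode T Nt 0 = 0" "Nt \<ge> 1 \<Longrightarrow> tnode T Nt Nt = T"
  by (auto simp: tnode_def)

lemma tnode_Suc: "tnode T Nt (Suc j) = tnode T Nt j + T / real Nt"
  by (simp add: tnode_def algebra_simps add_divide_distrib)

lemma tnode_in:
  assumes "T > 0" "j \<le> Nt" shows "tnode T Nt j \<in> {0..T}"
proof (cases "Nt = 0")
  case False
  then have "real j * T \<le> real Nt * T" using assms by (intro mult_right_mono) auto
  then show ?thesis using assms False by (simp add: tnode_def field_simps)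
qed (use assms in \<open>auto simp: tnode_def\<close>)

text \<open>
  The weighted distance \<open>exp (- c3 t) \<parallel>u - u\<^sub>j\<parallel>\<^sub>1\<close> is continuous across the nodes, because \<open>u\<^sub>j\<close> starts from
  the final value of \<open>u\<^sub>j\<^sub>-\<^sub>1\<close>, and it increases by at most \<open>\<kappa> \<Delta>\<^sup>\<alpha>\<^sup>+\<^sup>1 / (\<alpha> + 1)\<close> on each interval.
\<close>

lemma freezing_error:
  fixes u :: "real^'d \<Rightarrow> real \<Rightarrow> real"
  assumes a: "a > 0" and T: "T > 0" and Nt: "Nt \<ge> 1" and \<alpha>: "\<alpha> > 0"
    and dmz: "solves_dirichlet (cube a) 0 T F J g u"
    and uj0: "\<And>x. x \<in> cube a \<Longrightarrow> uj 0 x (tnode T Nt 0) = g x"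
    and frozen: "\<And>j. j \<in> {1..Nt} \<Longrightarrow>
          solves_dirichlet (cube a) (tnode T Nt (j - 1)) (tnode T Nt j)
            (\<lambda>x t. F x (tnode T Nt (j - 1))) (\<lambda>x t. J x (tnode T Nt (j - 1)))
            (\<lambda>x. uj (j - 1) x (tnode T Nt (j - 1))) (uj j)"
    and F: "\<And>i t. t \<in> {0..T} \<Longrightarrow> has_gradient_on (cube a) (\<lambda>x. F x t $ i) (\<lambda>x. DF i x t)"
    and J: "\<And>t. t \<in> {0..T} \<Longrightarrow> continuous_on (cube a) (\<lambda>x. J x t)"
    and bound: "\<And>x t. x \<in> cube a \<Longrightarrow> t \<in> {0..T} \<Longrightarrow>
       \<bar>\<Sum>i\<in>UNIV. DF i x t $ i\<bar> + 2 * \<bar>J x t\<bar> + norm (F x t) \<le> c3"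
    and hoelder: "\<And>x t s. x \<in> cube a \<Longrightarrow> t \<in> {0..T} \<Longrightarrow> s \<in> {0..T} \<Longrightarrow>
       norm (F x t - F x s) + \<bar>J x t - J x s\<bar> \<le> c4 * \<bar>t - s\<bar> powr \<alpha>"
    and mass: "integral (cube a) (\<lambda>x. \<bar>u x 0\<bar>) \<le> 1"
    and c5: "c5 = c4 * exp (c3 * T) + c4 * sqrt (measure lborel (cube a :: (real^'d) set))
          * exp (c3\<^sup>2 * T)
          * sqrt (2 * c3\<^sup>2 * T * integral (cube a) (\<lambda>x. (u x 0)\<^sup>2)
                  + integral (cube a) (\<lambda>x. (norm (grad (cube a) (\<lambda>z. u z 0) x))\<^sup>2))"
  shows "c5 \<ge> 0" and "integral (cube a) (\<lambda>x. \<bar>u x T - uj Nt x T\<bar>)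
     \<le> exp (c3 * T) * c5 * (T * (T / real Nt) powr \<alpha> / (\<alpha> + 1))"
proof -
  let ?S = "cube a :: (real^'d) set"
  let ?I = "integral ?S"
  define q where "q = sqrt (measure lborel ?S) * exp (c3\<^sup>2 * T)
          * sqrt (2 * c3\<^sup>2 * T * ?I (\<lambda>x. (u x 0)\<^sup>2) + ?I (\<lambda>x. (norm (grad ?S (\<lambda>z. u z 0) x))\<^sup>2))"
  define \<kappa> where "\<kappa> = c4 * (1 + q)"
  define \<Delta> where "\<Delta> = T / real Nt"
  have \<Delta>: "\<Delta> > 0" using T Nt by (simp add: \<Delta>_def)
  have zero: "0 \<in> ?S" using a by (simp add: cube_def mem_box_cart)
  have c3: "c3 \<ge> 0"
  proof -
    have "0 \<le> \<bar>\<Sum>i\<in>UNIV. DF i 0 0 $ i\<bar> + 2 * \<bar>J 0 0\<bar> + norm (F 0 0)" by simp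
    also have "\<dots> \<le> c3" using bound[OF zero, of 0] T by simp
    finally show ?thesis .
  qed
  have c4: "c4 \<ge> 0"
  proof -
    have "0 \<le> norm (F 0 T - F 0 0) + \<bar>J 0 T - J 0 0\<bar>" by simp
    also have "\<dots> \<le> c4 * \<bar>T - 0\<bar> powr \<alpha>" using hoelder[OF zero, of T 0] T by simp
    finally show ?thesis using T by (simp add: zero_le_mult_iff)
  qed
  have uD: "dirichlet_function a 0 T u (\<lambda>x t. time_deriv {0..T} (u x) t)
     (\<lambda>x t. grad ?S (\<lambda>z. u z t) x) (\<lambda>i x t. grad ?S (pderiv_within ?S i (\<lambda>z. u z t)) x)"
    by (rule solves_dirichlet_imp_dirichlet_function[OF T dmz])
  interpret U: dirichlet_function a 0 T u "\<lambda>x t. time_deriv {0..T} (u x) t"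
     "\<lambda>x t. grad ?S (\<lambda>z. u z t) x" "\<lambda>i x t. grad ?S (pderiv_within ?S i (\<lambda>z. u z t)) x"
    by (rule uD)
  have T0: "0 \<in> {0..T}" using T by simp
  have q: "q \<ge> 0"
  proof -
    have "0 \<le> ?I (\<lambda>x. (u x 0)\<^sup>2)" "0 \<le> ?I (\<lambda>x. (norm (grad ?S (\<lambda>z. u z 0) x))\<^sup>2)"
      by (intro integral_nonneg integrable_on_cube continuous_intros U.cont_slice[OF T0]; simp)+
    then show ?thesis using T unfolding q_def by (intro mult_nonneg_nonneg) auto
  qed
  have c5_eq: "c5 = c4 * exp (c3 * T) + c4 * q" by (simp add: c5 q_def mult.assoc)
  show "c5 \<ge> 0" using c4 q by (simp add: c5_eq)
  have \<kappa>: "\<kappa> \<ge> 0" "\<kappa> \<le> c5"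
  proof -
    show "\<kappa> \<ge> 0" using c4 q by (simp add: \<kappa>_def)
    have "c4 * 1 \<le> c4 * exp (c3 * T)" using c3 c4 T by (intro mult_left_mono) auto
    then show "\<kappa> \<le> c5" by (simp add: \<kappa>_def c5_eq algebra_simps)
  qed
  have source: "c4 * (?I (\<lambda>x. norm (grad ?S (\<lambda>z. u z t) x)) + ?I (\<lambda>x. \<bar>u x t\<bar>)) \<le> \<kappa> * exp (c3 * t)"
    if t: "t \<in> {0<..T}" for t
  proof -
    have b1: "?I (\<lambda>x. \<bar>u x t\<bar>) \<le> exp (c3 * t) * ?I (\<lambda>x. \<bar>u x 0\<bar>)"
      by (rule solution_L1_gradient_bounds(1)[OF a T c3 dmz F J bound t])
    have b2: "?I (\<lambda>x. norm (grad ?S (\<lambda>z. u z t) x)) \<le> exp (c3 * t) * q"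
      unfolding q_def by (rule solution_L1_gradient_bounds(2)[OF a T c3 dmz F J bound t])
    have "?I (\<lambda>x. \<bar>u x t\<bar>) \<le> exp (c3 * t) * 1"
      using order_trans[OF b1 mult_left_mono[OF mass exp_ge_zero]] .
    then have "?I (\<lambda>x. norm (grad ?S (\<lambda>z. u z t) x)) + ?I (\<lambda>x. \<bar>u x t\<bar>) \<le> exp (c3 * t) * (1 + q)"
      using b2 by (simp add: distrib_left)
    then have "c4 * (?I (\<lambda>x. norm (grad ?S (\<lambda>z. u z t) x)) + ?I (\<lambda>x. \<bar>u x t\<bar>)) \<le> c4 * (exp (c3 * t) * (1 + q))"
      using c4 by (rule mult_left_mono)
    then show ?thesis by (simp add: \<kappa>_def mult_ac)
  qed
  have step: "exp (- (c3 * tnode T Nt (Suc j))) * ?I (\<lambda>x. \<bar>u x (tnode T Nt (Suc j)) - uj (Suc j) x (tnode T Nt (Suc j))\<bar>)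
     \<le> exp (- (c3 * tnode T Nt j)) * ?I (\<lambda>x. \<bar>u x (tnode T Nt j) - uj j x (tnode T Nt j)\<bar>)
        + \<kappa> * (\<Delta> powr (\<alpha> + 1) / (\<alpha> + 1))" if j: "j < Nt" for j
  proof -
    define s where "s = tnode T Nt j"
    define s1 where "s1 = tnode T Nt (Suc j)"
    define v where "v = uj (Suc j)"
    have s1: "s1 = s + \<Delta>" by (simp add: s_def s1_def tnode_Suc \<Delta>_def)
    have s_in: "s \<in> {0..T}" "s1 \<in> {0..T}"
      using tnode_in[OF T, of j Nt] tnode_in[OF T, of "Suc j" Nt] j by (auto simp: s_def s1_def)
    have ss1: "s < s1" using \<Delta> s1 by simp
    have fr: "solves_dirichlet ?S s s1 (\<lambda>x t. F x s) (\<lambda>x t. J x s) (\<lambda>x. uj j x s) v"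
      using frozen[of "Suc j"] j by (simp add: s_def s1_def v_def)
    define Gu where "Gu x t = grad ?S (\<lambda>z. u z t) x" for x t
    define Gv where "Gv x t = grad ?S (\<lambda>z. v z t) x" for x t
    define gg where "gg x t = (F x t - F x s) \<bullet> Gu x t + (J x t - J x s) * u x t" for x t
    note uD' = dirichlet_function_subinterval[OF uD, of s s1]
    have uD'': "dirichlet_function a s s1 u (\<lambda>x t. time_deriv {0..T} (u x) t)
      (\<lambda>x t. Gu x t) (\<lambda>i x t. grad ?S (pderiv_within ?S i (\<lambda>z. u z t)) x)"
      unfolding Gu_def using uD' s_in ss1 by auto
    have vD: "dirichlet_function a s s1 v (\<lambda>x t. time_deriv {s..s1} (v x) t)
      (\<lambda>x t. Gv x t) (\<lambda>i x t. grad ?S (pderiv_within ?S i (\<lambda>z. v z t)) x)"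
      unfolding Gv_def by (rule solves_dirichlet_imp_dirichlet_function[OF ss1 fr])
    interpret W: dirichlet_function a s s1 "\<lambda>x t. u x t - v x t"
      "\<lambda>x t. time_deriv {0..T} (u x) t - time_deriv {s..s1} (v x) t"
      "\<lambda>x t. Gu x t - Gv x t"
      "\<lambda>i x t. grad ?S (pderiv_within ?S i (\<lambda>z. u z t)) x - grad ?S (pderiv_within ?S i (\<lambda>z. v z t)) x"
      by (rule dirichlet_function_diff[OF uD'' vD])
    \<comment> \<open>The integral of the Hoelder bound \<open>\<kappa> (t - s) powr \<alpha>\<close>.\<close>
    define \<beta> where "\<beta> t = \<kappa> * ((t - s) powr (\<alpha> + 1) / (\<alpha> + 1))" for t
    define \<beta>' where "\<beta>' t = \<kappa> * (t - s) powr \<alpha>" for t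
    have t_in: "t \<in> {0..T}" "t \<in> {0<..T}" "t \<in> {s<..s1}" if "t \<in> {s<..<s1}" for t
      using that s_in by auto
    note cF = has_gradient_on_components_continuous[OF F]
    have "exp (- (c3 * s1)) * ?I (\<lambda>x. \<bar>u x s1 - v x s1\<bar>)
       \<le> exp (- (c3 * s)) * ?I (\<lambda>x. \<bar>u x s - v x s\<bar>) + (\<beta> s1 - \<beta> s)"
    proof (rule W.L1_growth[where F="\<lambda>x t. F x s" and DF="\<lambda>i x t. DF i x s" and J="\<lambda>x t. J x s" and g=gg and \<beta>'=\<beta>'])
      show "0 \<le> s" using s_in by simp
      show "0 \<le> c3" by (rule c3)
      show "has_gradient_on ?S (\<lambda>x. F x s $ i) (\<lambda>x. DF i x s)" for i by (rule F[OF s_in(1)])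
      show "continuous_on ?S (\<lambda>x. J x s)" by (rule J[OF s_in(1)])
      show "\<bar>\<Sum>i\<in>UNIV. DF i x s $ i\<bar> + 2 * \<bar>J x s\<bar> \<le> c3" if "x \<in> ?S" for x
        using bound[OF that s_in(1)] norm_ge_zero[of "F x s"] by linarith
      fix t assume t: "t \<in> {s<..<s1}"
      note t' = t_in[OF t]
      have cGu: "continuous_on ?S (\<lambda>x. Gu x t)" and cu: "continuous_on ?S (\<lambda>x. u x t)"
        using U.cont_slice[OF t'(1)] by (auto simp: Gu_def)
      show cgg: "continuous_on ?S (\<lambda>x. gg x t)"
        unfolding gg_def by (intro continuous_intros cF J s_in t' cGu cu)
      show "time_deriv {0..T} (u x) t - time_deriv {s..s1} (v x) t
         = 1/2 * W.lap x t + F x s \<bullet> (Gu x t - Gv x t) + J x s * (u x t - v x t) + gg x t"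
        if x: "x \<in> ?S" for x
      proof -
        have "W.lap x t = laplacian ?S (\<lambda>z. u z t) x - laplacian ?S (\<lambda>z. v z t) x"
          unfolding W.lap_def laplacian_def by (simp add: grad_def sum_subtractf)
        moreover note solves_dirichlet_closed[OF a T dmz cF[OF t'(1)] J[OF t'(1)] x t'(2)]
          solves_dirichlet_closed[OF a ss1 fr cF[OF s_in(1)] J[OF s_in(1)] x t'(3)]
        ultimately show ?thesis
          by (simp add: gg_def Gu_def Gv_def algebra_simps)
      qed
      show "?I (\<lambda>x. \<bar>gg x t\<bar>) \<le> \<beta>' t * exp (c3 * t)"
      proof -
        let ?p = "(t - s) powr \<alpha>"
        have "?I (\<lambda>x. \<bar>gg x t\<bar>) \<le> ?I (\<lambda>x. c4 * ?p * (norm (Gu x t) + \<bar>u x t\<bar>))"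
        proof (rule integral_le)
          show "(\<lambda>x. \<bar>gg x t\<bar>) integrable_on ?S"
            by (intro integrable_on_cube continuous_intros cgg)
          show "(\<lambda>x. c4 * ?p * (norm (Gu x t) + \<bar>u x t\<bar>)) integrable_on ?S"
            by (intro integrable_on_cube continuous_intros cGu cu)
          fix x assume x: "x \<in> ?S"
          have h: "norm (F x t - F x s) + \<bar>J x t - J x s\<bar> \<le> c4 * ?p"
            using hoelder[OF x t'(1) s_in(1)] t by simp
          have "\<bar>gg x t\<bar> \<le> norm (F x t - F x s) * norm (Gu x t) + \<bar>J x t - J x s\<bar> * \<bar>u x t\<bar>"
            unfolding gg_def using Cauchy_Schwarz_ineq2[of "F x t - F x s" "Gu x t"]
              abs_triangle_ineq[of "(F x t - F x s) \<bullet> Gu x t" "(J x t - J x s) * u x t"]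
            by (simp add: abs_mult)
          also have "\<dots> \<le> (c4 * ?p) * norm (Gu x t) + (c4 * ?p) * \<bar>u x t\<bar>"
          proof -
            have "norm (F x t - F x s) \<le> c4 * ?p" "\<bar>J x t - J x s\<bar> \<le> c4 * ?p"
              using h norm_ge_zero[of "F x t - F x s"] abs_ge_zero[of "J x t - J x s"] by linarith+
            then show ?thesis by (intro add_mono mult_right_mono) auto
          qed
          finally show "\<bar>gg x t\<bar> \<le> c4 * ?p * (norm (Gu x t) + \<bar>u x t\<bar>)"
            by (simp add: distrib_left)
        qed
        also have "\<dots> = ?p * (c4 * (?I (\<lambda>x. norm (Gu x t)) + ?I (\<lambda>x. \<bar>u x t\<bar>)))"
          by (subst integral_mult_right, subst integral_add, (intro integrable_on_cube continuous_intros cGu cu)+) simp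
        also have "\<dots> \<le> ?p * (\<kappa> * exp (c3 * t))"
          using source[OF t'(2)] by (intro mult_left_mono) (auto simp: Gu_def)
        finally show ?thesis by (simp add: \<beta>'_def mult_ac)
      qed
      have "((\<lambda>t. (t - s) powr (\<alpha> + 1)) has_real_derivative ((\<alpha> + 1) * (t - s) powr (\<alpha> + 1 - 1)) * 1) (at t)"
        by (rule DERIV_chain2[where g="\<lambda>t. t - s"], rule has_real_derivative_powr)
           (use t in \<open>auto intro!: derivative_eq_intros\<close>)
      then have "(\<beta> has_real_derivative \<kappa> * (((\<alpha> + 1) * (t - s) powr (\<alpha> + 1 - 1)) * 1 / (\<alpha> + 1))) (at t)"
        unfolding \<beta>_def[abs_def] by (intro DERIV_cmult DERIV_cdivide)
      then show "(\<beta> has_real_derivative \<beta>' t) (at t)"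
        using \<alpha> by (simp add: \<beta>'_def)
    next
      show "continuous_on {s..s1} \<beta>"
        unfolding \<beta>_def[abs_def] using \<alpha>
        by (intro continuous_intros continuous_on_powr') auto
    qed
    moreover have "\<beta> s1 - \<beta> s = \<kappa> * (\<Delta> powr (\<alpha> + 1) / (\<alpha> + 1))"
      by (simp add: \<beta>_def s1)
    moreover have "?I (\<lambda>x. \<bar>u x s - v x s\<bar>) = ?I (\<lambda>x. \<bar>u x s - uj j x s\<bar>)"
      by (rule integral_cong) (use fr in \<open>simp add: solves_dirichlet_def\<close>)
    ultimately show ?thesis by (simp add: s_def s1_def v_def)
  qed
  have accumulated: "exp (- (c3 * tnode T Nt j)) * ?I (\<lambda>x. \<bar>u x (tnode T Nt j) - uj j x (tnode T Nt j)\<bar>)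
     \<le> real j * (\<kappa> * (\<Delta> powr (\<alpha> + 1) / (\<alpha> + 1)))" if "j \<le> Nt" for j
    using that
  proof (induction j)
    case 0
    have "?I (\<lambda>x. \<bar>u x 0 - uj 0 x 0\<bar>) = ?I (\<lambda>x. 0)"
      by (rule integral_cong) (use dmz uj0 in \<open>simp add: solves_dirichlet_def\<close>)
    then show ?case by simp
  next
    case (Suc j)
    have "real (Suc j) * (\<kappa> * (\<Delta> powr (\<alpha> + 1) / (\<alpha> + 1)))
       = real j * (\<kappa> * (\<Delta> powr (\<alpha> + 1) / (\<alpha> + 1))) + \<kappa> * (\<Delta> powr (\<alpha> + 1) / (\<alpha> + 1))"
      by (simp only: of_nat_Suc distrib_right mult_1 add.commute)
    then show ?case using step[of j] Suc by linarith
  qed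
  have "exp (- (c3 * T)) * ?I (\<lambda>x. \<bar>u x T - uj Nt x T\<bar>) \<le> \<kappa> * (T * \<Delta> powr \<alpha> / (\<alpha> + 1))"
  proof -
    have "real Nt * \<Delta> powr (\<alpha> + 1) = T * \<Delta> powr \<alpha>"
      using \<Delta> Nt T by (simp add: powr_add \<Delta>_def)
    then show ?thesis using accumulated[of Nt] Nt by (simp add: mult_ac)
  qed
  also have "\<dots> \<le> c5 * (T * \<Delta> powr \<alpha> / (\<alpha> + 1))"
    using \<kappa> T \<alpha> by (intro mult_right_mono) auto
  finally have "exp (c3 * T) * (exp (- (c3 * T)) * ?I (\<lambda>x. \<bar>u x T - uj Nt x T\<bar>))
     \<le> exp (c3 * T) * (c5 * (T * \<Delta> powr \<alpha> / (\<alpha> + 1)))"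
    by (intro mult_left_mono) auto
  moreover have "exp (c3 * T) * (exp (- (c3 * T)) * ?I (\<lambda>x. \<bar>u x T - uj Nt x T\<bar>)) = ?I (\<lambda>x. \<bar>u x T - uj Nt x T\<bar>)"
    by (simp add: exp_minus)
  ultimately show "?I (\<lambda>x. \<bar>u x T - uj Nt x T\<bar>) \<le> exp (c3 * T) * c5 * (T * (T / real Nt) powr \<alpha> / (\<alpha> + 1))"
    unfolding \<Delta>_def mult.assoc by linarith
qed

section \<open>Consistency of the finite difference scheme\<close>

lemma central_second_difference:
  fixes k :: "nat \<Rightarrow> real \<Rightarrow> real"
  assumes \<eta>: "\<eta> > 0"
    and deriv: "\<And>i r. r \<in> {-\<eta>..\<eta>} \<Longrightarrow> i \<le> 3 \<Longrightarrow> (k i has_real_derivative k (Suc i) r) (at r within {-\<eta>..\<eta>})"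
    and B: "\<And>r. r \<in> {-\<eta>..\<eta>} \<Longrightarrow> \<bar>k 4 r\<bar> \<le> B"
  shows "\<bar>(k 0 \<eta> + k 0 (- \<eta>) - 2 * k 0 0) / (2 * \<eta>\<^sup>2) - k 2 0 / 2\<bar> \<le> B * \<eta>\<^sup>2"
proof -
  define P where "P r = (\<Sum>i\<le>3. k i 0 * (r - 0) ^ i / fact i)" for r
  have B4: "\<And>r. r \<in> {-\<eta>..\<eta>} \<Longrightarrow> norm (k (Suc 3) r) \<le> B" using B by (simp add: eval_nat_numeral)
  have taylor: "\<bar>k 0 r - P r\<bar> \<le> B * \<eta> ^ 4 / 6" if "r = \<eta> \<or> r = - \<eta>" for r
  proof -
    have r: "r \<in> {-\<eta>..\<eta>}" "\<bar>r\<bar> = \<eta>" "0 \<in> {-\<eta>..\<eta>}" using that \<eta> by auto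
    have "norm (k 0 r - P r) \<le> B * norm (r - 0) ^ Suc 3 / fact 3"
      unfolding P_def by (rule field_Taylor[OF convex_real_interval(5) deriv B4 r(3,1)])
    then show ?thesis by (simp add: r(2) fact_numeral)
  qed
  have B0: "0 \<le> B" using order_trans[OF abs_ge_zero B[of 0]] \<eta> by simp
  have "P \<eta> + P (- \<eta>) = 2 * k 0 0 + k 2 0 * \<eta>\<^sup>2"
    by (simp add: P_def eval_nat_numeral)
  moreover have "0 \<le> B * \<eta> ^ 4" using B0 by simp
  ultimately have "\<bar>k 0 \<eta> + k 0 (- \<eta>) - 2 * k 0 0 - k 2 0 * \<eta>\<^sup>2\<bar> \<le> 2 * (B * \<eta> ^ 4)"
    using taylor[of \<eta>] taylor[of "- \<eta>"] by linarith
  also have "2 * (B * \<eta> ^ 4) = B * \<eta>\<^sup>2 * (2 * \<eta>\<^sup>2)" by (simp add: eval_nat_numeral)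
  finally have X: "\<bar>k 0 \<eta> + k 0 (- \<eta>) - 2 * k 0 0 - k 2 0 * \<eta>\<^sup>2\<bar> \<le> B * \<eta>\<^sup>2 * (2 * \<eta>\<^sup>2)" .
  have eq: "(k 0 \<eta> + k 0 (- \<eta>) - 2 * k 0 0) / (2 * \<eta>\<^sup>2) - k 2 0 / 2
      = (k 0 \<eta> + k 0 (- \<eta>) - 2 * k 0 0 - k 2 0 * \<eta>\<^sup>2) / (2 * \<eta>\<^sup>2)"
    using \<eta> by (simp add: field_simps)
  show ?thesis
    unfolding eq abs_divide using \<eta> X by (simp add: pos_divide_le_eq)
qed

lemma central_first_difference:
  fixes k :: "nat \<Rightarrow> real \<Rightarrow> real"
  assumes \<eta>: "\<eta> > 0"
    and deriv: "\<And>i r. r \<in> {-\<eta>..\<eta>} \<Longrightarrow> i \<le> 2 \<Longrightarrow> (k i has_real_derivative k (Suc i) r) (at r within {-\<eta>..\<eta>})"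
    and B: "\<And>r. r \<in> {-\<eta>..\<eta>} \<Longrightarrow> \<bar>k 3 r\<bar> \<le> B"
  shows "\<bar>(k 0 \<eta> - k 0 (- \<eta>)) / (2 * \<eta>) - k 1 0\<bar> \<le> B * \<eta>\<^sup>2"
proof -
  define P where "P r = (\<Sum>i\<le>2. k i 0 * (r - 0) ^ i / fact i)" for r
  have B4: "\<And>r. r \<in> {-\<eta>..\<eta>} \<Longrightarrow> norm (k (Suc 2) r) \<le> B" using B by (simp add: eval_nat_numeral)
  have taylor: "\<bar>k 0 r - P r\<bar> \<le> B * \<eta> ^ 3 / 2" if "r = \<eta> \<or> r = - \<eta>" for r
  proof -
    have r: "r \<in> {-\<eta>..\<eta>}" "\<bar>r\<bar> = \<eta>" "0 \<in> {-\<eta>..\<eta>}" using that \<eta> by auto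
    have "norm (k 0 r - P r) \<le> B * norm (r - 0) ^ Suc 2 / fact 2"
      unfolding P_def by (rule field_Taylor[OF convex_real_interval(5) deriv B4 r(3,1)])
    then show ?thesis by (simp add: r(2) fact_numeral)
  qed
  have B0: "0 \<le> B" using order_trans[OF abs_ge_zero B[of 0]] \<eta> by simp
  have "P \<eta> - P (- \<eta>) = 2 * (k 1 0 * \<eta>)"
    by (simp add: P_def eval_nat_numeral)
  moreover have "0 \<le> B * \<eta> ^ 3" using B0 \<eta> by simp
  ultimately have "\<bar>k 0 \<eta> - k 0 (- \<eta>) - 2 * (k 1 0 * \<eta>)\<bar> \<le> 2 * (B * \<eta> ^ 3)"
    using taylor[of \<eta>] taylor[of "- \<eta>"] by linarith
  also have "2 * (B * \<eta> ^ 3) = B * \<eta>\<^sup>2 * (2 * \<eta>)" by (simp add: eval_nat_numeral)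
  finally have X: "\<bar>k 0 \<eta> - k 0 (- \<eta>) - 2 * (k 1 0 * \<eta>)\<bar> \<le> B * \<eta>\<^sup>2 * (2 * \<eta>)" .
  have eq: "(k 0 \<eta> - k 0 (- \<eta>)) / (2 * \<eta>) - k 1 0
      = (k 0 \<eta> - k 0 (- \<eta>) - 2 * (k 1 0 * \<eta>)) / (2 * \<eta>)"
    using \<eta> by (simp add: field_simps)
  show ?thesis
    unfolding eq abs_divide using \<eta> X by (simp add: pos_divide_le_eq)
qed

lemma forward_difference:
  fixes k :: "nat \<Rightarrow> real \<Rightarrow> real"
  assumes \<tau>: "\<tau> > 0"
    and deriv: "\<And>i r. r \<in> {0..\<tau>} \<Longrightarrow> i \<le> 1 \<Longrightarrow> (k i has_real_derivative k (Suc i) r) (at r within {0..\<tau>})"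
    and B: "\<And>r. r \<in> {0..\<tau>} \<Longrightarrow> \<bar>k 2 r\<bar> \<le> B"
  shows "\<bar>(k 0 \<tau> - k 0 0) / \<tau> - k 1 0\<bar> \<le> B * \<tau>"
proof -
  have B4: "\<And>r. r \<in> {0..\<tau>} \<Longrightarrow> norm (k (Suc 1) r) \<le> B" using B by (simp add: eval_nat_numeral)
  have "norm (k 0 \<tau> - (\<Sum>i\<le>1. k i 0 * (\<tau> - 0) ^ i / fact i)) \<le> B * norm (\<tau> - 0) ^ Suc 1 / fact 1"
    by (rule field_Taylor[where S="{0..\<tau>}", OF _ deriv B4]; use \<tau> in simp)
  then have "\<bar>k 0 \<tau> - k 0 0 - k 1 0 * \<tau>\<bar> \<le> B * \<tau> * \<tau>"
    using \<tau> by (simp add: algebra_simps)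
  moreover have "(k 0 \<tau> - k 0 0) / \<tau> - k 1 0 = (k 0 \<tau> - k 0 0 - k 1 0 * \<tau>) / \<tau>"
    using \<tau> by (simp add: field_simps)
  ultimately show ?thesis
    using \<tau> by (simp add: abs_divide pos_divide_le_eq)
qed

lemma partial_derivative_along_line:
  fixes g :: "'a::euclidean_space \<Rightarrow> real"
  assumes D: "\<And>x. x \<in> S \<Longrightarrow> (g has_derivative (\<lambda>v. \<Sum>b\<in>Basis. (v \<bullet> b) * D b x)) (at x within S)"
    and b: "b \<in> Basis" and line: "\<And>r. r \<in> R \<Longrightarrow> p + r *\<^sub>R b \<in> S" and r: "r \<in> R"
  shows "((\<lambda>r. g (p + r *\<^sub>R b)) has_real_derivative D b (p + r *\<^sub>R b)) (at r within R)"
proof -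
  have "((\<lambda>r. g (p + r *\<^sub>R b)) has_derivative (\<lambda>s. \<Sum>c\<in>Basis. ((s *\<^sub>R b) \<bullet> c) * D c (p + r *\<^sub>R b))) (at r within R)"
    by (rule has_derivative_in_compose2[where g=g and t=S and g'="\<lambda>x v. \<Sum>b\<in>Basis. (v \<bullet> b) * D b x"])
       (use D line r in \<open>auto intro!: derivative_eq_intros\<close>)
  moreover have "(\<Sum>c\<in>Basis. ((s *\<^sub>R b) \<bullet> c) * D c (p + r *\<^sub>R b)) = s * D b (p + r *\<^sub>R b)" for s
  proof -
    have "(\<Sum>c\<in>Basis. ((s *\<^sub>R b) \<bullet> c) * D c (p + r *\<^sub>R b)) = (\<Sum>c\<in>Basis. if c = b then s * D b (p + r *\<^sub>R b) else 0)"
      by (rule sum.cong) (use b in \<open>auto simp: inner_Basis\<close>)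
    then show ?thesis using b by simp
  qed
  ultimately show ?thesis by (simp add: has_field_derivative_def mult_commute_abs)
qed

lemma smooth_on_obtain:
  fixes g :: "'a::euclidean_space \<Rightarrow> real"
  assumes "smooth_on S g"
  obtains D where "\<And>x. x \<in> S \<Longrightarrow> D [] x = g x"
    "\<And>bs x. bs \<in> lists Basis \<Longrightarrow> x \<in> S \<Longrightarrow> (D bs has_derivative (\<lambda>v. \<Sum>b\<in>Basis. (v \<bullet> b) * D (b # bs) x)) (at x within S)"
    "\<And>bs. bs \<in> lists Basis \<Longrightarrow> continuous_on S (D bs)"
proof -
  obtain D where D: "\<And>x. x \<in> S \<Longrightarrow> D [] x = g x"
    "\<And>bs x. bs \<in> lists Basis \<Longrightarrow> x \<in> S \<Longrightarrow> (D bs has_derivative (\<lambda>v. \<Sum>b\<in>Basis. (v \<bullet> b) * D (b # bs) x)) (at x within S)"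
    using assms unfolding smooth_on_def by blast
  moreover have "continuous_on S (D bs)" if "bs \<in> lists Basis" for bs
    by (rule has_derivative_continuous_on[OF D(2)[OF that]])
  ultimately show thesis using that by blast
qed

lemma sum_Basis_vec: "(\<Sum>b\<in>(Basis :: (real^'d) set). f b) = (\<Sum>i\<in>UNIV. f (axis i 1))"
proof -
  have B: "(Basis :: (real^'d) set) = (\<lambda>i. axis i 1) ` UNIV" by (auto simp: Basis_vec_def)
  have "inj (\<lambda>i::'d. axis i 1 :: real^'d)" by (auto simp: inj_on_def axis_eq_axis)
  then show ?thesis unfolding B by (simp add: sum.reindex)
qed

text \<open>
  The drift and the potential of the equation enter the energy estimates through this lemma.
\<close>

lemma smooth_on_imp_has_gradient_on:
  fixes g :: "real^'d \<Rightarrow> real"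
  assumes "smooth_on S g"
  obtains G where "has_gradient_on S g G"
proof -
  obtain D where D: "\<And>x. x \<in> S \<Longrightarrow> D [] x = g x"
    "\<And>bs x. bs \<in> lists Basis \<Longrightarrow> x \<in> S \<Longrightarrow> (D bs has_derivative (\<lambda>v. \<Sum>b\<in>Basis. (v \<bullet> b) * D (b # bs) x)) (at x within S)"
    "\<And>bs. bs \<in> lists Basis \<Longrightarrow> continuous_on S (D bs)"
    by (rule smooth_on_obtain[OF assms]) blast
  have "has_gradient_on S g (\<lambda>x. \<chi> i. D [axis i 1] x)"
    unfolding has_gradient_on_def
  proof
    show "continuous_on S (\<lambda>x. \<chi> i. D [axis i 1] x)"
      by (intro continuous_on_vec_lambda D(3)) (simp add: axis_in_Basis_iff)
    show "\<forall>x\<in>S. (g has_derivative (\<lambda>v. v \<bullet> (\<chi> i. D [axis i 1] x))) (at x within S)"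
    proof
      fix x assume x: "x \<in> S"
      have "(D [] has_derivative (\<lambda>v. v \<bullet> (\<chi> i. D [axis i 1] x))) (at x within S)"
        using D(2)[of "[]" x] x by (simp add: sum_Basis_vec inner_axis) (simp add: inner_vec_def)
      then show "(g has_derivative (\<lambda>v. v \<bullet> (\<chi> i. D [axis i 1] x))) (at x within S)"
        by (rule has_derivative_transform[OF x, rotated]) (simp add: D(1))
    qed
  qed
  then show thesis by (rule that)
qed

lemma sum_inner_Basis:
  fixes b0 :: "'a::euclidean_space" and D :: "'a \<Rightarrow> real"
  assumes "b0 \<in> Basis"
  shows "(\<Sum>b\<in>Basis. (b0 \<bullet> b) * D b) = D b0"
proof -
  have "(\<Sum>b\<in>Basis. (b0 \<bullet> b) * D b) = (\<Sum>b\<in>Basis. if b = b0 then D b0 else 0)"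
    by (rule sum.cong) (use assms in \<open>auto simp: inner_Basis\<close>)
  then show ?thesis using assms by simp
qed

lemma differentiable_vec_nth:
  "g differentiable F \<Longrightarrow> (\<lambda>x. g x $ i) differentiable F"
  unfolding differentiable_def using bounded_linear.has_derivative[OF bounded_linear_vec_nth] by blast

abbreviation space_dir :: "'d::finite \<Rightarrow> (real^'d) \<times> real" where
  "space_dir i \<equiv> (axis i 1, 0)"

abbreviation time_dir :: "(real^'d) \<times> real" where
  "time_dir \<equiv> (0, 1)"

lemma space_time_dir_Basis [simp]: "space_dir i \<in> Basis" "time_dir \<in> Basis"
  by (auto simp: Basis_prod_def axis_in_Basis_iff)

text \<open>
  Computing the derivatives of \<open>exp K v\<close> by the product rule and comparing them with the derivatives \<open>D\<close>
  shows the equation after the initial time: the terms which the derivatives of \<open>exp K\<close> produce cancel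
  against \<open>\<nabla>K\<close> in the drift and against the terms with \<open>K\<close> in \<open>J\<close>. At the initial time, where the equation for \<open>v\<close> is not required to hold, it
  follows by continuity of \<open>D\<close>. The scheme evaluates it there in its first step.
\<close>

lemma kolmogorov_equation:
  fixes K :: "real^'d \<Rightarrow> real" and f :: "real^'d \<Rightarrow> real^'d" and v :: "real^'d \<Rightarrow> real \<Rightarrow> real"
  assumes a: "a > 0" and T: "s < s1"
    and sol: "solves_dirichlet (cube a) s s1 (\<lambda>x t. - f x + grad UNIV K x) (\<lambda>x t. J x) g v"
    and F_cont: "continuous_on (cube a) (\<lambda>x. - f x + grad UNIV K x)" and J_cont: "continuous_on (cube a) J"
    and J: "\<And>x. J x = - divergence UNIV f x - 1/2 * hh x + 1/2 * laplacian UNIV K x - f x \<bullet> grad UNIV K x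
         + 1/2 * (norm (grad UNIV K x))\<^sup>2"
    and K_diff: "\<And>x. K differentiable (at x)" and gradK_diff: "\<And>x. grad UNIV K differentiable (at x)"
    and D0: "\<And>x t. x \<in> cube a \<Longrightarrow> t \<in> {s..s1} \<Longrightarrow> D [] (x, t) = exp (K x) * v x t"
    and D1: "\<And>bs p. bs \<in> lists Basis \<Longrightarrow> p \<in> cube a \<times> {s..s1} \<Longrightarrow>
       (D bs has_derivative (\<lambda>w. \<Sum>b\<in>Basis. (w \<bullet> b) * D (b # bs) p)) (at p within cube a \<times> {s..s1})"
    and x: "x \<in> cube a" and t: "t \<in> {s..s1}"
  shows "D [time_dir] (x, t) = 1/2 * (\<Sum>i\<in>UNIV. D [space_dir i, space_dir i] (x, t))
     - (\<Sum>i\<in>UNIV. f x $ i * D [space_dir i] (x, t)) - (divergence UNIV f x + 1/2 * hh x) * D [] (x, t)"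
proof -
  let ?S = "cube a :: (real^'d) set" and ?T = "{s..s1}"
  let ?gK = "grad UNIV K"
  let ?gv = "\<lambda>t z. grad ?S (\<lambda>z. v z t) z"
  interpret V: dirichlet_function a s s1 v "\<lambda>x t. time_deriv ?T (v x) t"
     "\<lambda>x t. ?gv t x" "\<lambda>i x t. grad ?S (pderiv_within ?S i (\<lambda>z. v z t)) x"
    by (rule solves_dirichlet_imp_dirichlet_function[OF T sol])
  have dK: "(K has_derivative (\<lambda>w. w \<bullet> ?gK z)) (at z within ?S)" for z
    using has_derivative_grad[OF K_diff] has_derivative_at_withinI by blast
  have dgK: "((\<lambda>z. ?gK z $ i) has_derivative (\<lambda>w. w \<bullet> grad UNIV (pderiv_within UNIV i K) z)) (at z within ?S)" for z i
  proof -
    have eq: "(\<lambda>z. ?gK z $ i) = pderiv_within UNIV i K" by (auto simp: grad_def)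
    have "(\<lambda>z. ?gK z $ i) differentiable (at z)"
      by (rule differentiable_vec_nth[OF gradK_diff])
    then have "pderiv_within UNIV i K differentiable (at z)" by (simp add: eq)
    from has_derivative_grad[OF this] show ?thesis
      unfolding eq using has_derivative_at_withinI by blast
  qed
  have space: "((\<lambda>z. D bs (z, t)) has_derivative (\<lambda>w. \<Sum>b\<in>Basis. ((w, 0) \<bullet> b) * D (b # bs) (z, t))) (at z within ?S)"
    if "bs \<in> lists Basis" "z \<in> ?S" "t \<in> ?T" for bs z t
    by (rule has_derivative_in_compose2[where g="D bs" and t="?S \<times> ?T" and g'="\<lambda>p w. \<Sum>b\<in>Basis. (w \<bullet> b) * D (b # bs) p"])
       (use that D1 in \<open>auto intro!: derivative_eq_intros\<close>)
  have grad_eq: "D [space_dir i] (z, t) = exp (K z) * (v z t * ?gK z $ i + ?gv t z $ i)"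
    if z: "z \<in> ?S" and t: "t \<in> ?T" for z t i
  proof -
    have dv: "((\<lambda>z. v z t) has_derivative (\<lambda>w. w \<bullet> ?gv t z)) (at z within ?S)"
      using V.gradient[OF t] z by (auto simp: has_gradient_on_def)
    have "((\<lambda>z. exp (K z) * v z t) has_derivative (\<lambda>w. exp (K z) * (v z t * (w \<bullet> ?gK z) + w \<bullet> ?gv t z))) (at z within ?S)"
      by (auto intro!: derivative_eq_intros dK dv simp: algebra_simps)
    then have "((\<lambda>z. D [] (z, t)) has_derivative (\<lambda>w. exp (K z) * (v z t * (w \<bullet> ?gK z) + w \<bullet> ?gv t z))) (at z within ?S)"
      by (rule has_derivative_transform[OF z, rotated]) (rule D0[OF _ t])
    from cube_has_derivative_unique[OF a z space[of "[]", OF _ z t] this]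
    have "(\<Sum>b\<in>Basis. (space_dir i \<bullet> b) * D [b] (z, t)) = exp (K z) * (v z t * (axis i 1 \<bullet> ?gK z) + axis i 1 \<bullet> ?gv t z)"
      by (simp add: fun_eq_iff)
    then show ?thesis
      by (simp only: sum_inner_Basis space_time_dir_Basis inner_axis' inner_real_def mult_1)
  qed
  have hess_eq: "D [space_dir i, space_dir i] (x, t) = exp (K x) *
      (v x t * (?gK x $ i)\<^sup>2 + 2 * (?gK x $ i * ?gv t x $ i) + v x t * pderiv_within UNIV i (pderiv_within UNIV i K) x
        + pderiv_within ?S i (pderiv_within ?S i (\<lambda>z. v z t)) x)"
    if t: "t \<in> ?T" for t i
  proof -
    let ?Ki = "\<lambda>w. w \<bullet> grad UNIV (pderiv_within UNIV i K) x"
    let ?vi = "\<lambda>w. w \<bullet> grad ?S (pderiv_within ?S i (\<lambda>z. v z t)) x"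
    have dv: "((\<lambda>z. v z t) has_derivative (\<lambda>w. w \<bullet> ?gv t x)) (at x within ?S)"
      using V.gradient[OF t] x by (auto simp: has_gradient_on_def)
    have dgv: "((\<lambda>z. ?gv t z $ i) has_derivative ?vi) (at x within ?S)"
      using V.hessian[OF t] x by (auto simp: has_gradient_on_def)
    let ?L = "\<lambda>w. exp (K x) * (v x t * ?Ki w + (w \<bullet> ?gv t x) * ?gK x $ i + ?vi w)
        + (exp (K x) * (w \<bullet> ?gK x)) * (v x t * ?gK x $ i + ?gv t x $ i)"
    have "((\<lambda>z. exp (K z) * (v z t * ?gK z $ i + ?gv t z $ i)) has_derivative ?L) (at x within ?S)"
      by (intro has_derivative_mult has_derivative_add dv dgv dgK has_derivative_eq_rhs[OF has_derivative_exp[OF dK]])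
         (simp add: fun_eq_iff)
    then have "((\<lambda>z. D [space_dir i] (z, t)) has_derivative ?L) (at x within ?S)"
      by (rule has_derivative_transform[OF x, rotated]) (rule grad_eq[OF _ t])
    from cube_has_derivative_unique[OF a x space[of "[space_dir i]", OF _ x t] this]
    have "(\<Sum>b\<in>Basis. (space_dir i \<bullet> b) * D [b, space_dir i] (x, t)) = ?L (axis i 1)"
      by (simp add: fun_eq_iff)
    then have "D [space_dir i, space_dir i] (x, t) = ?L (axis i 1)"
      by (simp only: sum_inner_Basis space_time_dir_Basis)
    then show ?thesis
      by (simp add: inner_axis' grad_def power2_eq_square algebra_simps)
  qed
  have time_eq: "D [time_dir] (x, t) = exp (K x) * time_deriv ?T (v x) t" if t: "t \<in> ?T" for t
  proof -
    have line: "((\<lambda>t. D [] ((x, 0) + t *\<^sub>R time_dir)) has_real_derivative D [time_dir] ((x, 0) + t *\<^sub>R time_dir)) (at t within ?T)"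
      by (rule partial_derivative_along_line[where S="?S \<times> ?T" and D="\<lambda>b. D [b]"])
         (use D1[of "[]"] x t in auto)
    have "((\<lambda>t. exp (K x) * v x t) has_real_derivative D [time_dir] ((x, 0) + t *\<^sub>R time_dir)) (at t within ?T)"
      by (rule has_field_derivative_transform_within[OF line zero_less_one t]) (simp add: D0[OF x])
    then have "((\<lambda>t. exp (K x) * v x t) has_real_derivative D [time_dir] (x, t)) (at t within ?T)"
      by simp
    moreover have "((\<lambda>t. exp (K x) * v x t) has_real_derivative exp (K x) * time_deriv ?T (v x) t) (at t within ?T)"
      by (intro DERIV_cmult V.time x t)
    ultimately show ?thesis
      using vector_derivative_unique_within_closed_interval[of s s1 t] T t
      by (simp add: has_real_derivative_iff_has_vector_derivative)
  qed
  define \<rho> where "\<rho> t = D [time_dir] (x, t) - (1/2 * (\<Sum>i\<in>UNIV. D [space_dir i, space_dir i] (x, t))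
     - (\<Sum>i\<in>UNIV. f x $ i * D [space_dir i] (x, t)) - (divergence UNIV f x + 1/2 * hh x) * D [] (x, t))" for t
  have "\<rho> t = 0"
  proof (rule continuous_constant_on_closure[where S="{s<..s1}" and f=\<rho>])
    have cD: "continuous_on ?T (\<lambda>t. D bs (x, t))" if "bs \<in> lists Basis" for bs
      by (rule continuous_on_compose2[OF has_derivative_continuous_on[OF D1[OF that]]])
         (use x in \<open>auto intro!: continuous_intros\<close>)
    show "continuous_on (closure {s<..s1}) \<rho>"
      using T unfolding \<rho>_def[abs_def] by (auto intro!: continuous_intros cD)
    show "\<rho> r = 0" if r: "r \<in> {s<..s1}" for r
    proof -
      have r': "r \<in> ?T" using r by auto
      have e: "time_deriv ?T (v x) r = 1/2 * laplacian ?S (\<lambda>z. v z r) x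
          + (- f x + ?gK x) \<bullet> ?gv r x + J x * v x r"
        by (rule solves_dirichlet_closed[OF a T sol F_cont J_cont x r])
      have h: "(\<Sum>i\<in>UNIV. D [space_dir i, space_dir i] (x, r)) = exp (K x) *
        (v x r * (norm (?gK x))\<^sup>2 + 2 * (?gK x \<bullet> ?gv r x) + v x r * laplacian UNIV K x + laplacian ?S (\<lambda>z. v z r) x)"
        unfolding hess_eq[OF r'] power2_norm_eq_inner laplacian_def
        by (simp add: sum_distrib_left[symmetric] sum.distrib inner_vec_def power2_eq_square)
      have g: "(\<Sum>i\<in>UNIV. f x $ i * D [space_dir i] (x, r)) = exp (K x) * (v x r * (f x \<bullet> ?gK x) + f x \<bullet> ?gv r x)"
        unfolding grad_eq[OF x r'] by (simp add: inner_vec_def sum_distrib_left sum.distrib algebra_simps)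
      show ?thesis
        unfolding \<rho>_def h g time_eq[OF r'] D0[OF x r'] e J
        by (simp add: algebra_simps inner_diff_left)
    qed
  qed (use t T in simp)
  then show ?thesis by (simp add: \<rho>_def)
qed

lemma mesh_pos: "a > 0 \<Longrightarrow> N \<ge> 2 \<Longrightarrow> mesh a N > 0"
  by (simp add: mesh_def)

lemma gpt_up: "gpt a N (up i l) = gpt a N l + mesh a N *\<^sub>R axis i 1"
  by (simp add: gpt_def up_def vec_eq_iff axis_def algebra_simps)

lemma gpt_dn: "l i \<ge> 1 \<Longrightarrow> gpt a N (dn i l) = gpt a N l - mesh a N *\<^sub>R axis i 1"
  by (simp add: gpt_def dn_def vec_eq_iff axis_def algebra_simps of_nat_diff)

lemma gpt_in_cube:
  fixes l :: "'d::finite \<Rightarrow> nat"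
  assumes a: "a > 0" and N: "N \<ge> 2" and l: "l \<in> grid N"
  shows "gpt a N l \<in> cube a"
proof -
  have "0 \<le> (real (l i) - 1) * mesh a N \<and> (real (l i) - 1) * mesh a N \<le> 2 * a" for i
  proof
    have li: "1 \<le> l i" "l i \<le> N" using l by (auto simp: grid_def)
    then show "0 \<le> (real (l i) - 1) * mesh a N" using mesh_pos[OF a N] by simp
    have "(real (l i) - 1) * mesh a N \<le> (real N - 1) * mesh a N"
      using li mesh_pos[OF a N] by (intro mult_right_mono) auto
    then show "(real (l i) - 1) * mesh a N \<le> 2 * a" using N by (simp add: mesh_def)
  qed
  then show ?thesis by (simp add: gpt_def cube_def mem_box_cart)
qed

lemma grid_interior_neighbours:
  assumes "l \<in> grid_interior N"
  shows "up i l \<in> grid N" "dn i l \<in> grid N" "l \<in> grid N" "l i \<ge> 1"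
proof -
  have l: "1 < l j \<and> l j < N" for j using assms by (auto simp: grid_interior_def)
  show "up i l \<in> grid N" unfolding grid_def up_def
  proof (intro CollectI allI)
    fix j show "1 \<le> (l(i := l i + 1)) j \<and> (l(i := l i + 1)) j \<le> N"
      using l[of j] by (cases "j = i") auto
  qed
  show "dn i l \<in> grid N" unfolding grid_def dn_def
  proof (intro CollectI allI)
    fix j show "1 \<le> (l(i := l i - 1)) j \<and> (l(i := l i - 1)) j \<le> N"
      using l[of j] by (cases "j = i") auto
  qed
  show "l \<in> grid N" "l i \<ge> 1" using l by (auto simp: grid_def less_imp_le)
qed

lemma gpt_boundary_frontier:
  fixes l :: "'d::finite \<Rightarrow> nat"
  assumes a: "a > 0" and N: "N \<ge> 2" and l: "l \<in> grid_boundary N"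
  shows "gpt a N l \<in> frontier (cube a)"
proof -
  have lg: "l \<in> grid N" and "l \<notin> grid_interior N" using l by (auto simp: grid_boundary_def)
  then obtain i where i: "\<not> (1 < l i \<and> l i < N)" by (auto simp: grid_interior_def)
  moreover have "1 \<le> l i" "l i \<le> N" using lg by (auto simp: grid_def)
  ultimately have "l i = 1 \<or> l i = N" by linarith
  then have "gpt a N l $ i = - a \<or> gpt a N l $ i = a"
    using N by (auto simp: gpt_def mesh_def)
  then have "gpt a N l \<notin> box (\<chi> i. - a) (\<chi> i. a)"
    by (simp add: mem_box_cart) (metis less_irrefl)
  then show ?thesis using gpt_in_cube[OF a N lg] by (simp add: cube_def frontier_cbox)
qed

text \<open>
  The difference quotients at an interior grid point only see segments inside the cube, although they may
  touch its boundary. Taylor expansion along them therefore uses derivatives within the segment.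
\<close>

lemma segment_in_cube:
  assumes a: "a > 0" and N: "N \<ge> 2" and l: "l \<in> grid_interior N" and r: "r \<in> {- mesh a N..mesh a N}"
  shows "gpt a N l + r *\<^sub>R axis i 1 \<in> cube a"
proof -
  let ?\<eta> = "mesh a N" and ?p = "gpt a N l"
  note g = grid_interior_neighbours[OF l]
  have \<eta>: "?\<eta> > 0" by (rule mesh_pos[OF a N])
  have "convex (cube a)" by (simp add: cube_def)
  from convexD[OF this gpt_in_cube[OF a N g(2)[of i]] gpt_in_cube[OF a N g(1)[of i]], of "(?\<eta> - r) / (2 * ?\<eta>)" "(?\<eta> + r) / (2 * ?\<eta>)"]
  have "((?\<eta> - r) / (2 * ?\<eta>)) *\<^sub>R (?p - ?\<eta> *\<^sub>R axis i 1) + ((?\<eta> + r) / (2 * ?\<eta>)) *\<^sub>R (?p + ?\<eta> *\<^sub>R axis i 1) \<in> cube a"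
    using \<eta> r g(4) by (simp add: gpt_up gpt_dn) (simp add: field_simps)
  also have "((?\<eta> - r) / (2 * ?\<eta>)) *\<^sub>R (?p - ?\<eta> *\<^sub>R axis i 1) + ((?\<eta> + r) / (2 * ?\<eta>)) *\<^sub>R (?p + ?\<eta> *\<^sub>R axis i 1)
      = ?p + r *\<^sub>R axis i 1"
    using \<eta> by (simp add: vec_eq_iff field_simps)
  finally show ?thesis .
qed

text \<open>
  The sum of the absolute values is one continuous function, which bounds all members of the family.
\<close>

lemma compact_family_bound:
  fixes g :: "'i \<Rightarrow> 'a::topological_space \<Rightarrow> real"
  assumes "finite I" "compact S" "\<And>i. i \<in> I \<Longrightarrow> continuous_on S (g i)"
  obtains M where "M \<ge> 0" "\<And>i x. i \<in> I \<Longrightarrow> x \<in> S \<Longrightarrow> \<bar>g i x\<bar> \<le> M"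
proof -
  have "compact ((\<lambda>x. \<Sum>i\<in>I. \<bar>g i x\<bar>) ` S)"
    by (intro compact_continuous_image continuous_intros assms)
  then obtain M where M: "M > 0" "\<forall>z\<in>(\<lambda>x. \<Sum>i\<in>I. \<bar>g i x\<bar>) ` S. norm z \<le> M"
    using compact_imp_bounded[THEN bounded_pos[THEN iffD1]] by blast
  have "\<bar>g i x\<bar> \<le> M" if i: "i \<in> I" and x: "x \<in> S" for i x
  proof -
    have "\<bar>g i x\<bar> \<le> (\<Sum>i\<in>I. \<bar>g i x\<bar>)"
      using assms(1) i by (intro member_le_sum) auto
    also have "\<dots> \<le> M" using M(2) x by force
    finally show ?thesis .
  qed
  then show thesis using that[of M] M(1) by simp
qed

lemma fd_rhs_difference_quotients:
  fixes f h :: "real^'d \<Rightarrow> real^'d" and V :: "('d \<Rightarrow> nat) \<Rightarrow> real"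
  shows "fd_rhs a N f h V l =
     (\<Sum>i\<in>UNIV. (V (up i l) + V (dn i l) - 2 * V l) / (2 * (mesh a N)\<^sup>2))
     - (\<Sum>i\<in>UNIV. f (gpt a N l) $ i * ((V (up i l) - V (dn i l)) / (2 * mesh a N)))
     - (\<Sum>i\<in>UNIV. (f (gpt a N (up i l)) $ i - f (gpt a N (dn i l)) $ i) / (2 * mesh a N)) * V l
     - 1/2 * (h (gpt a N l) \<bullet> h (gpt a N l)) * V l"
proof -
  have "(\<Sum>i\<in>UNIV. (V (up i l) + V (dn i l) - 2 * V l) / (2 * (mesh a N)\<^sup>2))
     = ((\<Sum>i\<in>UNIV. V (up i l) + V (dn i l)) - 2 * real CARD('d) * V l) / (2 * (mesh a N)\<^sup>2)"
    by (simp add: sum_divide_distrib[symmetric] sum_subtractf)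
  moreover have "(\<Sum>i\<in>UNIV. f (gpt a N l) $ i * ((V (up i l) - V (dn i l)) / (2 * mesh a N)))
     = (\<Sum>i\<in>UNIV. f (gpt a N l) $ i * (V (up i l) - V (dn i l))) / (2 * mesh a N)"
    by (simp add: sum_divide_distrib)
  moreover have "(\<Sum>i\<in>UNIV. (f (gpt a N (up i l)) $ i - f (gpt a N (dn i l)) $ i) / (2 * mesh a N)) * V l
     = (\<Sum>i\<in>UNIV. (f (gpt a N (up i l)) $ i - f (gpt a N (dn i l)) $ i) * V l) / (2 * mesh a N)"
    by (simp add: sum_divide_distrib[symmetric] sum_distrib_right[symmetric])
  ultimately show ?thesis unfolding fd_rhs_def by simp
qed

text \<open>
  Every difference quotient of the scheme, the discrete divergence included, is replaced by the
  derivative which it approximates; what remains is the Kolmogorov equation at a grid point. The constant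
  only depends on bounds for finitely many derivatives of \<open>w\<close> and \<open>f\<close> on the compact domain, not on the
  grid.
\<close>

lemma fd_consistency:
  fixes f h :: "real^'d \<Rightarrow> real^'d" and w :: "real^'d \<Rightarrow> real \<Rightarrow> real"
  assumes a: "a > 0" and T: "s < s1"
    and D0: "\<And>x t. x \<in> cube a \<Longrightarrow> t \<in> {s..s1} \<Longrightarrow> D [] (x, t) = w x t"
    and D1: "\<And>bs p. bs \<in> lists Basis \<Longrightarrow> p \<in> cube a \<times> {s..s1} \<Longrightarrow>
       (D bs has_derivative (\<lambda>v. \<Sum>b\<in>Basis. (v \<bullet> b) * D (b # bs) p)) (at p within cube a \<times> {s..s1})"
    and f_smooth: "\<And>i. smooth_on (cube a) (\<lambda>x. f x $ i)" and f_diff: "\<And>x. f differentiable (at x)"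
    and fke: "\<And>x t. x \<in> cube a \<Longrightarrow> t \<in> {s..s1} \<Longrightarrow>
      D [time_dir] (x, t) = 1/2 * (\<Sum>i\<in>UNIV. D [space_dir i, space_dir i] (x, t))
     - (\<Sum>i\<in>UNIV. f x $ i * D [space_dir i] (x, t)) - (divergence UNIV f x + 1/2 * (h x \<bullet> h x)) * D [] (x, t)"
  shows "\<exists>B\<ge>0. \<forall>N l t \<tau>. N \<ge> 2 \<longrightarrow> l \<in> grid_interior N \<longrightarrow> \<tau> > 0 \<longrightarrow> s \<le> t \<longrightarrow> t + \<tau> \<le> s1 \<longrightarrow>
       \<bar>(w (gpt a N l) (t + \<tau>) - w (gpt a N l) t) / \<tau> - fd_rhs a N f h (\<lambda>l. w (gpt a N l) t) l\<bar>
         \<le> B * (\<tau> + (mesh a N)\<^sup>2)"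
proof -
  let ?S = "cube a :: (real^'d) set" and ?T = "{s..s1}"
  obtain Df where Df0: "\<And>i x. x \<in> ?S \<Longrightarrow> Df i [] x = f x $ i"
    and Df1: "\<And>i bs x. bs \<in> lists Basis \<Longrightarrow> x \<in> ?S \<Longrightarrow>
      (Df i bs has_derivative (\<lambda>v. \<Sum>b\<in>Basis. (v \<bullet> b) * Df i (b # bs) x)) (at x within ?S)"
  proof -
    have "\<forall>i. \<exists>D. (\<forall>x\<in>?S. D [] x = f x $ i) \<and> (\<forall>bs\<in>lists Basis. \<forall>x\<in>?S.
      (D bs has_derivative (\<lambda>v. \<Sum>b\<in>Basis. (v \<bullet> b) * D (b # bs) x)) (at x within ?S))"
      using f_smooth unfolding smooth_on_def by simp
    then obtain Df where "\<forall>i. (\<forall>x\<in>?S. Df i [] x = f x $ i) \<and> (\<forall>bs\<in>lists Basis. \<forall>x\<in>?S.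
      (Df i bs has_derivative (\<lambda>v. \<Sum>b\<in>Basis. (v \<bullet> b) * Df i (b # bs) x)) (at x within ?S))"
      using choice[of "\<lambda>i D. (\<forall>x\<in>?S. D [] x = f x $ i) \<and> (\<forall>bs\<in>lists Basis. \<forall>x\<in>?S.
      (D bs has_derivative (\<lambda>v. \<Sum>b\<in>Basis. (v \<bullet> b) * D (b # bs) x)) (at x within ?S))"] by auto
    then show thesis by (intro that[of Df]) simp_all
  qed
  have cD: "continuous_on (?S \<times> ?T) (D bs)" if "bs \<in> lists Basis" for bs
    by (rule has_derivative_continuous_on[OF D1[OF that]])
  have cDf: "continuous_on ?S (Df i bs)" if "bs \<in> lists Basis" for i bs
    by (rule has_derivative_continuous_on[OF Df1[OF that]])
  have div_eq: "divergence UNIV f x = (\<Sum>i\<in>UNIV. Df i [axis i 1] x)" if x: "x \<in> ?S" for x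
    unfolding divergence_def
  proof (rule sum.cong)
    fix i
    have "(\<lambda>z. f z $ i) differentiable (at x)"
      by (rule differentiable_vec_nth[OF f_diff])
    then have "((\<lambda>z. f z $ i) has_derivative frechet_derivative (\<lambda>z. f z $ i) (at x)) (at x within ?S)"
      using frechet_derivative_works has_derivative_at_withinI by blast
    moreover have "((\<lambda>z. f z $ i) has_derivative (\<lambda>v. \<Sum>b\<in>Basis. (v \<bullet> b) * Df i [b] x)) (at x within ?S)"
      by (rule has_derivative_transform[OF x _ Df1[of "[]" x i]]) (use Df0 x in auto)
    ultimately have "frechet_derivative (\<lambda>z. f z $ i) (at x) = (\<lambda>v. \<Sum>b\<in>Basis. (v \<bullet> b) * Df i [b] x)"
      by (rule cube_has_derivative_unique[OF a x])
    then show "pderiv_within UNIV i (\<lambda>z. f z $ i) x = Df i [axis i 1] x"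
      by (simp add: pderiv_within_def sum_inner_Basis)
  qed simp
  let ?DI = "{[], [time_dir, time_dir]} \<union> range (\<lambda>i. [space_dir i, space_dir i, space_dir i, space_dir i])
      \<union> range (\<lambda>i. [space_dir i, space_dir i, space_dir i])"
  obtain M1 where M1: "M1 \<ge> 0" "\<And>bs p. bs \<in> ?DI \<Longrightarrow> p \<in> ?S \<times> ?T \<Longrightarrow> \<bar>D bs p\<bar> \<le> M1"
  proof (rule compact_family_bound[of ?DI "?S \<times> ?T" D])
    show "continuous_on (?S \<times> ?T) (D bs)" if "bs \<in> ?DI" for bs
      by (rule cD) (use that in auto)
  qed (auto intro!: compact_Times)
  obtain M2 where M2: "M2 \<ge> 0" "\<And>ib x. ib \<in> UNIV \<times> {True, False} \<Longrightarrow> x \<in> ?S \<Longrightarrow>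
      \<bar>Df (fst ib) (if snd ib then [] else [axis (fst ib) 1, axis (fst ib) 1, axis (fst ib) 1]) x\<bar> \<le> M2"
  proof (rule compact_family_bound[of "UNIV \<times> {True, False}" ?S
      "\<lambda>ib. Df (fst ib) (if snd ib then [] else [axis (fst ib) 1, axis (fst ib) 1, axis (fst ib) 1])"])
    show "continuous_on ?S (Df (fst ib) (if snd ib then [] else [axis (fst ib) 1, axis (fst ib) 1, axis (fst ib) 1]))"
      for ib by (rule cDf) auto
  qed auto
  define M where "M = max M1 M2"
  have M: "M \<ge> 0" using M1(1) by (simp add: M_def)
  \<comment> \<open>The constant \<open>M\<close> bounds the remainders of the Taylor expansions as well as \<open>w\<close> and \<open>f\<close>, which multiply some of them.\<close>
  have DM: "\<bar>D bs p\<bar> \<le> M" if "bs \<in> ?DI" "p \<in> ?S \<times> ?T" for bs p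
    using M1(2)[OF that] by (simp add: M_def)
  have fM: "\<bar>f x $ i\<bar> \<le> M" if "x \<in> ?S" for x i
    using M2(2)[of "(i, True)" x] that by (simp add: M_def Df0)
  have f3M: "\<bar>Df i [axis i 1, axis i 1, axis i 1] x\<bar> \<le> M" if "x \<in> ?S" for x i
    using M2(2)[of "(i, False)" x] that by (simp add: M_def)
  let ?d = "real CARD('d)"
  define B where "B = M + ?d * (M + M * M + M * M)"
  have B: "B \<ge> 0" using M by (simp add: B_def)
  have main: "\<bar>(w (gpt a N l) (t + \<tau>) - w (gpt a N l) t) / \<tau> - fd_rhs a N f h (\<lambda>l. w (gpt a N l) t) l\<bar>
         \<le> B * (\<tau> + (mesh a N)\<^sup>2)"
    if N: "N \<ge> 2" and l: "l \<in> grid_interior N" and \<tau>: "\<tau> > 0" and t: "s \<le> t" "t + \<tau> \<le> s1" for N l t \<tau>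
  proof -
    let ?x = "gpt a N l" and ?\<eta> = "mesh a N"
    have \<eta>: "?\<eta> > 0" by (rule mesh_pos[OF a N])
    note nb = grid_interior_neighbours[OF l]
    have x: "?x \<in> ?S" by (rule gpt_in_cube[OF a N nb(3)])
    have tT: "t \<in> ?T" "t + \<tau> \<in> ?T" using t \<tau> by auto
    have seg: "?x + r *\<^sub>R axis i 1 \<in> ?S" if "r \<in> {-?\<eta>..?\<eta>}" for r i
      by (rule segment_in_cube[OF a N l that])
    have w_up: "w (gpt a N (up i l)) t = D [] (?x + ?\<eta> *\<^sub>R axis i 1, t)" for i
      using D0[OF seg[of ?\<eta> i] tT(1)] \<eta> by (simp add: gpt_up)
    have w_dn: "w (gpt a N (dn i l)) t = D [] (?x + (- ?\<eta>) *\<^sub>R axis i 1, t)" for i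
      using D0[OF seg[of "- ?\<eta>" i] tT(1)] \<eta> by (simp add: gpt_dn[OF nb(4)])
    have w_x: "w ?x t = D [] (?x, t)" "w ?x (t + \<tau>) = D [] (?x, t + \<tau>)"
      using D0[OF x] tT by auto
    have f_up: "f (gpt a N (up i l)) $ i = Df i [] (?x + ?\<eta> *\<^sub>R axis i 1)" for i
      using Df0[OF seg[of ?\<eta> i]] \<eta> by (simp add: gpt_up)
    have f_dn: "f (gpt a N (dn i l)) $ i = Df i [] (?x + (- ?\<eta>) *\<^sub>R axis i 1)" for i
      using Df0[OF seg[of "- ?\<eta>" i]] \<eta> by (simp add: gpt_dn[OF nb(4)])
    have space_line: "((\<lambda>r. D bs (?x + r *\<^sub>R axis i 1, t)) has_real_derivative
        D (space_dir i # bs) (?x + r *\<^sub>R axis i 1, t)) (at r within {-?\<eta>..?\<eta>})"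
      if "bs \<in> lists Basis" "r \<in> {-?\<eta>..?\<eta>}" for bs r i
      using partial_derivative_along_line[of "?S \<times> ?T" "D bs" "\<lambda>b. D (b # bs)" "space_dir i" "{-?\<eta>..?\<eta>}" "(?x, t)" r]
        D1[OF that(1)] seg tT that by simp
    have time_line: "((\<lambda>r. D bs (?x, t + r)) has_real_derivative
        D (time_dir # bs) (?x, t + r)) (at r within {0..\<tau>})"
      if "bs \<in> lists Basis" "r \<in> {0..\<tau>}" for bs r
      using partial_derivative_along_line[of "?S \<times> ?T" "D bs" "\<lambda>b. D (b # bs)" "time_dir" "{0..\<tau>}" "(?x, t)" r]
        D1[OF that(1)] x t that by simp
    have f_line: "((\<lambda>r. Df i bs (?x + r *\<^sub>R axis i 1)) has_real_derivative
        Df i (axis i 1 # bs) (?x + r *\<^sub>R axis i 1)) (at r within {-?\<eta>..?\<eta>})"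
      if "bs \<in> lists Basis" "r \<in> {-?\<eta>..?\<eta>}" for bs r i
      by (rule partial_derivative_along_line[OF Df1[OF that(1)]]) (use seg that in auto)
    have rep: "replicate n b \<in> lists Basis" if "b \<in> Basis" for n and b :: "'z::euclidean_space"
      using that by (auto simp: in_lists_conv_set)
    have E_time: "\<bar>(w ?x (t + \<tau>) - w ?x t) / \<tau> - D [time_dir] (?x, t)\<bar> \<le> M * \<tau>"
    proof -
      have "\<bar>D [time_dir, time_dir] (?x, t + r)\<bar> \<le> M" if "r \<in> {0..\<tau>}" for r
        by (rule DM) (use that x t in auto)
      then show ?thesis
        using forward_difference[OF \<tau>, of "\<lambda>n r. D (replicate n time_dir) (?x, t + r)" M]
          time_line[OF rep] by (simp add: w_x eval_nat_numeral)
    qed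
    have E_second: "\<bar>(w (gpt a N (up i l)) t + w (gpt a N (dn i l)) t - 2 * w ?x t) / (2 * ?\<eta>\<^sup>2)
        - D [space_dir i, space_dir i] (?x, t) / 2\<bar> \<le> M * ?\<eta>\<^sup>2" for i
    proof -
      have "\<bar>D [space_dir i, space_dir i, space_dir i, space_dir i] (?x + r *\<^sub>R axis i 1, t)\<bar> \<le> M"
        if "r \<in> {-?\<eta>..?\<eta>}" for r
        by (rule DM) (use that seg tT in auto)
      then show ?thesis
        using central_second_difference[OF \<eta>, of "\<lambda>n r. D (replicate n (space_dir i)) (?x + r *\<^sub>R axis i 1, t)" M]
          space_line[OF rep] by (simp add: w_up w_dn w_x eval_nat_numeral)
    qed
    have E_first: "\<bar>(w (gpt a N (up i l)) t - w (gpt a N (dn i l)) t) / (2 * ?\<eta>)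
        - D [space_dir i] (?x, t)\<bar> \<le> M * ?\<eta>\<^sup>2" for i
    proof -
      have "\<bar>D [space_dir i, space_dir i, space_dir i] (?x + r *\<^sub>R axis i 1, t)\<bar> \<le> M"
        if "r \<in> {-?\<eta>..?\<eta>}" for r
        by (rule DM) (use that seg tT in auto)
      then show ?thesis
        using central_first_difference[OF \<eta>, of "\<lambda>n r. D (replicate n (space_dir i)) (?x + r *\<^sub>R axis i 1, t)" M]
          space_line[OF rep] by (simp add: w_up w_dn w_x eval_nat_numeral)
    qed
    have E_div: "\<bar>(f (gpt a N (up i l)) $ i - f (gpt a N (dn i l)) $ i) / (2 * ?\<eta>) - Df i [axis i 1] ?x\<bar> \<le> M * ?\<eta>\<^sup>2" for i
    proof -
      have "\<bar>Df i [axis i 1, axis i 1, axis i 1] (?x + r *\<^sub>R axis i 1)\<bar> \<le> M" if "r \<in> {-?\<eta>..?\<eta>}" for r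
        by (rule f3M[OF seg[OF that]])
      then show ?thesis
        using central_first_difference[OF \<eta>, of "\<lambda>n r. Df i (replicate n (axis i 1)) (?x + r *\<^sub>R axis i 1)" M]
          f_line[OF rep] by (simp add: f_up f_dn eval_nat_numeral)
    qed
    define A1 where "A1 = (\<Sum>i\<in>UNIV. (w (gpt a N (up i l)) t + w (gpt a N (dn i l)) t - 2 * w ?x t) / (2 * ?\<eta>\<^sup>2)
        - D [space_dir i, space_dir i] (?x, t) / 2)"
    define A2 where "A2 = (\<Sum>i\<in>UNIV. f ?x $ i * ((w (gpt a N (up i l)) t - w (gpt a N (dn i l)) t) / (2 * ?\<eta>)
        - D [space_dir i] (?x, t)))"
    define A3 where "A3 = (\<Sum>i\<in>UNIV. (f (gpt a N (up i l)) $ i - f (gpt a N (dn i l)) $ i) / (2 * ?\<eta>) - Df i [axis i 1] ?x)"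
    have A1: "\<bar>A1\<bar> \<le> ?d * (M * ?\<eta>\<^sup>2)"
      unfolding A1_def using sum_norm_bound[of UNIV, OF E_second[folded real_norm_def]] by simp
    have A2: "\<bar>A2\<bar> \<le> ?d * (M * (M * ?\<eta>\<^sup>2))"
    proof -
      have n: "norm (f ?x $ i * ((w (gpt a N (up i l)) t - w (gpt a N (dn i l)) t) / (2 * ?\<eta>)
        - D [space_dir i] (?x, t))) \<le> M * (M * ?\<eta>\<^sup>2)" for i
        unfolding norm_mult using fM[OF x] E_first M by (intro mult_mono) auto
      show ?thesis unfolding A2_def
        using sum_norm_bound[of UNIV, OF n] by simp
    qed
    have A3: "\<bar>A3\<bar> \<le> ?d * (M * ?\<eta>\<^sup>2)"
      unfolding A3_def using sum_norm_bound[of UNIV, OF E_div[folded real_norm_def]] by simp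
    have wM: "\<bar>w ?x t\<bar> \<le> M" unfolding w_x(1) by (rule DM) (use x tT in auto)
    have A3': "\<bar>A3 * w ?x t\<bar> \<le> ?d * (M * ?\<eta>\<^sup>2) * M"
      unfolding abs_mult using A3 wM M by (intro mult_mono) auto
    have "fd_rhs a N f h (\<lambda>l. w (gpt a N l) t) l - D [time_dir] (?x, t) = A1 - A2 - A3 * w ?x t"
      unfolding fd_rhs_difference_quotients fke[OF x tT(1)] div_eq[OF x] A1_def A2_def A3_def
      by (simp add: sum_subtractf w_x(1) sum_divide_distrib[symmetric] algebra_simps)
    then have "\<bar>(w ?x (t + \<tau>) - w ?x t) / \<tau> - fd_rhs a N f h (\<lambda>l. w (gpt a N l) t) l\<bar>
      \<le> M * \<tau> + ?d * (M * ?\<eta>\<^sup>2) + ?d * (M * (M * ?\<eta>\<^sup>2)) + ?d * (M * ?\<eta>\<^sup>2) * M"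
      using E_time A1 A2 A3' by linarith
    also have "\<dots> = M * \<tau> + ?d * (M + M * M + M * M) * ?\<eta>\<^sup>2"
      by (simp add: algebra_simps)
    also have "\<dots> \<le> B * \<tau> + B * ?\<eta>\<^sup>2"
      unfolding B_def using M \<tau> by (intro add_mono mult_right_mono) auto
    finally show ?thesis by (simp add: distrib_left)
  qed
  show ?thesis
    by (intro exI[of _ B] conjI B allI impI) (rule main)
qed

section \<open>Stability and convergence of the finite difference scheme\<close>

lemma fd_rhs_diff: "fd_rhs a N f h (\<lambda>l. V l - W l) l = fd_rhs a N f h V l - fd_rhs a N f h W l"
proof -
  have 1: "(\<Sum>i\<in>UNIV. (V (up i l) - W (up i l)) + (V (dn i l) - W (dn i l)))
     = (\<Sum>i\<in>UNIV. V (up i l) + V (dn i l)) - (\<Sum>i\<in>UNIV. W (up i l) + W (dn i l))"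
    by (simp add: sum_subtractf[symmetric] algebra_simps)
  have 2: "(\<Sum>i\<in>UNIV. f (gpt a N l) $ i * ((V (up i l) - W (up i l)) - (V (dn i l) - W (dn i l))))
     = (\<Sum>i\<in>UNIV. f (gpt a N l) $ i * (V (up i l) - V (dn i l))) - (\<Sum>i\<in>UNIV. f (gpt a N l) $ i * (W (up i l) - W (dn i l)))"
    by (simp add: sum_subtractf[symmetric] algebra_simps)
  have 3: "(\<Sum>i\<in>UNIV. (f (gpt a N (up i l)) $ i - f (gpt a N (dn i l)) $ i) * (V l - W l))
     = (\<Sum>i\<in>UNIV. (f (gpt a N (up i l)) $ i - f (gpt a N (dn i l)) $ i) * V l)
       - (\<Sum>i\<in>UNIV. (f (gpt a N (up i l)) $ i - f (gpt a N (dn i l)) $ i) * W l)"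
    by (simp add: sum_subtractf[symmetric] right_diff_distrib)
  have linear: "(A - A' - c * (v - v')) / k - (B - B') / k' - (C - C') / k' - q * (v - v')
      = ((A - c * v) / k - B / k' - C / k' - q * v) - ((A' - c * v') / k - B' / k' - C' / k' - q * v')"
    for A A' B B' C C' c k k' q v v' :: real
    by (simp add: diff_divide_distrib right_diff_distrib)
  show ?thesis
    unfolding fd_rhs_def 1 2 3 by (rule linear)
qed

text \<open>
  The conditions under which one step of the scheme has nonnegative weights: \<open>mesh a N < 1 / Cf\<close> for the
  neighbours of a grid point, and \<open>cfl\<close> for the point itself.
\<close>

locale fd_scheme =
  fixes a :: real and N :: nat and f h :: "real^'d \<Rightarrow> real^'d" and Cf Lf Ch \<tau> :: real
  assumes a: "a > 0" and N: "N \<ge> 2"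
    and Cf: "Cf > 0" "\<And>x i. x \<in> cube a \<Longrightarrow> \<bar>f x $ i\<bar> \<le> Cf"
    and Lf: "Lf > 0" "\<And>x z i. x \<in> cube a \<Longrightarrow> z \<in> cube a \<Longrightarrow> \<bar>f x $ i - f z $ i\<bar> \<le> Lf * norm (x - z)"
    and Ch: "\<And>x i. x \<in> cube a \<Longrightarrow> \<bar>h x $ i\<bar> \<le> Ch"
    and mesh: "mesh a N < 1 / Cf" and \<tau>: "\<tau> > 0"
    and cfl: "\<tau> * (real CARD('d) / (mesh a N)\<^sup>2 + real CARD('d) * Lf + real CARD('d) / 2 * Ch\<^sup>2) \<le> 1"
begin

text \<open>
  With nonnegative weights the maximum norm is amplified at most by the sum of the weights. The diffusive
  and the convective weights sum up to one; only the discrete divergence can add to it, and it is at most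
  \<open>d Lf\<close> in absolute value.
\<close>

lemma fd_step_stable:
  fixes V :: "('d \<Rightarrow> nat) \<Rightarrow> real"
  assumes l: "l \<in> grid_interior N"
    and V: "\<And>l. l \<in> grid N \<Longrightarrow> \<bar>V l\<bar> \<le> m"
  shows "\<bar>V l + \<tau> * fd_rhs a N f h V l\<bar> \<le> (1 + \<tau> * (real CARD('d) * Lf)) * m"
proof -
  let ?d = "real CARD('d)" and ?\<eta> = "mesh a N" and ?x = "gpt a N l"
  note nb = grid_interior_neighbours[OF l]
  have \<eta>: "?\<eta> > 0" by (rule mesh_pos[OF a N])
  have x: "?x \<in> cube a" by (rule gpt_in_cube[OF a N nb(3)])
  have m: "m \<ge> 0" using V[OF nb(3)] by linarith
  define p where "p = \<tau> / (2 * ?\<eta>\<^sup>2)"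
  define r where "r i = \<tau> * f ?x $ i / (2 * ?\<eta>)" for i
  define \<delta> where "\<delta> = (\<Sum>i\<in>UNIV. (f (gpt a N (up i l)) $ i - f (gpt a N (dn i l)) $ i) / (2 * ?\<eta>))"
  \<comment> \<open>One step has the weights \<open>p - r i\<close> and \<open>p + r i\<close> on the neighbours and \<open>c0\<close> on the point itself.\<close>
  define c0 where "c0 = 1 - 2 * ?d * p - \<tau> * \<delta> - \<tau> * (h ?x \<bullet> h ?x) / 2"
  have r: "\<bar>r i\<bar> \<le> p" for i
  proof -
    have "\<bar>f ?x $ i\<bar> * ?\<eta> \<le> Cf * ?\<eta>" using Cf(2)[OF x] \<eta> by (intro mult_right_mono) auto
    also have "\<dots> \<le> 1" using mesh Cf(1) by (simp add: field_simps)
    finally have "\<tau> * (\<bar>f ?x $ i\<bar> * ?\<eta>) \<le> \<tau> * 1" using \<tau> by (intro mult_left_mono) auto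
    then have "\<tau> * (\<bar>f ?x $ i\<bar> * ?\<eta>) / (2 * ?\<eta>\<^sup>2) \<le> \<tau> / (2 * ?\<eta>\<^sup>2)"
      using \<eta> by (intro divide_right_mono) auto
    moreover have "\<tau> * (\<bar>f ?x $ i\<bar> * ?\<eta>) / (2 * ?\<eta>\<^sup>2) = \<bar>r i\<bar>"
      using \<tau> \<eta> by (simp add: r_def abs_mult power2_eq_square)
    ultimately show ?thesis by (simp add: p_def)
  qed
  have \<delta>: "\<bar>\<delta>\<bar> \<le> ?d * Lf"
  proof -
    have n: "norm ((f (gpt a N (up i l)) $ i - f (gpt a N (dn i l)) $ i) / (2 * ?\<eta>)) \<le> Lf" for i
    proof -
      have "gpt a N (up i l) - gpt a N (dn i l) = (2 * ?\<eta>) *\<^sub>R axis i 1"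
        by (simp add: gpt_up gpt_dn[OF nb(4)] scaleR_2[symmetric])
      then have "norm (gpt a N (up i l) - gpt a N (dn i l)) = 2 * ?\<eta>"
        using \<eta> by (simp add: norm_axis_1)
      then have "\<bar>f (gpt a N (up i l)) $ i - f (gpt a N (dn i l)) $ i\<bar> \<le> Lf * (2 * ?\<eta>)"
        using Lf(2)[OF gpt_in_cube[OF a N nb(1)[of i]] gpt_in_cube[OF a N nb(2)[of i]], of i] by simp
      then show ?thesis using \<eta> by (simp add: abs_divide pos_divide_le_eq)
    qed
    show ?thesis unfolding \<delta>_def using sum_norm_bound[of UNIV, OF n] by simp
  qed
  have H: "0 \<le> h ?x \<bullet> h ?x" "h ?x \<bullet> h ?x \<le> ?d * Ch\<^sup>2"
  proof -
    have "h ?x $ i * h ?x $ i \<le> Ch\<^sup>2" for i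
      using Ch[OF x, of i] abs_le_square_iff[of "h ?x $ i" Ch] by (simp add: power2_eq_square)
    then show "h ?x \<bullet> h ?x \<le> ?d * Ch\<^sup>2"
      unfolding inner_vec_def using sum_bounded_above[of UNIV "\<lambda>i. h ?x $ i \<bullet> h ?x $ i" "Ch\<^sup>2"] by simp
  qed simp
  have c0: "c0 \<ge> 0"
  proof -
    have "2 * ?d * p = \<tau> * (?d / ?\<eta>\<^sup>2)" by (simp add: p_def)
    moreover have "\<tau> * \<delta> \<le> \<tau> * (?d * Lf)" using \<delta> \<tau> by (intro mult_left_mono) auto
    moreover have "\<tau> * (h ?x \<bullet> h ?x) / 2 \<le> \<tau> * (?d / 2 * Ch\<^sup>2)"
      using mult_left_mono[OF H(2), of \<tau>] \<tau> by simp
    ultimately show ?thesis using cfl unfolding c0_def distrib_left by linarith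
  qed
  have "V l + \<tau> * fd_rhs a N f h V l
      = (\<Sum>i\<in>UNIV. (p - r i) * V (up i l) + (p + r i) * V (dn i l)) + c0 * V l"
  proof -
    have "(\<Sum>i\<in>UNIV. (p - r i) * V (up i l) + (p + r i) * V (dn i l))
      = \<tau> * (\<Sum>i\<in>UNIV. (V (up i l) + V (dn i l) - 2 * V l) / (2 * ?\<eta>\<^sup>2))
        - \<tau> * (\<Sum>i\<in>UNIV. f ?x $ i * ((V (up i l) - V (dn i l)) / (2 * ?\<eta>))) + 2 * ?d * p * V l"
    proof -
      have "(p - r i) * V (up i l) + (p + r i) * V (dn i l)
        = \<tau> * ((V (up i l) + V (dn i l) - 2 * V l) / (2 * ?\<eta>\<^sup>2))
         - \<tau> * (f ?x $ i * ((V (up i l) - V (dn i l)) / (2 * ?\<eta>))) + 2 * p * V l" for i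
        by (simp add: p_def r_def diff_divide_distrib add_divide_distrib algebra_simps)
      then show ?thesis
        by (simp only: sum.distrib sum_subtractf sum_distrib_left[symmetric]) simp
    qed
    then show ?thesis
      unfolding fd_rhs_difference_quotients \<delta>_def[symmetric] c0_def by (simp add: algebra_simps)
  qed
  also have "\<bar>\<dots>\<bar> \<le> (\<Sum>i\<in>(UNIV :: 'd set). 2 * p * m) + c0 * m"
  proof -
    have "\<bar>(p - r i) * V (up i l) + (p + r i) * V (dn i l)\<bar> \<le> 2 * p * m" for i
    proof -
      have "\<bar>(p - r i) * V (up i l)\<bar> \<le> (p - r i) * m" "\<bar>(p + r i) * V (dn i l)\<bar> \<le> (p + r i) * m"
        using r[of i] V[OF nb(1)] V[OF nb(2)] unfolding abs_mult by (auto intro!: mult_mono)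
      then show ?thesis by (simp add: algebra_simps)
    qed
    then have "\<bar>\<Sum>i\<in>UNIV. (p - r i) * V (up i l) + (p + r i) * V (dn i l)\<bar> \<le> (\<Sum>i\<in>(UNIV :: 'd set). 2 * p * m)"
      by (intro order_trans[OF sum_abs] sum_mono)
    moreover have "\<bar>c0 * V l\<bar> \<le> c0 * m"
      using c0 V[OF nb(3)] by (simp add: abs_mult mult_left_mono)
    ultimately show ?thesis by linarith
  qed
  also have "\<dots> = (1 - \<tau> * \<delta> - \<tau> * (h ?x \<bullet> h ?x) / 2) * m"
    by (simp add: c0_def algebra_simps)
  also have "\<dots> \<le> (1 + \<tau> * (?d * Lf)) * m"
  proof (rule mult_right_mono[OF _ m])
    have "\<tau> * (- \<delta>) \<le> \<tau> * (?d * Lf)" using \<delta> \<tau> by (intro mult_left_mono) auto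
    moreover have "0 \<le> \<tau> * (h ?x \<bullet> h ?x) / 2" using H(1) \<tau> by simp
    ultimately show "1 - \<tau> * \<delta> - \<tau> * (h ?x \<bullet> h ?x) / 2 \<le> 1 + \<tau> * (?d * Lf)" by simp
  qed
  finally show ?thesis .
qed

text \<open>
  The error itself satisfies the scheme up to the truncation error \<open>R\<close>, and it vanishes at the boundary
  points.
\<close>

lemma fd_interval_error:
  fixes U :: "nat \<Rightarrow> ('d \<Rightarrow> nat) \<Rightarrow> real" and w :: "real^'d \<Rightarrow> real \<Rightarrow> real"
  assumes n: "s + real n * \<tau> = s1"
    and boundary: "\<And>l k. l \<in> grid_boundary N \<Longrightarrow> k \<le> n \<Longrightarrow> U k l = 0"
      "\<And>x t. x \<in> frontier (cube a) \<Longrightarrow> t \<in> {s..s1} \<Longrightarrow> w x t = 0"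
    and scheme: "\<And>l k. l \<in> grid_interior N \<Longrightarrow> k < n \<Longrightarrow> (U (Suc k) l - U k l) / \<tau> = fd_rhs a N f h (U k) l"
    and consistent: "\<And>l t. l \<in> grid_interior N \<Longrightarrow> s \<le> t \<Longrightarrow> t + \<tau> \<le> s1 \<Longrightarrow>
       \<bar>(w (gpt a N l) (t + \<tau>) - w (gpt a N l) t) / \<tau> - fd_rhs a N f h (\<lambda>l. w (gpt a N l) t) l\<bar> \<le> R"
    and R: "R \<ge> 0"
    and init: "\<And>l. l \<in> grid N \<Longrightarrow> \<bar>U 0 l - w (gpt a N l) s\<bar> \<le> m" and m: "m \<ge> 0"
    and l: "l \<in> grid N"
  shows "\<bar>U n l - w (gpt a N l) s1\<bar> \<le> exp (real n * \<tau> * (real CARD('d) * Lf)) * (m + real n * \<tau> * R)"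
proof -
  let ?L = "real CARD('d) * Lf"
  have L: "?L \<ge> 0" using Lf(1) by simp
  have main: "\<forall>l\<in>grid N. \<bar>U k l - w (gpt a N l) (s + real k * \<tau>)\<bar> \<le> exp (real k * \<tau> * ?L) * (m + real k * \<tau> * R)"
    if "k \<le> n" for k
    using that
  proof (induction k)
    case 0
    then show ?case using init by simp
  next
    case (Suc k)
    let ?t = "s + real k * \<tau>" and ?b = "exp (real k * \<tau> * ?L) * (m + real k * \<tau> * R)"
    define E where "E l = U k l - w (gpt a N l) ?t" for l
    have E: "\<bar>E l\<bar> \<le> ?b" if "l \<in> grid N" for l
      using Suc that unfolding E_def by simp
    have b: "?b \<ge> 0" using m R \<tau> by simp
    have kn: "real k * \<tau> + \<tau> \<le> real n * \<tau>"
    proof -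
      have "real (Suc k) * \<tau> \<le> real n * \<tau>" using Suc.prems \<tau> by (intro mult_right_mono) auto
      then show ?thesis by (simp add: algebra_simps)
    qed
    have t: "s \<le> ?t" "?t + \<tau> \<le> s1" using kn n \<tau> by auto
    have t': "s + real (Suc k) * \<tau> = ?t + \<tau>" by (simp add: algebra_simps)
    have goal_bound: "(1 + \<tau> * ?L) * ?b + \<tau> * R \<le> exp (real (Suc k) * \<tau> * ?L) * (m + real (Suc k) * \<tau> * R)"
    proof -
      have e: "1 + \<tau> * ?L \<le> exp (\<tau> * ?L)" by (rule exp_ge_add_one_self)
      have "(1 + \<tau> * ?L) * ?b \<le> exp (\<tau> * ?L) * ?b" using e b by (rule mult_right_mono)
      moreover have "exp (\<tau> * ?L) * ?b = exp (real (Suc k) * \<tau> * ?L) * (m + real k * \<tau> * R)"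
        by (simp add: algebra_simps flip: exp_add)
      moreover have "1 * (\<tau> * R) \<le> exp (real (Suc k) * \<tau> * ?L) * (\<tau> * R)"
        using L \<tau> R by (intro mult_right_mono) auto
      moreover have "exp (real (Suc k) * \<tau> * ?L) * (m + real (Suc k) * \<tau> * R)
         = exp (real (Suc k) * \<tau> * ?L) * (m + real k * \<tau> * R) + exp (real (Suc k) * \<tau> * ?L) * (\<tau> * R)"
        unfolding distrib_left[symmetric] by (simp add: algebra_simps)
      ultimately show ?thesis by linarith
    qed
    show ?case
    proof
      fix l :: "'d \<Rightarrow> nat" assume lg: "l \<in> grid N"
      have "\<bar>U (Suc k) l - w (gpt a N l) (?t + \<tau>)\<bar> \<le> (1 + \<tau> * ?L) * ?b + \<tau> * R"
      proof (cases "l \<in> grid_interior N")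
        case True
        let ?W = "\<lambda>l. w (gpt a N l) ?t"
        define q where "q = (w (gpt a N l) (?t + \<tau>) - w (gpt a N l) ?t) / \<tau> - fd_rhs a N f h ?W l"
        have "\<bar>q\<bar> \<le> R" unfolding q_def by (rule consistent[OF True t])
        then have "\<bar>\<tau> * q\<bar> \<le> \<tau> * R" using \<tau> by (simp add: abs_mult)
        moreover have "U (Suc k) l = U k l + \<tau> * fd_rhs a N f h (U k) l"
          using scheme[OF True, of k] Suc.prems \<tau> by (simp add: field_simps)
        moreover have "w (gpt a N l) (?t + \<tau>) = ?W l + \<tau> * fd_rhs a N f h ?W l + \<tau> * q"
          using \<tau> by (simp add: q_def field_simps)
        moreover have "fd_rhs a N f h E l = fd_rhs a N f h (U k) l - fd_rhs a N f h ?W l"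
          unfolding E_def[abs_def] by (rule fd_rhs_diff)
        then have "\<tau> * fd_rhs a N f h E l = \<tau> * fd_rhs a N f h (U k) l - \<tau> * fd_rhs a N f h ?W l"
          by (simp add: right_diff_distrib)
        ultimately have eq: "U (Suc k) l - w (gpt a N l) (?t + \<tau>) = (E l + \<tau> * fd_rhs a N f h E l) - \<tau> * q"
          unfolding E_def by linarith
        have "\<bar>E l + \<tau> * fd_rhs a N f h E l\<bar> \<le> (1 + \<tau> * ?L) * ?b"
          by (rule fd_step_stable[OF True E])
        with \<open>\<bar>\<tau> * q\<bar> \<le> \<tau> * R\<close> show ?thesis unfolding eq by linarith
      next
        case False
        then have lb: "l \<in> grid_boundary N" using lg by (simp add: grid_boundary_def)
        have "U (Suc k) l = 0" by (rule boundary(1)[OF lb Suc.prems])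
        moreover have "w (gpt a N l) (?t + \<tau>) = 0"
          by (rule boundary(2)[OF gpt_boundary_frontier[OF a N lb]]) (use t \<tau> in auto)
        moreover have "0 \<le> (1 + \<tau> * ?L) * ?b + \<tau> * R" using b L \<tau> R by simp
        ultimately show ?thesis by simp
      qed
      then show "\<bar>U (Suc k) l - w (gpt a N l) (s + real (Suc k) * \<tau>)\<bar>
          \<le> exp (real (Suc k) * \<tau> * ?L) * (m + real (Suc k) * \<tau> * R)"
        unfolding t' using goal_bound by linarith
    qed
  qed
  show ?thesis using main[of n] l n by simp
qed

text \<open>
  A restart multiplies the error by the values of \<open>Efun\<close>, hence at most by \<open>e\<close>. With
  \<open>Q = e exp(\<Delta> d Lf)\<close> the recursion \<open>E\<^sub>j\<^sub>+\<^sub>1 \<le> exp(\<Delta> d Lf) (e E\<^sub>j + \<Delta> R)\<close> is solved by \<open>j Q\<^sup>j \<Delta> R\<close>.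
\<close>

lemma fd_error_at_nodes:
  fixes U :: "nat \<Rightarrow> nat \<Rightarrow> ('d \<Rightarrow> nat) \<Rightarrow> real" and w :: "nat \<Rightarrow> real^'d \<Rightarrow> real \<Rightarrow> real"
  assumes T: "T > 0"
    and n: "real n * \<tau> = T / real Nt"
    and sol: "fd_solution a N f h y \<sigma>0 T Nt n \<tau> U"
    and w_boundary: "\<And>j x t. j \<in> {1..Nt} \<Longrightarrow> x \<in> frontier (cube a) \<Longrightarrow> t \<in> {tnode T Nt (j - 1)..tnode T Nt j} \<Longrightarrow> w j x t = 0"
    and w_initial: "\<And>x. x \<in> cube a \<Longrightarrow> w 1 x 0 = \<sigma>0 x"
    and w_restart: "\<And>j l. j \<in> {1..<Nt} \<Longrightarrow> l \<in> grid N \<Longrightarrow>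
       w (j + 1) (gpt a N l) (tnode T Nt j) = Efun a N h y T Nt j l * w j (gpt a N l) (tnode T Nt j)"
    and E: "\<And>j l. j \<in> {1..<Nt} \<Longrightarrow> l \<in> grid N \<Longrightarrow> \<bar>Efun a N h y T Nt j l\<bar> \<le> e" and e: "e \<ge> 1"
    and consistent: "\<And>j l t. j \<in> {1..Nt} \<Longrightarrow> l \<in> grid_interior N \<Longrightarrow> tnode T Nt (j - 1) \<le> t \<Longrightarrow> t + \<tau> \<le> tnode T Nt j \<Longrightarrow>
       \<bar>(w j (gpt a N l) (t + \<tau>) - w j (gpt a N l) t) / \<tau> - fd_rhs a N f h (\<lambda>l. w j (gpt a N l) t) l\<bar> \<le> R"
    and R: "R \<ge> 0"
    and j: "1 \<le> j" "j \<le> Nt" and l: "l \<in> grid N"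
  shows "\<bar>U j n l - w j (gpt a N l) (tnode T Nt j)\<bar>
    \<le> real j * ((e * exp (T / real Nt * (real CARD('d) * Lf))) ^ j * (T / real Nt * R))"
proof -
  let ?\<Delta> = "T / real Nt" and ?L = "real CARD('d) * Lf"
  let ?x = "exp (?\<Delta> * ?L)"
  define Q where "Q = e * ?x"
  have \<Delta>: "?\<Delta> > 0" using T j by simp
  have L: "?L > 0" using Lf(1) by simp
  have x1: "1 \<le> ?x" unfolding one_le_exp_iff
    by (rule mult_nonneg_nonneg[OF less_imp_le[OF \<Delta>] less_imp_le[OF L]])
  have Q1: "Q \<ge> 1" using e x1 mult_mono[of 1 e 1 ?x] by (simp add: Q_def)
  have DR: "0 \<le> ?\<Delta> * R" by (intro mult_nonneg_nonneg) (use \<Delta> R in auto)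
  have xQ: "?x * (?\<Delta> * R) \<le> Q * (?\<Delta> * R)"
  proof -
    have "1 * ?x \<le> e * ?x" using e x1 by (intro mult_right_mono) auto
    then show ?thesis using DR unfolding Q_def by (intro mult_right_mono) auto
  qed
  have interval: "\<bar>U j n l - w j (gpt a N l) (tnode T Nt j)\<bar> \<le> ?x * (m + ?\<Delta> * R)"
    if j: "j \<in> {1..Nt}" and init: "\<And>l. l \<in> grid N \<Longrightarrow> \<bar>U j 0 l - w j (gpt a N l) (tnode T Nt (j - 1))\<bar> \<le> m"
      and m: "m \<ge> 0" and l: "l \<in> grid N" for j m l
  proof -
    have t: "tnode T Nt (j - 1) + real n * \<tau> = tnode T Nt j"
      using tnode_Suc[of T Nt "j - 1"] j n by simp
    have "\<bar>U j n l - w j (gpt a N l) (tnode T Nt j)\<bar> \<le> exp (real n * \<tau> * ?L) * (m + real n * \<tau> * R)"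
      by (rule fd_interval_error[where w="w j" and U="U j", OF t _ w_boundary[OF j] _ consistent[OF j] R init m l])
         (use sol j in \<open>auto simp: fd_solution_def\<close>)
    then show ?thesis by (simp add: n)
  qed
  have "\<forall>l\<in>grid N. \<bar>U j n l - w j (gpt a N l) (tnode T Nt j)\<bar> \<le> real j * (Q ^ j * (?\<Delta> * R))"
    using j
  proof (induction j rule: nat_induct_at_least)
    case base
    show ?case
    proof
      fix l :: "'d \<Rightarrow> nat" assume l: "l \<in> grid N"
      have "\<bar>U 1 n l - w 1 (gpt a N l) (tnode T Nt 1)\<bar> \<le> ?x * (0 + ?\<Delta> * R)"
      proof (rule interval[OF _ _ _ l])
        show "1 \<in> {1..Nt}" using base by simp
        show "\<bar>U 1 0 l - w 1 (gpt a N l) (tnode T Nt (1 - 1))\<bar> \<le> 0" if l: "l \<in> grid N" for l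
          using sol l w_initial[OF gpt_in_cube[OF a N l]] by (simp add: fd_solution_def)
      qed simp
      also have "\<dots> \<le> Q * (?\<Delta> * R)" using xQ by simp
      finally show "\<bar>U 1 n l - w 1 (gpt a N l) (tnode T Nt 1)\<bar> \<le> real 1 * (Q ^ 1 * (?\<Delta> * R))" by simp
    qed
  next
    case (Suc j)
    let ?m = "real j * (Q ^ j * (?\<Delta> * R))"
    have jj: "j \<in> {1..<Nt}" "Suc j \<in> {1..Nt}" using Suc by auto
    have IH: "\<bar>U j n l - w j (gpt a N l) (tnode T Nt j)\<bar> \<le> ?m" if "l \<in> grid N" for l
      using Suc that by simp
    have m: "0 \<le> ?m" by (intro mult_nonneg_nonneg DR) (use Q1 in auto)
    show ?case
    proof
      fix l :: "'d \<Rightarrow> nat" assume l: "l \<in> grid N"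
      have "\<bar>U (Suc j) n l - w (Suc j) (gpt a N l) (tnode T Nt (Suc j))\<bar> \<le> ?x * (e * ?m + ?\<Delta> * R)"
      proof (rule interval[OF jj(2) _ _ l])
        fix l :: "'d \<Rightarrow> nat" assume l: "l \<in> grid N"
        have eq: "U (Suc j) 0 l - w (Suc j) (gpt a N l) (tnode T Nt j)
            = Efun a N h y T Nt j l * (U j n l - w j (gpt a N l) (tnode T Nt j))"
          using sol jj(1) l w_restart[OF jj(1) l] by (simp add: fd_solution_def right_diff_distrib)
        have "\<bar>Efun a N h y T Nt j l\<bar> * \<bar>U j n l - w j (gpt a N l) (tnode T Nt j)\<bar> \<le> e * ?m"
          by (rule mult_mono[OF E[OF jj(1) l] IH[OF l]]) (use e in auto)
        then show "\<bar>U (Suc j) 0 l - w (Suc j) (gpt a N l) (tnode T Nt (Suc j - 1))\<bar> \<le> e * ?m"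
          by (simp only: eq abs_mult diff_Suc_1)
      qed (rule mult_nonneg_nonneg[OF _ m], use e in simp)
      also have "\<dots> \<le> Q * ?m + Q * (?\<Delta> * R)"
        using xQ by (simp add: Q_def distrib_left mult_ac)
      also have "Q * (?\<Delta> * R) \<le> Q ^ Suc j * (?\<Delta> * R)"
        using DR Q1 self_le_power[OF Q1, of "Suc j"] by (intro mult_right_mono) auto
      also have "Q * ?m + Q ^ Suc j * (?\<Delta> * R) = real (Suc j) * (Q ^ Suc j * (?\<Delta> * R))"
        by (simp add: algebra_simps add_divide_distrib)
      finally show "\<bar>U (Suc j) n l - w (Suc j) (gpt a N l) (tnode T Nt (Suc j))\<bar>
          \<le> real (Suc j) * (Q ^ Suc j * (?\<Delta> * R))" by simp
    qed
  qed
  then show ?thesis using l by (simp add: Q_def)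
qed

end

section \<open>Accumulation of the low-rank errors\<close>

lemma finite_grid [simp]: "finite (grid N :: ('d::finite \<Rightarrow> nat) set)"
proof -
  have "finite (PiE UNIV (\<lambda>_::'d. {1..N}))" by (intro finite_PiE) auto
  then show ?thesis by (rule rev_finite_subset) (auto simp: grid_def PiE_def Pi_def)
qed

lemma grid_nonempty: "N \<ge> 1 \<Longrightarrow> grid N \<noteq> {}"
  by (auto simp: grid_def intro!: exI[of _ "\<lambda>_. 1"])

lemma mat_vec_cong: "(\<And>l. l \<in> G \<Longrightarrow> V l = W l) \<Longrightarrow> mat_vec G M V = mat_vec G M W"
  by (simp add: mat_vec_def)

lemma mat_vec_diff_right: "mat_vec G M (\<lambda>l. V l - W l) k = mat_vec G M V k - mat_vec G M W k"
  by (simp add: mat_vec_def right_diff_distrib sum_subtractf)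

lemma mat_vec_diff_left: "mat_vec G (\<lambda>k l. M k l - M' k l) V k = mat_vec G M V k - mat_vec G M' V k"
  by (simp add: mat_vec_def left_diff_distrib sum_subtractf)

lemma mat_vec_scale: "mat_vec G M (\<lambda>l. c * V l) k = c * mat_vec G M V k"
  by (simp add: mat_vec_def sum_distrib_left mult_ac)

lemma mat_vec_diag: "finite G \<Longrightarrow> k \<in> G \<Longrightarrow> mat_vec G (diag_mat E) V k = E k * V k"
  by (simp add: mat_vec_def diag_mat_def if_distrib[of "\<lambda>c. c * _"] cong: if_cong)

lemma L2_set_cong': "(\<And>l. l \<in> G \<Longrightarrow> V l = W l) \<Longrightarrow> L2_set V G = L2_set W G"
  by (rule L2_set_cong) auto

lemma L2_mat_vec_le_frobenius:
  assumes "finite G"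
  shows "L2_set (mat_vec G M V) G \<le> frobenius_norm G M * L2_set V G"
proof -
  have "\<bar>mat_vec G M V k\<bar> \<le> L2_set (M k) G * L2_set V G" for k
  proof -
    have "\<bar>mat_vec G M V k\<bar> \<le> (\<Sum>l\<in>G. \<bar>M k l\<bar> * \<bar>V l\<bar>)"
      unfolding mat_vec_def by (rule order_trans[OF sum_abs]) (simp add: abs_mult)
    also have "\<dots> \<le> L2_set (M k) G * L2_set V G" by (rule L2_set_mult_ineq)
    finally show ?thesis .
  qed
  then have "L2_set (\<lambda>k. \<bar>mat_vec G M V k\<bar>) G \<le> L2_set (\<lambda>k. L2_set (M k) G * L2_set V G) G"
    by (intro L2_set_mono) auto
  also have "\<dots> = L2_set (\<lambda>k. L2_set (M k) G) G * L2_set V G"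
    by (simp add: L2_set_left_distrib)
  also have "L2_set (\<lambda>k. L2_set (M k) G) G = frobenius_norm G M"
    unfolding frobenius_norm_def L2_set_def
    by (simp add: sum_nonneg sum.cartesian_product case_prod_beta)
  finally show ?thesis by (simp add: L2_set_def)
qed

text \<open>
  The Frobenius norm bounds the set whose supremum is the spectral norm, so that the supremum is an
  upper bound of it.
\<close>

lemma L2_mat_vec_le_spectral:
  assumes "finite G"
  shows "L2_set (mat_vec G M V) G \<le> spectral_norm G M * L2_set V G"
proof -
  let ?X = "{L2_set (mat_vec G M V) G | V. L2_set V G \<le> 1}"
  have bdd: "bdd_above ?X"
  proof (rule bdd_aboveI)
    fix z assume "z \<in> ?X"
    then obtain V where V: "z = L2_set (mat_vec G M V) G" "L2_set V G \<le> 1" by blast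
    have "frobenius_norm G M * L2_set V G \<le> frobenius_norm G M * 1"
      using V(2) by (intro mult_left_mono) (auto simp: frobenius_norm_def)
    then show "z \<le> frobenius_norm G M"
      using L2_mat_vec_le_frobenius[OF assms, of M V] V(1) by linarith
  qed
  show ?thesis
  proof (cases "L2_set V G = 0")
    case True
    then have "mat_vec G M V = mat_vec G M (\<lambda>_. 0)"
      using assms by (intro mat_vec_cong) (simp add: L2_set_eq_0_iff)
    then show ?thesis using True by (simp add: mat_vec_def L2_set_def)
  next
    case False
    let ?n = "L2_set V G"
    have n: "?n > 0" using False by (simp add: less_le)
    have one: "L2_set (\<lambda>l. inverse ?n * V l) G = 1"
      using n by (subst L2_set_right_distrib[symmetric]) auto
    have "L2_set (mat_vec G M (\<lambda>l. inverse ?n * V l)) G \<in> ?X"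
      by (intro CollectI exI[of _ "\<lambda>l. inverse ?n * V l"] conjI refl) (rule eq_refl[OF one])
    then have "L2_set (mat_vec G M (\<lambda>l. inverse ?n * V l)) G \<le> spectral_norm G M"
      unfolding spectral_norm_def by (rule cSup_upper[OF _ bdd])
    also have "L2_set (mat_vec G M (\<lambda>l. inverse ?n * V l)) G = inverse ?n * L2_set (mat_vec G M V) G"
      using n unfolding mat_vec_scale by (subst L2_set_right_distrib[symmetric]) auto
    finally show ?thesis using n by (simp add: field_simps)
  qed
qed

lemma spectral_norm_nonneg:
  assumes "finite G" shows "0 \<le> spectral_norm G M"
proof (cases "G = {}")
  case True
  then show ?thesis by (simp add: spectral_norm_def L2_set_def)
next
  case False
  then obtain k where k: "k \<in> G" by blast
  define V where "V l = (if l = k then 1 else 0 :: real)" for l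
  have "L2_set V G = 1"
  proof -
    have "(V l)\<^sup>2 = (if l = k then 1 else 0)" for l by (simp add: V_def)
    then show ?thesis using k assms by (simp add: L2_set_def)
  qed
  then show ?thesis
    using order_trans[OF L2_set_nonneg L2_mat_vec_le_spectral[OF assms, of M V]] by simp
qed

lemma spectral_norm_diag_le:
  assumes "finite G" "\<And>k. k \<in> G \<Longrightarrow> \<bar>E k\<bar> \<le> e" "e \<ge> 0"
  shows "spectral_norm G (diag_mat E) \<le> e"
  unfolding spectral_norm_def
proof (rule cSup_least)
  show "{L2_set (mat_vec G (diag_mat E) V) G |V. L2_set V G \<le> 1} \<noteq> {}"
    by (auto intro!: exI[of _ "\<lambda>_. 0"] simp: L2_set_def)
  fix z assume "z \<in> {L2_set (mat_vec G (diag_mat E) V) G |V. L2_set V G \<le> 1}"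
  then obtain V where V: "z = L2_set (mat_vec G (diag_mat E) V) G" "L2_set V G \<le> 1" by blast
  have "L2_set (\<lambda>k. \<bar>mat_vec G (diag_mat E) V k\<bar>) G \<le> L2_set (\<lambda>k. e * \<bar>V k\<bar>) G"
    using assms by (intro L2_set_mono) (auto simp: mat_vec_diag abs_mult intro!: mult_right_mono)
  also have "\<dots> = e * L2_set (\<lambda>k. \<bar>V k\<bar>) G"
    using assms(3) by (simp add: L2_set_right_distrib)
  also have "\<dots> \<le> e * 1"
    using V(2) assms(3) by (intro mult_left_mono) (auto simp: L2_set_def)
  finally show "z \<le> e" by (simp add: V(1) L2_set_def)
qed

text \<open>
  This covers the propagator with its Frobenius error as well as the Hadamard factor, read as a diagonal
  matrix, with its spectral error.
\<close>

lemma perturbed_operator_error: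
  assumes "\<And>W. L2_set (mat_vec G M W) G \<le> c * L2_set W G"
    and "\<And>W. L2_set (mat_vec G (\<lambda>k l. Mh k l - M k l) W) G \<le> \<epsilon> * c * L2_set W G"
  shows "L2_set (\<lambda>k. mat_vec G Mh Vh k - mat_vec G M V k) G
    \<le> (1 + \<epsilon>) * c * L2_set (\<lambda>l. Vh l - V l) G + \<epsilon> * c * L2_set V G"
proof -
  let ?E = "\<lambda>l. Vh l - V l" and ?P = "\<lambda>k l. Mh k l - M k l"
  have "(\<lambda>k. mat_vec G Mh Vh k - mat_vec G M V k) = (\<lambda>k. (mat_vec G M ?E k + mat_vec G ?P ?E k) + mat_vec G ?P V k)"
    by (simp add: mat_vec_diff_left mat_vec_diff_right)
  then have "L2_set (\<lambda>k. mat_vec G Mh Vh k - mat_vec G M V k) G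
      \<le> (L2_set (mat_vec G M ?E) G + L2_set (mat_vec G ?P ?E) G) + L2_set (mat_vec G ?P V) G"
    by (simp only:) (intro order_trans[OF L2_set_triangle_ineq] add_right_mono L2_set_triangle_ineq)
  also have "\<dots> \<le> (c * L2_set ?E G + \<epsilon> * c * L2_set ?E G) + \<epsilon> * c * L2_set V G"
    using assms by (intro add_mono) auto
  finally show ?thesis by (simp add: algebra_simps)
qed

text \<open>
  The first interval starts without a Hadamard factor, so its recursion has the factor
  \<open>(1 + \<epsilon>2) c \<le> c7\<close> and no contribution \<open>b\<close>.
\<close>

lemma qtt_error_recursion:
  fixes g v w b :: "nat \<Rightarrow> real" and \<epsilon>1 \<epsilon>2 c c7 :: real
  assumes g0: "g 0 \<le> \<epsilon>1 * v 0"
    and base: "g (Suc 0) \<le> (1 + \<epsilon>2) * c * g 0 + \<epsilon>2 * c * w (Suc 0)"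
    and step: "\<And>j. 1 \<le> j \<Longrightarrow> j < Nt \<Longrightarrow> g (Suc j) \<le> c7 * g j + b j + \<epsilon>2 * c * w (Suc j)"
    and Nt: "Nt \<ge> 1" and c7: "(1 + \<epsilon>2) * c \<le> c7" "c7 \<ge> 0" and nn: "\<And>j. b j \<ge> 0" "g 0 \<ge> 0"
  shows "g Nt \<le> c7 ^ Nt * (\<epsilon>1 * v 0) + (\<Sum>j=1..Nt. c7 ^ (Nt - j) * (b (j - 1) + \<epsilon>2 * c * w j))"
proof -
  have main: "g n \<le> c7 ^ n * (\<epsilon>1 * v 0) + (\<Sum>j=1..n. c7 ^ (n - j) * (b (j - 1) + \<epsilon>2 * c * w j))"
    if "n \<le> Nt" for n
    using that
  proof (induction n)
    case 0
    then show ?case using g0 by simp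
  next
    case (Suc n)
    have st: "g (Suc n) \<le> c7 * g n + (b n + \<epsilon>2 * c * w (Suc n))"
    proof (cases "n = 0")
      case True
      have "(1 + \<epsilon>2) * c * g 0 \<le> c7 * g 0" using c7(1) nn(2) by (rule mult_right_mono)
      then show ?thesis using base True nn(1)[of 0] by simp
    next
      case False
      then show ?thesis using step[of n] Suc.prems by simp
    qed
    also have "c7 * g n \<le> c7 * (c7 ^ n * (\<epsilon>1 * v 0) + (\<Sum>j=1..n. c7 ^ (n - j) * (b (j - 1) + \<epsilon>2 * c * w j)))"
      using Suc c7(2) by (intro mult_left_mono) auto
    also have "\<dots> = c7 ^ Suc n * (\<epsilon>1 * v 0) + (\<Sum>j=1..n. c7 ^ (Suc n - j) * (b (j - 1) + \<epsilon>2 * c * w j))"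
      by (simp add: distrib_left sum_distrib_left Suc_diff_le mult_ac)
    finally show ?case by simp
  qed
  show ?thesis by (rule main) simp
qed

lemma mat_vec_power_Suc:
  assumes "finite G"
  shows "mat_vec G (mat_power G M (Suc n)) V k = mat_vec G M (mat_vec G (mat_power G M n) V) k"
proof -
  have "mat_vec G (mat_power G M (Suc n)) V k = (\<Sum>l\<in>G. \<Sum>p\<in>G. M k p * mat_power G M n p l * V l)"
    by (simp add: mat_vec_def sum_distrib_right)
  also have "\<dots> = (\<Sum>p\<in>G. \<Sum>l\<in>G. M k p * mat_power G M n p l * V l)"
    by (rule sum.swap)
  finally show ?thesis by (simp add: mat_vec_def sum_distrib_left mult.assoc)
qed

text \<open>
  On grid functions with zero boundary values the matrix represents the scheme, and the scheme preserves
  the zero boundary values; so the powers of the matrix reproduce the iterates.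
\<close>

lemma fd_solution_propagator:
  fixes U :: "nat \<Rightarrow> nat \<Rightarrow> ('d::finite \<Rightarrow> nat) \<Rightarrow> real"
  assumes A: "fd_matrix a N f h A" and sol: "fd_solution a N f h y \<sigma>0 T Nt n \<tau> U" and \<tau>: "\<tau> > 0"
    and j: "j \<in> {1..Nt}" and l: "l \<in> grid N"
  shows "U j n l = mat_vec (grid N) (fd_propagator N n \<tau> A) (U j 0) l"
proof -
  let ?G = "grid N :: ('d \<Rightarrow> nat) set"
  let ?M = "\<lambda>k l. \<tau> * A k l + diag_mat (\<lambda>_. 1) k l"
  have M: "mat_vec ?G ?M V k = \<tau> * mat_vec ?G A V k + V k" if "k \<in> ?G" for V k
  proof -
    have "mat_vec ?G ?M V k = \<tau> * mat_vec ?G A V k + mat_vec ?G (diag_mat (\<lambda>_. 1)) V k"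
      by (simp add: mat_vec_def distrib_right sum.distrib sum_distrib_left mult.assoc)
    then show ?thesis using that by (simp add: mat_vec_diag)
  qed
  have "\<forall>l\<in>?G. U j k l = mat_vec ?G (mat_power ?G ?M k) (U j 0) l" if "k \<le> n" for k
    using that
  proof (induction k)
    case 0
    then show ?case by (simp add: mat_vec_diag)
  next
    case (Suc k)
    have zero: "\<forall>l\<in>grid_boundary N. U j k l = 0" "\<forall>l\<in>grid_boundary N. U j (Suc k) l = 0"
      using sol j Suc.prems by (auto simp: fd_solution_def)
    show ?case
    proof
      fix l assume l: "l \<in> ?G"
      have "mat_vec ?G (mat_power ?G ?M (Suc k)) (U j 0) l = mat_vec ?G ?M (mat_vec ?G (mat_power ?G ?M k) (U j 0)) l"
        by (rule mat_vec_power_Suc) simp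
      also have "mat_vec ?G ?M (mat_vec ?G (mat_power ?G ?M k) (U j 0)) = mat_vec ?G ?M (U j k)"
        by (rule mat_vec_cong) (use Suc in simp)
      also have "mat_vec ?G ?M (U j k) l = \<tau> * mat_vec ?G A (U j k) l + U j k l" by (rule M[OF l])
      also have "\<dots> = U j (Suc k) l"
      proof (cases "l \<in> grid_interior N")
        case True
        then have "mat_vec ?G A (U j k) l = fd_rhs a N f h (U j k) l"
          using A zero(1) by (simp add: fd_matrix_def)
        moreover have "(U j (Suc k) l - U j k l) / \<tau> = fd_rhs a N f h (U j k) l"
          using sol j Suc.prems True by (simp add: fd_solution_def)
        ultimately show ?thesis using \<tau> by (simp add: field_simps)
      next
        case False
        then have lb: "l \<in> grid_boundary N" using l by (simp add: grid_boundary_def)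
        then have "mat_vec ?G A (U j k) l = 0" using A zero(1) by (simp add: fd_matrix_def)
        then show ?thesis using zero lb by simp
      qed
      finally show "U j (Suc k) l = mat_vec ?G (mat_power ?G ?M (Suc k)) (U j 0) l" by simp
    qed
  qed
  then show ?thesis using l by (simp add: fd_propagator_def)
qed

lemma qtt_error:
  fixes U :: "nat \<Rightarrow> nat \<Rightarrow> ('d::finite \<Rightarrow> nat) \<Rightarrow> real"
  assumes A: "fd_matrix a N f h A" and sol: "fd_solution a N f h y \<sigma>0 T Nt n \<tau> U" and \<tau>: "\<tau> > 0"
    and Nt: "Nt \<ge> 1" and \<epsilon>: "\<epsilon>1 \<ge> 0" "\<epsilon>2 \<ge> 0"
    and qtt: "qtt_solution a N h y T Nt (fd_propagator N n \<tau> A) (U 0 n) \<epsilon>1 \<epsilon>2 Eh Mh Uh0 UhT"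
    and E: "\<And>j l. j \<in> {1..<Nt} \<Longrightarrow> l \<in> grid N \<Longrightarrow> \<bar>Efun a N h y T Nt j l\<bar> \<le> e" and e: "e \<ge> 1"
  defines "c6 \<equiv> spectral_norm (grid N) (fd_propagator N n \<tau> A)"
  defines "c7 \<equiv> (1 + \<epsilon>2) * (1 + \<epsilon>1) * c6 * e"
  shows "L2_set (\<lambda>l. UhT Nt l - U Nt n l) (grid N)
    \<le> c7 ^ Nt * (\<epsilon>1 * L2_set (U 0 n) (grid N))
      + (\<Sum>j=1..Nt. c7 ^ (Nt - j) * ((1 + \<epsilon>2) * \<epsilon>1 * c6 * e * L2_set (U (j - 1) n) (grid N)
          + \<epsilon>2 * c6 * L2_set (U j 0) (grid N)))"
proof -
  let ?G = "grid N :: ('d \<Rightarrow> nat) set" and ?M = "fd_propagator N n \<tau> A"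
  let ?E = "Efun a N h y T Nt"
  define g where "g j = L2_set (\<lambda>l. UhT j l - U j n l) ?G" for j
  have c6: "c6 \<ge> 0" unfolding c6_def by (rule spectral_norm_nonneg) simp
  have M_bound: "L2_set (mat_vec ?G ?M W) ?G \<le> c6 * L2_set W ?G" for W
    unfolding c6_def by (rule L2_mat_vec_le_spectral) simp
  have P_bound: "L2_set (mat_vec ?G (\<lambda>k l. Mh k l - ?M k l) W) ?G \<le> \<epsilon>2 * c6 * L2_set W ?G" for W
  proof -
    have "frobenius_norm ?G (\<lambda>k l. Mh k l - ?M k l) \<le> \<epsilon>2 * c6"
      using qtt by (simp add: qtt_solution_def c6_def)
    then show ?thesis
      by (intro order_trans[OF L2_mat_vec_le_frobenius] mult_right_mono) auto
  qed
  have propagate: "g j \<le> (1 + \<epsilon>2) * c6 * L2_set (\<lambda>l. Uh0 j l - U j 0 l) ?G + \<epsilon>2 * c6 * L2_set (U j 0) ?G"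
    if j: "j \<in> {1..Nt}" for j
  proof -
    have "g j = L2_set (\<lambda>l. mat_vec ?G Mh (Uh0 j) l - mat_vec ?G ?M (U j 0) l) ?G"
      unfolding g_def
      by (rule L2_set_cong') (use qtt j fd_solution_propagator[OF A sol \<tau> j] in \<open>auto simp: qtt_solution_def\<close>)
    then show ?thesis
      using perturbed_operator_error[of ?G ?M c6 Mh \<epsilon>2, OF M_bound P_bound] by simp
  qed
  have restart: "L2_set (\<lambda>l. Uh0 (Suc j) l - U (Suc j) 0 l) ?G \<le> (1 + \<epsilon>1) * e * g j + \<epsilon>1 * e * L2_set (U j n) ?G"
    if j: "j \<in> {1..<Nt}" for j
  proof -
    let ?D = "diag_mat (?E j)" and ?Dh = "diag_mat (Eh j)"
    have sp: "spectral_norm ?G ?D \<le> e"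
      by (rule spectral_norm_diag_le) (use E[OF j] e in auto)
    have D: "L2_set (mat_vec ?G ?D W) ?G \<le> e * L2_set W ?G" for W
      using sp by (intro order_trans[OF L2_mat_vec_le_spectral] mult_right_mono) auto
    have Dh: "L2_set (mat_vec ?G (\<lambda>k l. ?Dh k l - ?D k l) W) ?G \<le> \<epsilon>1 * e * L2_set W ?G" for W
    proof -
      have "spectral_norm ?G (\<lambda>k l. ?Dh k l - ?D k l) \<le> \<epsilon>1 * spectral_norm ?G ?D"
        using qtt j by (simp add: qtt_solution_def)
      also have "\<dots> \<le> \<epsilon>1 * e" using sp \<epsilon>(1) by (rule mult_left_mono)
      finally show ?thesis
        by (intro order_trans[OF L2_mat_vec_le_spectral] mult_right_mono) auto
    qed
    have "L2_set (\<lambda>l. Uh0 (Suc j) l - U (Suc j) 0 l) ?G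
        = L2_set (\<lambda>l. mat_vec ?G ?Dh (UhT j) l - mat_vec ?G ?D (U j n) l) ?G"
      by (rule L2_set_cong') (use qtt sol j in \<open>auto simp: qtt_solution_def fd_solution_def mat_vec_diag\<close>)
    then show ?thesis
      using perturbed_operator_error[of ?G ?D e ?Dh \<epsilon>1, OF D Dh] by (simp add: g_def)
  qed
  have "g Nt \<le> c7 ^ Nt * (\<epsilon>1 * L2_set (U 0 n) ?G)
      + (\<Sum>j=1..Nt. c7 ^ (Nt - j) * ((1 + \<epsilon>2) * \<epsilon>1 * c6 * e * L2_set (U (j - 1) n) ?G
          + \<epsilon>2 * c6 * L2_set (U j 0) ?G))"
  proof (rule qtt_error_recursion[where v="\<lambda>j. L2_set (U j n) ?G" and w="\<lambda>j. L2_set (U j 0) ?G"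
      and b="\<lambda>j. (1 + \<epsilon>2) * \<epsilon>1 * c6 * e * L2_set (U j n) ?G"])
    show "g 0 \<le> \<epsilon>1 * L2_set (U 0 n) ?G"
      using qtt by (simp add: qtt_solution_def g_def)
    have "L2_set (\<lambda>l. Uh0 1 l - U 1 0 l) ?G = g 0"
      unfolding g_def by (rule L2_set_cong') (use qtt sol in \<open>simp add: qtt_solution_def fd_solution_def\<close>)
    then show "g (Suc 0) \<le> (1 + \<epsilon>2) * c6 * g 0 + \<epsilon>2 * c6 * L2_set (U (Suc 0) 0) ?G"
      using propagate[of 1] Nt by simp
    show "g (Suc j) \<le> c7 * g j + (1 + \<epsilon>2) * \<epsilon>1 * c6 * e * L2_set (U j n) ?G + \<epsilon>2 * c6 * L2_set (U (Suc j) 0) ?G"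
      if j: "1 \<le> j" "j < Nt" for j
    proof -
      have "(1 + \<epsilon>2) * c6 * L2_set (\<lambda>l. Uh0 (Suc j) l - U (Suc j) 0 l) ?G
         \<le> (1 + \<epsilon>2) * c6 * ((1 + \<epsilon>1) * e * g j + \<epsilon>1 * e * L2_set (U j n) ?G)"
        using restart[of j] j c6 \<epsilon> by (intro mult_left_mono) auto
      also have "\<dots> = c7 * g j + (1 + \<epsilon>2) * \<epsilon>1 * c6 * e * L2_set (U j n) ?G"
        by (simp add: c7_def algebra_simps)
      finally show ?thesis using propagate[of "Suc j"] j by simp
    qed
    show "(1 + \<epsilon>2) * c6 \<le> c7"
    proof -
      have "1 * 1 \<le> (1 + \<epsilon>1) * e" using \<epsilon> e by (intro mult_mono) auto
      then have "(1 + \<epsilon>2) * c6 * 1 \<le> (1 + \<epsilon>2) * c6 * ((1 + \<epsilon>1) * e)"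
        using \<epsilon> c6 by (intro mult_left_mono) auto
      then show ?thesis by (simp add: c7_def mult_ac)
    qed
    show "0 \<le> c7" using \<epsilon> c6 e by (simp add: c7_def)
    show "0 \<le> (1 + \<epsilon>2) * \<epsilon>1 * c6 * e * L2_set (U j n) ?G" for j
      using \<epsilon> c6 e by simp
    show "0 \<le> g 0" by (simp add: g_def)
  qed (rule Nt)
  then show ?thesis by (simp add: g_def)
qed

section \<open>The error of the recovered solution\<close>

lemma L1_norm_eq_integral:
  "g absolutely_integrable_on S \<Longrightarrow> L1_norm S g = integral S (\<lambda>x. \<bar>g x\<bar>)"
  unfolding L1_norm_def
  by (rule set_lebesgue_integral_eq_integral(2)) (rule set_integrable_abs)

lemma absolutely_integrable_on_cube: "continuous_on (cube a) g \<Longrightarrow> g absolutely_integrable_on cube a"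
  for g :: "real^'d \<Rightarrow> real"
  unfolding cube_def by (rule absolutely_integrable_continuous)

text \<open>
  The triangle inequality for a freezing error \<open>a\<close>, an interpolation error \<open>b\<close> and a grid error \<open>c\<close>, the
  last two of which are multiplied by a function bounded by \<open>e\<close>.
\<close>

lemma L1_norm_three_terms:
  fixes g a b c :: "real^'d \<Rightarrow> real"
  assumes abs_int: "g absolutely_integrable_on S" "a absolutely_integrable_on S" "b absolutely_integrable_on S" "c absolutely_integrable_on S"
    and bound: "\<And>x. x \<in> S \<Longrightarrow> \<bar>g x\<bar> \<le> \<bar>a x\<bar> + e * (\<bar>b x\<bar> + \<bar>c x\<bar>)"
  shows "L1_norm S g \<le> L1_norm S a + e * (L1_norm S b + L1_norm S c)"
proof -
  have i: "(\<lambda>x. \<bar>q x\<bar>) integrable_on S" if "q absolutely_integrable_on S" for q :: "real^'d \<Rightarrow> real"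
    using that unfolding absolutely_integrable_on_def by simp
  note ints = i[OF abs_int(1)] i[OF abs_int(2)] i[OF abs_int(3)] i[OF abs_int(4)]
  have "integral S (\<lambda>x. \<bar>g x\<bar>) \<le> integral S (\<lambda>x. \<bar>a x\<bar> + e * (\<bar>b x\<bar> + \<bar>c x\<bar>))"
    using bound by (intro integral_le ints integrable_add integrable_on_mult_right)
  also have "\<dots> = integral S (\<lambda>x. \<bar>a x\<bar>) + e * (integral S (\<lambda>x. \<bar>b x\<bar>) + integral S (\<lambda>x. \<bar>c x\<bar>))"
    by (subst integral_add, (intro integral_le ints integrable_add integrable_on_mult_right)+,
        subst integral_mult_right, subst integral_add, (intro ints)+) simp
  finally show ?thesis using abs_int by (simp add: L1_norm_eq_integral)
qed

lemma absolutely_integrable_on_cube_mult: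
  fixes g k :: "real^'d \<Rightarrow> real"
  assumes k: "continuous_on (cube a) k" and g: "g absolutely_integrable_on cube a"
  shows "(\<lambda>x. k x * g x) absolutely_integrable_on cube a"
proof (rule absolutely_integrable_bounded_measurable_product[OF bilinear_times _ _ _ g])
  show "k \<in> borel_measurable (lebesgue_on (cube a))"
    using k by (rule continuous_imp_measurable_on_sets_lebesgue) (simp add: cube_def)
  show "bounded (k ` cube a)"
    by (intro compact_imp_bounded compact_continuous_image k) simp
qed (simp add: cube_def)

lemma interp_operator_error:
  fixes P :: "(('d::finite \<Rightarrow> nat) \<Rightarrow> real) \<Rightarrow> real^'d \<Rightarrow> real"
  assumes P: "interp_operator a N CI \<V> P" and N: "N \<ge> 1"
    and close: "\<And>l. l \<in> grid N \<Longrightarrow> \<bar>V l - W l\<bar> \<le> m"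
  shows "L1_norm (cube a) (\<lambda>x. P V x - P W x) \<le> \<bar>CI\<bar> * m"
    "(\<lambda>x. P V x - P W x) absolutely_integrable_on cube a"
proof -
  let ?D = "\<lambda>l. V l - W l"
  have lin: "P ?D x = P V x - P W x" if x: "x \<in> cube a" for x
  proof -
    have "P (\<lambda>l. V l + (- 1) * W l) x = P V x + P (\<lambda>l. (- 1) * W l) x"
      by (rule P[unfolded interp_operator_def, THEN conjunct1, rule_format, OF x])
    also have "P (\<lambda>l. (- 1) * W l) x = (- 1) * P W x"
      by (rule P[unfolded interp_operator_def, THEN conjunct2, THEN conjunct1, rule_format, OF x])
    finally show ?thesis by simp
  qed
  have ai: "P ?D absolutely_integrable_on cube a"
    using P unfolding interp_operator_def by blast
  have "P V absolutely_integrable_on cube a" "P W absolutely_integrable_on cube a"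
    using P unfolding interp_operator_def by blast+
  then show ai': "(\<lambda>x. P V x - P W x) absolutely_integrable_on cube a"
    by (rule set_integral_diff(1))
  have mx: "Max ((\<lambda>l. \<bar>?D l\<bar>) ` grid N) \<le> m"
    using close grid_nonempty[OF N] by (subst Max_le_iff) auto
  have nn: "0 \<le> Max ((\<lambda>l. \<bar>?D l\<bar>) ` grid N)"
  proof -
    obtain l :: "'d \<Rightarrow> nat" where l: "l \<in> grid N" using grid_nonempty[OF N] by blast
    have "\<bar>?D l\<bar> \<le> Max ((\<lambda>l. \<bar>?D l\<bar>) ` grid N)" using l by (intro Max_ge) auto
    then show ?thesis using abs_ge_zero[of "?D l"] by linarith
  qed
  have "L1_norm (cube a) (\<lambda>x. P V x - P W x) = L1_norm (cube a) (P ?D)"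
    using ai ai' by (simp add: L1_norm_eq_integral) (rule integral_cong, simp add: lin)
  also have "\<dots> \<le> CI * Max ((\<lambda>l. \<bar>?D l\<bar>) ` grid N)"
    using P unfolding interp_operator_def by blast
  also have "\<dots> \<le> \<bar>CI\<bar> * Max ((\<lambda>l. \<bar>?D l\<bar>) ` grid N)"
    using nn by (intro mult_right_mono) auto
  also have "\<dots> \<le> \<bar>CI\<bar> * m" using mx by (intro mult_left_mono) auto
  finally show "L1_norm (cube a) (\<lambda>x. P V x - P W x) \<le> \<bar>CI\<bar> * m" .
qed

lemma smooth_on_uminus:
  assumes "smooth_on S g" shows "smooth_on S (\<lambda>x. - g x)"
proof -
  obtain D where D: "\<And>x. x \<in> S \<Longrightarrow> D [] x = g x"
    "\<And>bs x. bs \<in> lists Basis \<Longrightarrow> x \<in> S \<Longrightarrow> (D bs has_derivative (\<lambda>v. \<Sum>b\<in>Basis. (v \<bullet> b) * D (b # bs) x)) (at x within S)"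
    "\<And>bs. bs \<in> lists Basis \<Longrightarrow> continuous_on S (D bs)"
    by (rule smooth_on_obtain[OF assms]) blast
  have "((\<lambda>x. - D bs x) has_derivative (\<lambda>v. \<Sum>b\<in>Basis. (v \<bullet> b) * - D (b # bs) x)) (at x within S)"
    if "bs \<in> lists Basis" "x \<in> S" for bs x
    using has_derivative_minus[OF D(2)[OF that]] by (simp add: sum_negf)
  then show ?thesis
    unfolding smooth_on_def by (intro exI[of _ "\<lambda>bs x. - D bs x"]) (simp add: D(1))
qed

lemma gradient_eq_pderiv:
  fixes g :: "real^'d \<Rightarrow> real"
  assumes a: "a > 0" and G: "has_gradient_on (cube a) g G" and g: "g differentiable (at x)" and x: "x \<in> cube a"
  shows "G x $ i = pderiv_within UNIV i g x"
proof -
  have "(g has_derivative (\<lambda>v. v \<bullet> grad UNIV g x)) (at x within cube a)"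
    using has_derivative_grad[OF g] has_derivative_at_withinI by blast
  moreover have "(g has_derivative (\<lambda>v. v \<bullet> G x)) (at x within cube a)"
    using G x by (simp add: has_gradient_on_def)
  ultimately have "(\<lambda>v. v \<bullet> G x) = (\<lambda>v. v \<bullet> grad UNIV g x)"
    using cube_has_derivative_unique[OF a x] by blast
  then have "axis i 1 \<bullet> G x = axis i 1 \<bullet> grad UNIV g x" by (rule fun_cong)
  then show ?thesis by (simp add: inner_axis' grad_def)
qed

theorem theorem5p7:
  fixes f h :: "real^'d \<Rightarrow> real^'d"
    and y :: "real \<Rightarrow> real^'d"
    and \<sigma>0 :: "real^'d \<Rightarrow> real"
    and u :: "real^'d \<Rightarrow> real \<Rightarrow> real"
    and uj :: "nat \<Rightarrow> real^'d \<Rightarrow> real \<Rightarrow> real"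
    and a T \<alpha> Cf Lf Ch c1 c2 c3 c4 c5 CI :: real
    and Nt :: nat
  assumes a_pos: "a > 0" and T_pos: "T > 0" and Nt_pos: "Nt \<ge> 1"
    and y0: "y 0 = 0"
    and density: "\<And>x. \<sigma>0 x \<ge> 0" "integrable lebesgue \<sigma>0" "(LINT x|lebesgue. \<sigma>0 x) = 1"
    and f_diff: "\<And>x. f differentiable (at x)"
    and K_diff: "\<And>x t. t \<in> {0..T} \<Longrightarrow> (\<lambda>z. obsK h y z t) differentiable (at x)"
    and gradK_diff: "\<And>x t. t \<in> {0..T} \<Longrightarrow> grad UNIV (\<lambda>z. obsK h y z t) differentiable (at x)"
    and dmz: "solves_dirichlet (cube a) 0 T (dmzF f h y) (dmzJ f h y) \<sigma>0 u"
    and uj0: "\<And>x. x \<in> cube a \<Longrightarrow> uj 0 x (tnode T Nt 0) = \<sigma>0 x"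
    and frozen: "\<And>j. j \<in> {1..Nt} \<Longrightarrow>
          solves_dirichlet (cube a) (tnode T Nt (j - 1)) (tnode T Nt j)
            (\<lambda>x t. dmzF f h y x (tnode T Nt (j - 1))) (\<lambda>x t. dmzJ f h y x (tnode T Nt (j - 1)))
            (\<lambda>x. uj (j - 1) x (tnode T Nt (j - 1))) (uj j)"
    and utilde_smooth: "\<And>j. j \<in> {1..Nt} \<Longrightarrow>
          smooth_on (cube a \<times> {tnode T Nt (j - 1)..tnode T Nt j}) (\<lambda>(x, t). utilde h y T Nt uj j x t)"
    and Asm1: "\<And>x t. t \<in> {0..T} \<Longrightarrow>
          - 1/2 * (h x \<bullet> h x) - 1/2 * laplacian UNIV (\<lambda>z. obsK h y z t) x
          - f x \<bullet> grad UNIV (\<lambda>z. obsK h y z t) x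
          + 1/2 * (norm (grad UNIV (\<lambda>z. obsK h y z t) x))\<^sup>2
          + norm (f x - grad UNIV (\<lambda>z. obsK h y z t) x) \<le> c1"
    and Asm2: "Cf > 0" "Lf > 0"
          "\<And>x i. x \<in> cube a \<Longrightarrow> \<bar>f x $ i\<bar> \<le> Cf"
          "\<And>x z i. x \<in> cube a \<Longrightarrow> z \<in> cube a \<Longrightarrow> \<bar>f x $ i - f z $ i\<bar> \<le> Lf * norm (x - z)"
    and Asm3: "\<And>x i. x \<in> cube a \<Longrightarrow> \<bar>h x $ i\<bar> \<le> Ch"
    and Asm4: "\<And>x j. x \<in> cube a \<Longrightarrow> j \<le> Nt \<Longrightarrow> \<bar>2 * obsK h y x (tnode T Nt j)\<bar> \<le> c2"
    and alpha: "0 < \<alpha>" "\<alpha> \<le> 1"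
    and R_smooth:
          "\<And>t i. t \<in> {0..T} \<Longrightarrow> smooth_on (cube a) (\<lambda>x. dmzF f h y x t $ i)"
          "\<And>t. t \<in> {0..T} \<Longrightarrow> smooth_on (cube a) (\<lambda>x. dmzJ f h y x t)"
    and R_bound: "\<And>x t. x \<in> cube a \<Longrightarrow> t \<in> {0..T} \<Longrightarrow>
          \<bar>divergence UNIV (\<lambda>z. dmzF f h y z t) x\<bar> + 2 * \<bar>dmzJ f h y x t\<bar> + norm (dmzF f h y x t) \<le> c3"
    and R_hoelder: "\<And>x t s. x \<in> cube a \<Longrightarrow> t \<in> {0..T} \<Longrightarrow> s \<in> {0..T} \<Longrightarrow>
          norm (dmzF f h y x t - dmzF f h y x s)
          + \<bar>divergence UNIV (\<lambda>z. dmzF f h y z t) x - divergence UNIV (\<lambda>z. dmzF f h y z s) x\<bar>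
          + \<bar>dmzJ f h y x t - dmzJ f h y x s\<bar> \<le> c4 * \<bar>t - s\<bar> powr \<alpha>"
    and c5: "c5 = c4 * exp (c3 * T) + c4 * sqrt (measure lebesgue (cube a :: (real^'d) set))
          * exp (c3\<^sup>2 * T)
          * sqrt (2 * c3\<^sup>2 * T * (LINT x:cube a|lebesgue. (u x 0)\<^sup>2)
                  + (LINT x:cube a|lebesgue. (norm (grad (cube a) (\<lambda>z. u z 0) x))\<^sup>2))"
  shows "\<exists>C>0. \<forall>N n \<tau> \<epsilon>1 \<epsilon>2 A U Eh Mh Uh0 UhT P.
    N \<ge> 2 \<longrightarrow> \<tau> > 0 \<longrightarrow> real n = (T / real Nt) / \<tau> \<longrightarrow> \<epsilon>1 \<ge> 0 \<longrightarrow> \<epsilon>2 \<ge> 0 \<longrightarrow>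
    mesh a N < 1 / Cf \<longrightarrow>
    \<tau> < inverse (real CARD('d) / (mesh a N)\<^sup>2 + real CARD('d) * Lf + real CARD('d) / 2 * Ch\<^sup>2) \<longrightarrow>
    fd_matrix a N f h A \<longrightarrow>
    fd_solution a N f h y \<sigma>0 T Nt n \<tau> U \<longrightarrow>
    qtt_solution a N h y T Nt (fd_propagator N n \<tau> A) (U 0 n) \<epsilon>1 \<epsilon>2 Eh Mh Uh0 UhT \<longrightarrow>
    interp_operator a N CI ((\<lambda>j x. utilde h y T Nt uj j x (tnode T Nt j)) ` {1..Nt}) P \<longrightarrow>
    (let d = real CARD('d); \<Delta>T = T / real Nt;
         err = (\<lambda>x. u x T - exp (- (h x \<bullet> y (tnode T Nt (Nt - 1)))) * P (UhT Nt) x);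
         c6 = spectral_norm (grid N) (fd_propagator N n \<tau> A);
         c7 = (1 + \<epsilon>2) * (1 + \<epsilon>1) * c6 * exp c2
     in err absolutely_integrable_on cube a \<and>
        L1_norm (cube a) err
        \<le> 2 * c5 / (\<alpha> + 1) * (T powr (\<alpha> + 1) * exp (c3 * T) / real Nt powr \<alpha>)
          + C * exp c2 *
              (C * exp (c2 * real Nt + T * d * Lf) / (d * Lf * (exp (c2 + \<Delta>T * d * Lf) - 1))
                 * (\<tau> + (mesh a N)\<^sup>2)
               + (mesh a N)\<^sup>2 * L2_norm (cube a) (laplacian (cube a) (\<lambda>x. utilde h y T Nt uj Nt x T)))
          + C * exp c2 * c7 ^ Nt * \<epsilon>1 * L2_set (U 0 n) (grid N)
          + C * exp c2 * (\<Sum>j=1..Nt. c7 ^ (Nt - j) *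
              ((1 + \<epsilon>2) * \<epsilon>1 * c6 * exp c2 * L2_set (U (j - 1) n) (grid N)
               + \<epsilon>2 * c6 * L2_set (U j 0) (grid N))))"
proof -
  let ?S = "cube a :: (real^'d) set" and ?\<Delta> = "T / real Nt" and ?L = "real CARD('d) * Lf"
  let ?F = "dmzF f h y" and ?J = "dmzJ f h y" and ?t = "tnode T Nt" and ?w = "utilde h y T Nt uj"
  note t_in = tnode_in[OF T_pos]

  have F_diff: "(\<lambda>z. ?F z t) differentiable (at x)" if "t \<in> {0..T}" for t x
    unfolding dmzF_def using f_diff gradK_diff[OF that] by (intro differentiable_add differentiable_minus)
  have "\<exists>DF. \<forall>i t. t \<in> {0..T} \<longrightarrow> has_gradient_on ?S (\<lambda>x. ?F x t $ i) (\<lambda>x. DF i x t)"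
  proof -
    have "\<exists>G. t \<in> {0..T} \<longrightarrow> has_gradient_on ?S (\<lambda>x. ?F x t $ i) G" for t i
      using smooth_on_imp_has_gradient_on[OF R_smooth(1)[of t i]] by blast
    then obtain G where "\<And>t i. t \<in> {0..T} \<longrightarrow> has_gradient_on ?S (\<lambda>x. ?F x t $ i) (G t i)" by metis
    then show ?thesis by (intro exI[of _ "\<lambda>i x t. G t i x"]) simp
  qed
  then obtain DF where DF: "\<And>i t. t \<in> {0..T} \<Longrightarrow> has_gradient_on ?S (\<lambda>x. ?F x t $ i) (\<lambda>x. DF i x t)"
    by blast
  have F_cont: "continuous_on ?S (\<lambda>x. ?F x t)" if "t \<in> {0..T}" for t
    by (rule has_gradient_on_components_continuous[OF DF[OF that]])
  have J_cont: "continuous_on ?S (\<lambda>x. ?J x t)" if t: "t \<in> {0..T}" for t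
  proof -
    obtain G where "has_gradient_on ?S (\<lambda>x. ?J x t) G"
      by (rule smooth_on_imp_has_gradient_on[OF R_smooth(2)[OF t]])
    then show ?thesis by (rule has_gradient_on_imp_continuous_on)
  qed
  have div_F: "divergence UNIV (\<lambda>z. ?F z t) x = (\<Sum>i\<in>UNIV. DF i x t $ i)" if "x \<in> ?S" "t \<in> {0..T}" for x t
    unfolding divergence_def
    using gradient_eq_pderiv[OF a_pos DF[OF that(2)] differentiable_vec_nth[OF F_diff[OF that(2)]] that(1)] by simp

  interpret U: dirichlet_function a 0 T u "\<lambda>x t. time_deriv {0..T} (u x) t"
     "\<lambda>x t. grad ?S (\<lambda>z. u z t) x" "\<lambda>i x t. grad ?S (pderiv_within ?S i (\<lambda>z. u z t)) x"
    by (rule solves_dirichlet_imp_dirichlet_function[OF T_pos dmz])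
  have u0: "u x 0 = \<sigma>0 x" if "x \<in> ?S" for x
    using dmz that by (simp add: solves_dirichlet_def)
  have T0: "0 \<in> {0..T}" "T \<in> {0..T}" using T_pos by auto
  have lebesgue_HK: "(LINT x:?S|lebesgue. g x) = integral ?S g" if "continuous_on ?S g" for g :: "real^'d \<Rightarrow> real"
    by (rule set_lebesgue_integral_eq_integral(2)[OF absolutely_integrable_on_cube[OF that]])
  have mass: "integral ?S (\<lambda>x. \<bar>u x 0\<bar>) \<le> 1"
  proof -
    have "integral ?S (\<lambda>x. \<bar>u x 0\<bar>) = (LINT x:?S|lebesgue. \<bar>u x 0\<bar>)"
      by (rule lebesgue_HK[symmetric]) (intro continuous_intros U.cont_slice T0)
    also have "\<dots> = (LINT x:?S|lebesgue. \<sigma>0 x)"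
      using u0 density(1) by (intro set_lebesgue_integral_cong) (auto simp: cube_def)
    also have "\<dots> \<le> (LINT x|lebesgue. \<sigma>0 x)"
      unfolding set_lebesgue_integral_def
      by (intro integral_mono integrable_mult_indicator density(2))
         (auto simp: cube_def indicator_def density(1))
    finally show ?thesis using density(3) by simp
  qed
  have c5': "c5 = c4 * exp (c3 * T) + c4 * sqrt (measure lborel ?S) * exp (c3\<^sup>2 * T)
          * sqrt (2 * c3\<^sup>2 * T * integral ?S (\<lambda>x. (u x 0)\<^sup>2)
                  + integral ?S (\<lambda>x. (norm (grad ?S (\<lambda>z. u z 0) x))\<^sup>2))"
  proof -
    have "measure lebesgue ?S = measure lborel ?S" by (simp add: cube_def measure_completion)
    moreover have "(LINT x:?S|lebesgue. (u x 0)\<^sup>2) = integral ?S (\<lambda>x. (u x 0)\<^sup>2)"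
      by (rule lebesgue_HK) (intro continuous_intros U.cont_slice T0)
    moreover have "(LINT x:?S|lebesgue. (norm (grad ?S (\<lambda>z. u z 0) x))\<^sup>2) = integral ?S (\<lambda>x. (norm (grad ?S (\<lambda>z. u z 0) x))\<^sup>2)"
      by (rule lebesgue_HK) (intro continuous_intros U.cont_slice T0)
    ultimately show ?thesis unfolding c5 by simp
  qed
  have R_bound': "\<bar>\<Sum>i\<in>UNIV. DF i x t $ i\<bar> + 2 * \<bar>?J x t\<bar> + norm (?F x t) \<le> c3"
    if "x \<in> ?S" "t \<in> {0..T}" for x t
    using R_bound[OF that] by (simp add: div_F[OF that])
  have R_hoelder': "norm (?F x t - ?F x s) + \<bar>?J x t - ?J x s\<bar> \<le> c4 * \<bar>t - s\<bar> powr \<alpha>"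
    if "x \<in> ?S" "t \<in> {0..T}" "s \<in> {0..T}" for x t s
    using R_hoelder[OF that] by linarith
  note fe = freezing_error[where F="?F" and J="?J" and DF=DF and uj=uj, OF a_pos T_pos Nt_pos alpha(1) dmz uj0 frozen
      DF J_cont R_bound' R_hoelder' mass c5']
  have c5_nonneg: "c5 \<ge> 0" by (rule fe(1))
  have freezing: "integral ?S (\<lambda>x. \<bar>u x T - uj Nt x T\<bar>) \<le> exp (c3 * T) * c5 * (T * ?\<Delta> powr \<alpha> / (\<alpha> + 1))"
    by (rule fe(2))

  \<comment> \<open>As \<open>y 0 = 0\<close>, the drift at time zero is \<open>- f\<close>; so the smoothness of the drift is inherited by \<open>f\<close>.\<close>
  have f_smooth: "smooth_on ?S (\<lambda>x. f x $ i)" for i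
  proof -
    have "(\<lambda>x. - (?F x 0 $ i)) = (\<lambda>x. f x $ i)"
      by (simp add: dmzF_def obsK_def y0 grad_def pderiv_within_def)
    then show ?thesis using smooth_on_uminus[OF R_smooth(1)[OF T0(1), of i]] by simp
  qed
  have t_step: "?t (j - 1) < ?t j" "?t (j - 1) \<in> {0..T}" "?t j \<in> {0..T}" if "j \<in> {1..Nt}" for j
    using that T_pos t_in[of "j - 1" Nt] t_in[of j Nt] tnode_Suc[of T Nt "j - 1"] by auto
  have "\<exists>B\<ge>0. \<forall>N l t \<tau>. N \<ge> 2 \<longrightarrow> l \<in> grid_interior N \<longrightarrow> \<tau> > 0 \<longrightarrow> ?t (j - 1) \<le> t \<longrightarrow> t + \<tau> \<le> ?t j \<longrightarrow>
       \<bar>(?w j (gpt a N l) (t + \<tau>) - ?w j (gpt a N l) t) / \<tau> - fd_rhs a N f h (\<lambda>l. ?w j (gpt a N l) t) l\<bar>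
         \<le> B * (\<tau> + (mesh a N)\<^sup>2)" if j: "j \<in> {1..Nt}" for j
  proof -
    let ?K = "\<lambda>z. obsK h y z (?t (j - 1))"
    obtain D where D: "\<And>p. p \<in> ?S \<times> {?t (j - 1)..?t j} \<Longrightarrow> D [] p = (\<lambda>(x, t). ?w j x t) p"
      "\<And>bs p. bs \<in> lists Basis \<Longrightarrow> p \<in> ?S \<times> {?t (j - 1)..?t j} \<Longrightarrow>
        (D bs has_derivative (\<lambda>v. \<Sum>b\<in>Basis. (v \<bullet> b) * D (b # bs) p)) (at p within ?S \<times> {?t (j - 1)..?t j})"
      by (rule smooth_on_obtain[OF utilde_smooth[OF j]]) blast
    have D0: "D [] (x, t) = ?w j x t" if "x \<in> ?S" "t \<in> {?t (j - 1)..?t j}" for x t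
      using D(1)[of "(x, t)"] that by simp
    have sol: "solves_dirichlet ?S (?t (j - 1)) (?t j) (\<lambda>x t. - f x + grad UNIV ?K x) (\<lambda>x t. ?J x (?t (j - 1)))
        (\<lambda>x. uj (j - 1) x (?t (j - 1))) (uj j)"
      using frozen[OF j] by (simp add: dmzF_def)
    have F_c: "continuous_on ?S (\<lambda>x. - f x + grad UNIV ?K x)"
      using F_cont[OF t_step(2)[OF j]] by (simp add: dmzF_def)
    have J_eq: "?J x (?t (j - 1)) = - divergence UNIV f x - 1/2 * (h x \<bullet> h x) + 1/2 * laplacian UNIV ?K x
         - f x \<bullet> grad UNIV ?K x + 1/2 * (norm (grad UNIV ?K x))\<^sup>2" for x
      by (simp add: dmzJ_def)
    have fke: "D [time_dir] (x, t) = 1/2 * (\<Sum>i\<in>UNIV. D [space_dir i, space_dir i] (x, t))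
     - (\<Sum>i\<in>UNIV. f x $ i * D [space_dir i] (x, t)) - (divergence UNIV f x + 1/2 * (h x \<bullet> h x)) * D [] (x, t)"
      if "x \<in> ?S" "t \<in> {?t (j - 1)..?t j}" for x t
    proof (rule kolmogorov_equation[OF a_pos t_step(1)[OF j] sol F_c J_cont[OF t_step(2)[OF j]] J_eq
          K_diff[OF t_step(2)[OF j]] gradK_diff[OF t_step(2)[OF j]] _ D(2) that])
      show "D [] (x, t) = exp (?K x) * uj j x t" if "x \<in> ?S" "t \<in> {?t (j - 1)..?t j}" for x t
        using D0[OF that] by (simp add: utilde_def obsK_def)
    qed
    show ?thesis
      by (rule fd_consistency[OF a_pos t_step(1)[OF j] D0 D(2) f_smooth f_diff fke])
  qed
  then obtain B where B: "\<And>j. j \<in> {1..Nt} \<Longrightarrow> B j \<ge> 0"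
    "\<And>j N l t \<tau>. j \<in> {1..Nt} \<Longrightarrow> N \<ge> 2 \<Longrightarrow> l \<in> grid_interior N \<Longrightarrow> \<tau> > 0 \<Longrightarrow> ?t (j - 1) \<le> t \<Longrightarrow> t + \<tau> \<le> ?t j \<Longrightarrow>
       \<bar>(?w j (gpt a N l) (t + \<tau>) - ?w j (gpt a N l) t) / \<tau> - fd_rhs a N f h (\<lambda>l. ?w j (gpt a N l) t) l\<bar>
         \<le> B j * (\<tau> + (mesh a N)\<^sup>2)"
    by metis
  define BB where "BB = (\<Sum>j\<in>{1..Nt}. B j)"
  have BB: "BB \<ge> 0" "\<And>j. j \<in> {1..Nt} \<Longrightarrow> B j \<le> BB"
    unfolding BB_def using B(1) by (auto intro!: sum_nonneg member_le_sum)

  have c2: "c2 \<ge> 0"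
    using Asm4[of 0 0] a_pos by (force simp: cube_def mem_box_cart)
  have K_bound: "\<bar>h x \<bullet> y (?t j)\<bar> \<le> c2 / 2" if "x \<in> ?S" "j \<le> Nt" for x j
    using Asm4[OF that] by (simp add: obsK_def)
  have E_bound: "\<bar>Efun a N h y T Nt j l\<bar> \<le> exp c2"
    if "N \<ge> 2" "j \<in> {1..<Nt}" "l \<in> grid N" for N j l
  proof -
    have x: "gpt a N l \<in> ?S" by (rule gpt_in_cube[OF a_pos that(1,3)])
    have "h (gpt a N l) \<bullet> (y (?t j) - y (?t (j - 1))) \<le> c2"
    proof -
      have "j \<le> Nt" "j - 1 \<le> Nt" using that(2) by auto
      from K_bound[OF x this(1)] K_bound[OF x this(2)] show ?thesis
        unfolding inner_diff_right by linarith
    qed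
    then show ?thesis by (simp add: Efun_def)
  qed
  have e1: "1 \<le> exp c2" using c2 by simp

  have w_boundary: "?w j x t = 0" if "j \<in> {1..Nt}" "x \<in> frontier ?S" "t \<in> {?t (j - 1)..?t j}" for j x t
    using frozen[OF that(1)] that by (simp add: utilde_def solves_dirichlet_def)
  have w_initial: "?w 1 x 0 = \<sigma>0 x" if "x \<in> ?S" for x
    using frozen[of 1] Nt_pos uj0[OF that] that by (simp add: utilde_def solves_dirichlet_def y0)
  have w_restart: "?w (j + 1) (gpt a N l) (?t j) = Efun a N h y T Nt j l * ?w j (gpt a N l) (?t j)"
    if "N \<ge> 2" "j \<in> {1..<Nt}" "l \<in> grid N" for N j l
  proof -
    have "uj (j + 1) (gpt a N l) (?t j) = uj j (gpt a N l) (?t j)"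
      using frozen[of "j + 1"] that gpt_in_cube[OF a_pos that(1,3)] by (simp add: solves_dirichlet_def)
    then show ?thesis
      by (simp add: utilde_def Efun_def inner_diff_right flip: exp_add mult.assoc)
  qed

  define Q where "Q = exp c2 * exp (?\<Delta> * ?L)"
  define C0 where "C0 = real Nt * (Q ^ Nt * (?\<Delta> * BB))"
  define X where "X = exp (c2 * real Nt + T * real CARD('d) * Lf) / (real CARD('d) * Lf * (exp (c2 + ?\<Delta> * real CARD('d) * Lf) - 1))"
  \<comment> \<open>\<open>C0\<close> is the constant of the finite difference error at time \<open>T\<close>. Dividing by the factor \<open>X\<close> of the claim yields \<open>C0 \<le> C X\<close>.\<close>
  define C where "C = 1 + \<bar>CI\<bar> + C0 / X"
  have \<Delta>: "?\<Delta> > 0" using T_pos Nt_pos by simp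
  have C0: "C0 \<ge> 0"
    unfolding C0_def Q_def using BB(1) less_imp_le[OF \<Delta>] by (intro mult_nonneg_nonneg zero_le_power) auto
  have X: "X > 0"
  proof -
    have "0 < ?\<Delta> * real CARD('d) * Lf" using \<Delta> Asm2(2) by (intro mult_pos_pos) auto
    then have "1 < exp (c2 + ?\<Delta> * real CARD('d) * Lf)" using c2 by simp
    then show ?thesis using Asm2(2) by (simp add: X_def)
  qed
  have C: "C > 0" "\<bar>CI\<bar> \<le> C" "\<bar>CI\<bar> * C0 \<le> C * (C * X)"
  proof -
    have "0 \<le> C0 / X" using C0 X by simp
    then show "C > 0" "\<bar>CI\<bar> \<le> C" by (simp_all add: C_def)
    have "C0 = (C0 / X) * X" using X by simp
    also have "\<dots> \<le> C * X" using X by (intro mult_right_mono) (auto simp: C_def)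
    finally show "\<bar>CI\<bar> * C0 \<le> C * (C * X)"
      using \<open>\<bar>CI\<bar> \<le> C\<close> C0 by (intro mult_mono) auto
  qed

  show ?thesis
  proof (intro exI[of _ C] conjI allI impI)
    show "C > 0" by (rule C(1))
    fix N n \<tau> \<epsilon>1 \<epsilon>2 A U Eh Mh Uh0 UhT P
    assume N: "N \<ge> 2" and \<tau>: "\<tau> > 0" and n: "real n = (T / real Nt) / \<tau>" and \<epsilon>: "\<epsilon>1 \<ge> 0" "\<epsilon>2 \<ge> 0"
      and mesh: "mesh a N < 1 / Cf"
      and cfl: "\<tau> < inverse (real CARD('d) / (mesh a N)\<^sup>2 + real CARD('d) * Lf + real CARD('d) / 2 * Ch\<^sup>2)"
      and A: "fd_matrix a N f h A" and sol: "fd_solution a N f h y \<sigma>0 T Nt n \<tau> U"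
      and qtt: "qtt_solution a N h y T Nt (fd_propagator N n \<tau> A) (U 0 n) \<epsilon>1 \<epsilon>2 Eh Mh Uh0 UhT"
      and P: "interp_operator a N CI ((\<lambda>j x. ?w j x (?t j)) ` {1..Nt}) P"
    let ?\<eta> = "mesh a N"
    let ?c6 = "spectral_norm (grid N) (fd_propagator N n \<tau> A)"
    let ?c7 = "(1 + \<epsilon>2) * (1 + \<epsilon>1) * ?c6 * exp c2"
    let ?err = "\<lambda>x. u x T - exp (- (h x \<bullet> y (?t (Nt - 1)))) * P (UhT Nt) x"
    define S1 where "S1 = ?c7 ^ Nt * (\<epsilon>1 * L2_set (U 0 n) (grid N))"
    define S2 where "S2 = (\<Sum>j=1..Nt. ?c7 ^ (Nt - j) *
              ((1 + \<epsilon>2) * \<epsilon>1 * ?c6 * exp c2 * L2_set (U (j - 1) n) (grid N)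
               + \<epsilon>2 * ?c6 * L2_set (U j 0) (grid N)))"
    define \<delta> where "\<delta> = \<tau> + ?\<eta>\<^sup>2"
    define W where "W l = ?w Nt (gpt a N l) T" for l
    define lapn where "lapn = L2_norm ?S (laplacian ?S (\<lambda>x. ?w Nt x T))"
    have \<delta>: "\<delta> \<ge> 0" using \<tau> by (simp add: \<delta>_def)
    have \<eta>: "?\<eta> > 0" by (rule mesh_pos[OF a_pos N])
    have cfl': "\<tau> * (real CARD('d) / ?\<eta>\<^sup>2 + real CARD('d) * Lf + real CARD('d) / 2 * Ch\<^sup>2) \<le> 1"
    proof -
      define z where "z = real CARD('d) / ?\<eta>\<^sup>2 + real CARD('d) * Lf + real CARD('d) / 2 * Ch\<^sup>2"
      have "z > 0" unfolding z_def using \<eta> Asm2(2) by (intro add_pos_nonneg) auto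
      then have "\<tau> * z \<le> inverse z * z" using cfl unfolding z_def[symmetric] by (intro mult_right_mono) auto
      then show ?thesis using \<open>z > 0\<close> by (simp add: z_def)
    qed
    interpret scheme: fd_scheme a N f h Cf Lf Ch \<tau>
      by (rule fd_scheme.intro[OF a_pos N Asm2(1,3,2,4) Asm3 mesh \<tau> cfl'])
    have fd: "\<bar>U Nt n l - W l\<bar> \<le> C0 * \<delta>" if l: "l \<in> grid N" for l
    proof -
      have "\<bar>U Nt n l - ?w Nt (gpt a N l) (?t Nt)\<bar>
          \<le> real Nt * ((exp c2 * exp (?\<Delta> * ?L)) ^ Nt * (?\<Delta> * (BB * \<delta>)))"
      proof (rule scheme.fd_error_at_nodes[where w="?w", OF T_pos _ sol w_boundary w_initial
            w_restart[OF N] E_bound[OF N] e1 _ _ Nt_pos order_refl l])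
        show "real n * \<tau> = ?\<Delta>" using n \<tau> by simp
        show "0 \<le> BB * \<delta>" using BB(1) \<delta> by simp
        fix j t and l :: "'d \<Rightarrow> nat" assume j: "j \<in> {1..Nt}" and l: "l \<in> grid_interior N" and t: "?t (j - 1) \<le> t" "t + \<tau> \<le> ?t j"
        have "B j * \<delta> \<le> BB * \<delta>" using BB(2)[OF j] \<delta> by (rule mult_right_mono)
        then show "\<bar>(?w j (gpt a N l) (t + \<tau>) - ?w j (gpt a N l) t) / \<tau> - fd_rhs a N f h (\<lambda>l. ?w j (gpt a N l) t) l\<bar> \<le> BB * \<delta>"
          using B(2)[OF j N l \<tau> t] unfolding \<delta>_def by linarith
      qed
      then show ?thesis using Nt_pos by (simp add: C0_def Q_def W_def mult.assoc)
    qed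
    have qtt_err: "L2_set (\<lambda>l. UhT Nt l - U Nt n l) (grid N) \<le> S1 + S2"
      unfolding S1_def S2_def by (rule qtt_error[OF A sol \<tau> Nt_pos \<epsilon> qtt E_bound[OF N] e1])
    have grid_err: "\<bar>W l - UhT Nt l\<bar> \<le> C0 * \<delta> + (S1 + S2)" if l: "l \<in> grid N" for l
    proof -
      have "\<bar>UhT Nt l - U Nt n l\<bar> \<le> L2_set (\<lambda>l. \<bar>UhT Nt l - U Nt n l\<bar>) (grid N)"
        by (rule member_le_L2_set[OF finite_grid l])
      also have "\<dots> = L2_set (\<lambda>l. UhT Nt l - U Nt n l) (grid N)" by (simp add: L2_set_def)
      finally show ?thesis using fd[OF l] qtt_err by linarith
    qed
    have G: "0 \<le> C0 * \<delta> + (S1 + S2)"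
      by (rule add_nonneg_nonneg[OF mult_nonneg_nonneg[OF C0 \<delta>] order_trans[OF L2_set_nonneg qtt_err]])

    have K_cont: "continuous_on ?S (\<lambda>x. h x \<bullet> y (?t (Nt - 1)))"
    proof -
      have "?t (Nt - 1) \<in> {0..T}" by (rule t_in) simp
      then have "(\<lambda>z. h z \<bullet> y (?t (Nt - 1))) differentiable (at x)" for x
        using K_diff[of "?t (Nt - 1)" x] by (simp add: obsK_def)
      then show ?thesis
        by (intro continuous_at_imp_continuous_on ballI differentiable_imp_continuous_within)
    qed
    have uj_cont: "continuous_on ?S (\<lambda>x. uj Nt x T)"
    proof -
      have "continuous_on (?S \<times> {?t (Nt - 1)..?t Nt}) (\<lambda>(x, t). uj Nt x t)"
        using frozen[of Nt] Nt_pos unfolding solves_dirichlet_def C21_on_def by simp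
      then show ?thesis
        by (rule continuous_on_fix_snd) (use t_step[of Nt] Nt_pos in auto)
    qed
    have w_eq: "?w Nt x T = exp (h x \<bullet> y (?t (Nt - 1))) * uj Nt x T" for x by (simp add: utilde_def)
    have w_cont: "continuous_on ?S (\<lambda>x. ?w Nt x T)"
      unfolding w_eq by (intro continuous_intros K_cont uj_cont)
    have P_int: "P V absolutely_integrable_on ?S" for V
      using P unfolding interp_operator_def by blast
    have u_cont: "continuous_on ?S (\<lambda>x. u x T)" by (rule U.cont_slice(1)[OF T0(2)])
    have a_int: "(\<lambda>x. u x T - uj Nt x T) absolutely_integrable_on ?S"
      by (intro absolutely_integrable_on_cube continuous_intros u_cont uj_cont)
    have b_int: "(\<lambda>x. P W x - ?w Nt x T) absolutely_integrable_on ?S"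
      by (intro set_integral_diff P_int absolutely_integrable_on_cube w_cont)
    note c_err = interp_operator_error[OF P _ grid_err]
    have c_int: "(\<lambda>x. P W x - P (UhT Nt) x) absolutely_integrable_on ?S"
      and c_bound: "L1_norm ?S (\<lambda>x. P W x - P (UhT Nt) x) \<le> \<bar>CI\<bar> * (C0 * \<delta> + (S1 + S2))"
      using c_err N by auto
    have err_int: "?err absolutely_integrable_on ?S"
      by (intro set_integral_diff absolutely_integrable_on_cube u_cont absolutely_integrable_on_cube_mult
            P_int continuous_intros K_cont)
    have L1a: "L1_norm ?S (\<lambda>x. u x T - uj Nt x T) \<le> exp (c3 * T) * c5 * (T * ?\<Delta> powr \<alpha> / (\<alpha> + 1))"
      using freezing by (simp add: L1_norm_eq_integral[OF a_int])
    have L1b: "L1_norm ?S (\<lambda>x. P W x - ?w Nt x T) \<le> CI * ?\<eta>\<^sup>2 * lapn"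
    proof -
      have mem: "(\<lambda>x. ?w Nt x T) \<in> (\<lambda>j x. ?w j x (?t j)) ` {1..Nt}"
        using Nt_pos by (intro image_eqI[of _ _ Nt]) auto
      show ?thesis
        unfolding lapn_def W_def[abs_def]
        by (rule P[unfolded interp_operator_def, THEN conjunct2, THEN conjunct2, THEN conjunct2, THEN bspec, OF mem])
    qed
    have "L1_norm ?S ?err \<le> L1_norm ?S (\<lambda>x. u x T - uj Nt x T)
        + exp c2 * (L1_norm ?S (\<lambda>x. P W x - ?w Nt x T) + L1_norm ?S (\<lambda>x. P W x - P (UhT Nt) x))"
    proof (rule L1_norm_three_terms[OF err_int a_int b_int c_int])
      fix x assume x: "x \<in> ?S"
      let ?k = "exp (- (h x \<bullet> y (?t (Nt - 1))))"
      \<comment> \<open>The factor is at most \<open>exp (c2 / 2)\<close>, since the bound on \<open>2 K\<close> applies at the node.\<close>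
      have k: "?k \<le> exp c2"
        using K_bound[OF x, of "Nt - 1"] c2 by simp
      have "uj Nt x T = ?k * ?w Nt x T" by (simp add: w_eq exp_minus)
      then have "?err x = (u x T - uj Nt x T) + ?k * ((?w Nt x T - P W x) + (P W x - P (UhT Nt) x))"
        by (simp add: algebra_simps)
      also have "\<bar>\<dots>\<bar> \<le> \<bar>u x T - uj Nt x T\<bar> + ?k * (\<bar>?w Nt x T - P W x\<bar> + \<bar>P W x - P (UhT Nt) x\<bar>)"
        by (intro order_trans[OF abs_triangle_ineq] add_left_mono)
           (simp only: abs_mult abs_exp_cancel mult_left_mono[OF abs_triangle_ineq] exp_ge_zero)
      also have "\<dots> \<le> \<bar>u x T - uj Nt x T\<bar> + exp c2 * (\<bar>?w Nt x T - P W x\<bar> + \<bar>P W x - P (UhT Nt) x\<bar>)"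
        using k by (intro add_left_mono mult_right_mono) auto
      finally show "\<bar>?err x\<bar> \<le> \<bar>u x T - uj Nt x T\<bar> + exp c2 * (\<bar>P W x - ?w Nt x T\<bar> + \<bar>P W x - P (UhT Nt) x\<bar>)"
        by (simp add: abs_minus_commute)
    qed
    also have "\<dots> \<le> exp (c3 * T) * c5 * (T * ?\<Delta> powr \<alpha> / (\<alpha> + 1))
        + exp c2 * (CI * ?\<eta>\<^sup>2 * lapn + \<bar>CI\<bar> * (C0 * \<delta> + (S1 + S2)))"
      using L1a L1b c_bound by (intro add_mono mult_left_mono) auto
    also have "\<dots> \<le> 2 * c5 / (\<alpha> + 1) * (T powr (\<alpha> + 1) * exp (c3 * T) / real Nt powr \<alpha>)
        + exp c2 * (C * ?\<eta>\<^sup>2 * lapn + (C * (C * X) * \<delta> + C * (S1 + S2)))"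
    proof (intro add_mono mult_left_mono)
      have "T powr (\<alpha> + 1) * exp (c3 * T) / real Nt powr \<alpha> = exp (c3 * T) * (T * ?\<Delta> powr \<alpha>)"
        using T_pos Nt_pos by (simp add: powr_add powr_divide)
      then have "2 * c5 / (\<alpha> + 1) * (T powr (\<alpha> + 1) * exp (c3 * T) / real Nt powr \<alpha>)
         = 2 * (exp (c3 * T) * c5 * (T * ?\<Delta> powr \<alpha> / (\<alpha> + 1)))" by simp
      moreover have "0 \<le> exp (c3 * T) * c5 * (T * ?\<Delta> powr \<alpha> / (\<alpha> + 1))"
        using c5_nonneg T_pos alpha by simp
      ultimately show "exp (c3 * T) * c5 * (T * ?\<Delta> powr \<alpha> / (\<alpha> + 1))
         \<le> 2 * c5 / (\<alpha> + 1) * (T powr (\<alpha> + 1) * exp (c3 * T) / real Nt powr \<alpha>)" by linarith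
      have lapn: "lapn \<ge> 0"
        unfolding lapn_def L2_norm_def set_lebesgue_integral_def by (intro real_sqrt_ge_zero integral_nonneg_AE) auto
      have "CI \<le> C" using C(2) by linarith
      then have "CI * (?\<eta>\<^sup>2 * lapn) \<le> C * (?\<eta>\<^sup>2 * lapn)" using lapn by (intro mult_right_mono) auto
      then show "CI * ?\<eta>\<^sup>2 * lapn \<le> C * ?\<eta>\<^sup>2 * lapn" by (simp add: mult.assoc)
      have "\<bar>CI\<bar> * C0 * \<delta> \<le> C * (C * X) * \<delta>" using C(3) \<delta> by (rule mult_right_mono)
      moreover have "\<bar>CI\<bar> * (S1 + S2) \<le> C * (S1 + S2)"
        using C(2) qtt_err L2_set_nonneg[of "\<lambda>l. UhT Nt l - U Nt n l" "grid N"]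
        by (intro mult_right_mono) linarith+
      ultimately show "\<bar>CI\<bar> * (C0 * \<delta> + (S1 + S2)) \<le> C * (C * X) * \<delta> + C * (S1 + S2)"
        by (simp add: distrib_left mult.assoc)
    qed simp_all
    finally have bound: "L1_norm ?S ?err \<le> 2 * c5 / (\<alpha> + 1) * (T powr (\<alpha> + 1) * exp (c3 * T) / real Nt powr \<alpha>)
        + exp c2 * (C * ?\<eta>\<^sup>2 * lapn + (C * (C * X) * \<delta> + C * (S1 + S2)))" .
    have "C * X = C * exp (c2 * real Nt + T * real CARD('d) * Lf) / (real CARD('d) * Lf * (exp (c2 + ?\<Delta> * real CARD('d) * Lf) - 1))"
      by (simp add: X_def)
    then have rearranged: "exp c2 * (C * ?\<eta>\<^sup>2 * lapn + (C * (C * X) * \<delta> + C * (S1 + S2)))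
      = C * exp c2 *
              (C * exp (c2 * real Nt + T * real CARD('d) * Lf) / (real CARD('d) * Lf * (exp (c2 + ?\<Delta> * real CARD('d) * Lf) - 1))
                 * (\<tau> + ?\<eta>\<^sup>2) + ?\<eta>\<^sup>2 * lapn)
          + C * exp c2 * ?c7 ^ Nt * \<epsilon>1 * L2_set (U 0 n) (grid N) + C * exp c2 * S2"
      by (simp only: \<delta>_def[symmetric] S1_def) (simp add: algebra_simps)
    show "let d = real CARD('d); \<Delta>T = T / real Nt; err = ?err; c6 = ?c6;
         c7 = (1 + \<epsilon>2) * (1 + \<epsilon>1) * c6 * exp c2
     in err absolutely_integrable_on cube a \<and>
        L1_norm (cube a) err
        \<le> 2 * c5 / (\<alpha> + 1) * (T powr (\<alpha> + 1) * exp (c3 * T) / real Nt powr \<alpha>)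
          + C * exp c2 *
              (C * exp (c2 * real Nt + T * d * Lf) / (d * Lf * (exp (c2 + \<Delta>T * d * Lf) - 1))
                 * (\<tau> + (mesh a N)\<^sup>2)
               + (mesh a N)\<^sup>2 * L2_norm (cube a) (laplacian (cube a) (\<lambda>x. utilde h y T Nt uj Nt x T)))
          + C * exp c2 * c7 ^ Nt * \<epsilon>1 * L2_set (U 0 n) (grid N)
          + C * exp c2 * (\<Sum>j=1..Nt. c7 ^ (Nt - j) *
              ((1 + \<epsilon>2) * \<epsilon>1 * c6 * exp c2 * L2_set (U (j - 1) n) (grid N)
               + \<epsilon>2 * c6 * L2_set (U j 0) (grid N)))"
      unfolding Let_def lapn_def[symmetric] S2_def[symmetric]
      using err_int bound[unfolded rearranged] by (simp only: add.assoc simp_thms)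
  qed
qed

end
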